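(* Let $\sigma>0$ and let $\phi(z)=az+b$ where $a\in\mathbb{R}$, $0<|a|\leq 1$ and $b\in\mathbb{C}$. Then the bounded composition operator $C_\phi$ on the Paley-Wiener space $B^2_\sigma$ satisfies the following. (1) $C_\phi$ is cyclic if and only if $a=1$ and either $b\in\mathbb{C}\setminus\mathbb{R}$, or $b\in\mathbb{R}$ with $0<|b|\leq \pi/\sigma$. (2) $C_\phi$ is never supercyclic. Moreover, the adjoint $C_\phi^*$ is cyclic if and only if $0<|a|<1$ or $C_\phi$ is cyclic.
   Context: For $\sigma>0$, the Paley-Wiener space $B^2_\sigma$ is the Hilbert space of all entire functions of exponential type $\leq\sigma$ whose restrictions to $\mathbb{R}$ belong to $L^2(\mathbb{R})$, with norm $\|f\|^2=\int_{-\infty}^{\infty}|f(t)|^2\,dt$ (and corresponding inner product). For $\phi(z)=az+b$, the composition operator is $C_\phi f=f\circ\phi$; it is bounded on $B^2_\sigma$ when $a\in\mathbb{R}$, $0<|a|\le 1$, $b\in\mathbb{C}$. A bounded linear operator $T$ on a separable Hilbert space $\mathcal{H}$ is cyclic if there exists $f\in\mathcal{H}$ such that the linear span of the orbit $\{T^nf:n=0,1,2,\ldots\}$ is dense in $\mathcal{H}$; it is supercyclic if there exists $f\in\mathcal{H}$ such that the set of all scalar multiples of elements of the orbit, $\{\lambda T^nf:\lambda\in\mathbb{C},\,n=0,1,2,\ldots\}$, is dense in $\mathcal{H}$. *)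

theory Defs
  imports "HOL-Complex_Analysis.Complex_Analysis" "HOL-Library.Function_Algebras"
begin

interpretation cfun: vector_space "\<lambda>(c::complex) (f::complex \<Rightarrow> complex) z. c * f z"
  by unfold_locales (auto simp: fun_eq_iff algebra_simps)

definition exponential_type_le :: "real \<Rightarrow> (complex \<Rightarrow> complex) \<Rightarrow> bool" where
  "exponential_type_le \<sigma> f \<longleftrightarrow>
     (\<forall>\<epsilon>>0. \<exists>C. \<forall>z. cmod (f z) \<le> C * exp ((\<sigma> + \<epsilon>) * cmod z))"

text \<open>Elements are honest functions, not equivalence classes: two entire functions that
  agree almost everywhere on the real line are equal.\<close>

definition paley_wiener :: "real \<Rightarrow> (complex \<Rightarrow> complex) set" where
  "paley_wiener \<sigma> = {f. f holomorphic_on UNIV \<and> exponential_type_le \<sigma> f \<and>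
     integrable lborel (\<lambda>t::real. (cmod (f (complex_of_real t)))\<^sup>2)}"

definition pw_inner :: "(complex \<Rightarrow> complex) \<Rightarrow> (complex \<Rightarrow> complex) \<Rightarrow> complex" where
  "pw_inner f g = (LINT t|lborel. f (complex_of_real t) * cnj (g (complex_of_real t)))"

definition pw_norm :: "(complex \<Rightarrow> complex) \<Rightarrow> real" where
  "pw_norm f = sqrt (LINT t|lborel. (cmod (f (complex_of_real t)))\<^sup>2)"

definition comp_op :: "(complex \<Rightarrow> complex) \<Rightarrow> (complex \<Rightarrow> complex) \<Rightarrow> complex \<Rightarrow> complex" where
  "comp_op \<phi> f = f \<circ> \<phi>"

text \<open>The approximants are restricted to the space itself, since the norm of a function that
  is not square-integrable is \<open>0\<close> by the convention for the Bochner integral.\<close>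

definition pw_dense :: "real \<Rightarrow> (complex \<Rightarrow> complex) set \<Rightarrow> bool" where
  "pw_dense \<sigma> D \<longleftrightarrow>
     (\<forall>g\<in>paley_wiener \<sigma>. \<forall>\<epsilon>>0. \<exists>h\<in>D \<inter> paley_wiener \<sigma>. pw_norm (g - h) < \<epsilon>)"

definition pw_cyclic ::
    "real \<Rightarrow> ((complex \<Rightarrow> complex) \<Rightarrow> (complex \<Rightarrow> complex)) \<Rightarrow> bool" where
  "pw_cyclic \<sigma> T \<longleftrightarrow>
     (\<exists>f\<in>paley_wiener \<sigma>. pw_dense \<sigma> (cfun.span (range (\<lambda>n. (T ^^ n) f))))"

definition pw_supercyclic ::
    "real \<Rightarrow> ((complex \<Rightarrow> complex) \<Rightarrow> (complex \<Rightarrow> complex)) \<Rightarrow> bool" where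
  "pw_supercyclic \<sigma> T \<longleftrightarrow>
     (\<exists>f\<in>paley_wiener \<sigma>. pw_dense \<sigma> {(\<lambda>z. c * (T ^^ n) f z) | c n. True})"

text \<open>For a bounded operator on the space the described element exists by the Riesz
  representation theorem. Arguments outside the space are irrelevant.\<close>

definition pw_adjoint ::
    "real \<Rightarrow> ((complex \<Rightarrow> complex) \<Rightarrow> (complex \<Rightarrow> complex))
      \<Rightarrow> (complex \<Rightarrow> complex) \<Rightarrow> (complex \<Rightarrow> complex)" where
  "pw_adjoint \<sigma> T g =
     (THE h. h \<in> paley_wiener \<sigma> \<and> (\<forall>f\<in>paley_wiener \<sigma>. pw_inner (T f) g = pw_inner f h))"

end

theory Submission
  imports Defs "HOL-Probability.Sinc_Integral"
begin

text \<open>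
  A function of the space is reproduced on the whole plane by convolution with an integrable kernel. Hence
  complex translations \<open>T\<^sub>c f(z) = f(z + c)\<close> are bounded with adjoint \<open>T\<^sub>-\<^sub>c\<^sub>'\<close>, \<open>c'\<close> the conjugate of \<open>c\<close>, and
  the space is a Hilbert space with reproducing kernel \<open>K\<^sub>w\<close>.

  For \<open>\<bar>a\<bar> < 1\<close> the range of the operator consists of functions of smaller type and has infinite
  codimension, so there is no cyclic vector; the adjoint maps \<open>K\<^sub>w\<close> to \<open>K\<close> at \<open>\<phi> w\<close>, and since the iterates of \<open>\<phi>\<close>
  accumulate at its fixed point, \<open>K\<^sub>w\<close> is cyclic for the adjoint by the identity theorem. For \<open>a = -1\<close> both operators
  are involutions. For \<open>a = 1\<close> the operator is a translation. If \<open>b\<close> is not real, cyclicity of a kernel means that a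
  function of the space vanishing on one half of a non-real lattice is zero; for real \<open>b\<close> with \<open>\<bar>b\<bar> \<le> \<pi> / \<sigma>\<close> a
  superposition of kernels of smaller types is used instead, and both cases follow from a theorem of Carlson
  type. For larger real \<open>b\<close> an antisymmetric bilinear form invariant under the translation obstructs cyclicity.
  Supercyclicity of a translation fails since translations are normal.
\<close>

section \<open>The cardinal sine and square integrable functions\<close>

text \<open>The Fourier transform explains the constants although it does not occur in the proof. It
  turns the space into the square integrable functions on [-\<sigma>, \<sigma>] and the shift by b
  into multiplication by exp (\<i> b \<xi>). For real b \<noteq> 0 this multiplier is injective up
  to null sets exactly if \<bar>b\<bar> \<le> \<pi> / \<sigma>. For larger b it takes equal values
  at \<xi> and \<xi> + p, p = 2 \<pi> / b, and the antisymmetric form is, up to a factor, the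
  integral over \<xi> of the determinant formed by the values of two transforms at these points. At
  \<bar>b\<bar> = \<pi> / \<sigma> the multiplier runs once round the circle; by Szego's theorem the
  transform of a cyclic vector must then have a logarithm that is not integrable. The transform of a
  kernel is bounded below, so kernels fail; kernels of smaller types are cut off to smaller
  intervals, and with rapidly decreasing weights their sum decays fast enough at the ends. The gap
  in the Carlson type theorem that closes slowly reflects this. In place of Plancherel's theorem
  stands a convolution formula obtained by contour integration, which yields bounded point
  evaluations and with them completeness.\<close>

definition csinc :: "complex \<Rightarrow> complex" where
  "csinc z = (if z = 0 then 1 else sin z / z)"

lemma csinc_0 [simp]: "csinc 0 = 1"
  by (simp add: csinc_def)

lemma mult_csinc: "z * csinc z = sin z"
  by (simp add: csinc_def)

lemma csinc_minus [simp]: "csinc (- z) = csinc z"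
  by (simp add: csinc_def)

lemma cnj_csinc [simp]: "cnj (csinc z) = csinc (cnj z)"
  by (simp add: csinc_def cnj_sin)

lemma holomorphic_csinc: "csinc holomorphic_on UNIV"
proof -
  have "(\<lambda>z::complex. if z = 0 then deriv sin 0 else (sin z - sin 0) / (z - 0)) holomorphic_on UNIV"
    by (rule pole_lemma) (auto intro: holomorphic_intros)
  moreover have "deriv sin (0::complex) = 1"
    by (rule DERIV_imp_deriv) (auto intro!: derivative_eq_intros)
  ultimately show ?thesis
    by (simp add: csinc_def[abs_def] cong: if_cong)
qed

lemma holomorphic_on_csinc [holomorphic_intros]:
  "f holomorphic_on A \<Longrightarrow> (\<lambda>z. csinc (f z)) holomorphic_on A"
  using holomorphic_on_compose[of f A csinc] holomorphic_on_subset[OF holomorphic_csinc]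
  by (simp add: o_def)

lemma continuous_on_csinc [continuous_intros]:
  "continuous_on A f \<Longrightarrow> continuous_on A (\<lambda>z. csinc (f z))"
  using continuous_on_compose2[OF holomorphic_on_imp_continuous_on[OF holomorphic_csinc]] by blast

lemma cmod_sin_le: "cmod (sin z) \<le> exp \<bar>Im z\<bar>"
proof -
  have "cmod (sin z) = cmod (exp (\<i> * z) - exp (- (\<i> * z))) / 2"
    by (simp add: sin_exp_eq norm_divide norm_mult)
  also have "\<dots> \<le> (cmod (exp (\<i> * z)) + cmod (exp (- (\<i> * z)))) / 2"
    by (intro divide_right_mono norm_triangle_ineq4) auto
  also have "\<dots> \<le> exp \<bar>Im z\<bar>"
    by simp (smt (verit) exp_le_cancel_iff field_sum_of_halves)
  finally show ?thesis .
qed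

text \<open>One bound serves both for the decay on the real line and for the growth off it. In the
  unit disc the maximum principle carries over the bound by 3 from the circle, where the exponential
  is at most e; since 1 + \<bar>z\<bar> \<le> 2 there, 3 becomes 6.\<close>

lemma cmod_csinc_le: "cmod (csinc z) \<le> 6 * exp \<bar>Im z\<bar> / (1 + cmod z)"
proof (cases "cmod z \<le> 1")
  case True
  have "cmod (csinc z) \<le> 3"
  proof (rule maximum_modulus_frontier[of csinc "cball 0 1"])
    fix w :: complex assume "w \<in> frontier (cball 0 1)"
    then have w: "cmod w = 1" by simp
    then have "\<bar>Im w\<bar> \<le> 1" using abs_Im_le_cmod[of w] by simp
    then have "exp \<bar>Im w\<bar> \<le> 3" using exp_le by (smt (verit) exp_le_cancel_iff)
    moreover have "cmod (csinc w) \<le> exp \<bar>Im w\<bar>"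
      using w cmod_sin_le[of w] by (auto simp: csinc_def norm_divide)
    ultimately show "cmod (csinc w) \<le> 3" by linarith
  qed (use True in \<open>auto intro: holomorphic_on_subset[OF holomorphic_csinc] continuous_on_csinc continuous_on_id\<close>)
  also have "3 \<le> 6 * exp \<bar>Im z\<bar> / (1 + cmod z)"
  proof -
    have "3 * (1 + cmod z) \<le> 6 * exp \<bar>Im z\<bar>"
      using True one_le_exp_iff[of "\<bar>Im z\<bar>"] by (smt (verit) abs_ge_zero)
    then show ?thesis by (simp add: field_simps add_pos_nonneg)
  qed
  finally show ?thesis .
next
  case False
  then have z: "cmod z > 1" "z \<noteq> 0" by auto
  have "cmod (csinc z) \<le> exp \<bar>Im z\<bar> / cmod z"
    using z cmod_sin_le[of z] by (auto simp: csinc_def norm_divide divide_right_mono)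
  also have "\<dots> \<le> 6 * exp \<bar>Im z\<bar> / (1 + cmod z)"
  proof -
    have "exp \<bar>Im z\<bar> * (1 + cmod z) \<le> exp \<bar>Im z\<bar> * (6 * cmod z)"
      using z by (intro mult_left_mono) auto
    then show ?thesis using z
      by (simp add: field_simps add_pos_nonneg)
  qed
  finally show ?thesis .
qed

lemma cmod_csinc_real_le_1: "cmod (csinc (complex_of_real x)) \<le> 1"
proof (cases "x = 0")
  case False
  then show ?thesis
    using abs_sin_le_one[of x] abs_sin_x_le_abs_x[of x]
    by (simp add: csinc_def norm_divide sin_of_real)
qed simp

lemma integrable_inverse_1_plus_sq: "integrable lborel (\<lambda>x::real. inverse (1 + x\<^sup>2))"
  using integrable_inverse_1_plus_square by (simp add: set_integrable_def)

text \<open>Square integrable on the real axis: the setting for all arguments that do not use that the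
  functions are entire.\<close>

definition sqi :: "(complex \<Rightarrow> complex) \<Rightarrow> bool" where
  "sqi f \<longleftrightarrow> (\<lambda>t::real. f (complex_of_real t)) \<in> borel_measurable borel \<and>
     integrable lborel (\<lambda>t::real. (cmod (f (complex_of_real t)))\<^sup>2)"

lemma sqiD:
  assumes "sqi f"
  shows "(\<lambda>t::real. f (complex_of_real t)) \<in> borel_measurable borel"
    and "integrable lborel (\<lambda>t::real. (cmod (f (complex_of_real t)))\<^sup>2)"
  using assms by (auto simp: sqi_def)

lemma borel_measurable_entire:
  assumes "f holomorphic_on UNIV"
  shows "(\<lambda>t::real. f (complex_of_real t)) \<in> borel_measurable borel"
proof (rule borel_measurable_continuous_onI)
  show "continuous_on UNIV (\<lambda>t::real. f (complex_of_real t))"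
    by (rule continuous_on_compose2[OF holomorphic_on_imp_continuous_on[OF assms]])
       (auto intro: continuous_on_of_real continuous_on_id)
qed

lemma sqi_mult_bounded:
  assumes "sqi f" and [measurable]: "(\<lambda>t::real. m (complex_of_real t)) \<in> borel_measurable borel"
    and bd: "\<And>t::real. cmod (m (complex_of_real t)) \<le> B"
  shows "sqi (\<lambda>z. m z * f z)"
proof -
  note [measurable] = sqiD(1)[OF assms(1)]
  have "integrable lborel (\<lambda>t::real. (cmod (m (complex_of_real t) * f (complex_of_real t)))\<^sup>2)"
  proof (rule Bochner_Integration.integrable_bound)
    show "integrable lborel (\<lambda>t. B\<^sup>2 * (cmod (f (complex_of_real t)))\<^sup>2)"
      using sqiD(2)[OF assms(1)] by simp
    have "(cmod (m (complex_of_real t) * f (complex_of_real t)))\<^sup>2 \<le> B\<^sup>2 * (cmod (f (complex_of_real t)))\<^sup>2" for t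
      unfolding norm_mult power_mult_distrib by (intro mult_right_mono power_mono bd) auto
    then show "AE t in lborel. norm ((cmod (m (complex_of_real t) * f (complex_of_real t)))\<^sup>2)
        \<le> norm (B\<^sup>2 * (cmod (f (complex_of_real t)))\<^sup>2)"
      by (intro AE_I2) auto
  qed measurable
  then show ?thesis by (auto simp: sqi_def)
qed

lemma sqi_scale: "sqi f \<Longrightarrow> sqi (\<lambda>z. c * f z)"
  by (rule sqi_mult_bounded[of f "\<lambda>_. c" "cmod c"]) auto

lemma integrable_sqi_mult:
  assumes "sqi f" "sqi g"
  shows "integrable lborel (\<lambda>t::real. f (complex_of_real t) * g (complex_of_real t))"
proof (rule Bochner_Integration.integrable_bound)
  note [measurable] = sqiD(1)[OF assms(1)] sqiD(1)[OF assms(2)]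
  show "integrable lborel (\<lambda>t::real. (cmod (f (complex_of_real t)))\<^sup>2 + (cmod (g (complex_of_real t)))\<^sup>2)"
    using assms by (intro Bochner_Integration.integrable_add sqiD)
  have "cmod (a * b) \<le> (cmod a)\<^sup>2 + (cmod b)\<^sup>2" for a b
  proof -
    have "2 * (cmod a * cmod b) \<le> (cmod a)\<^sup>2 + (cmod b)\<^sup>2"
      using sum_squares_bound[of "cmod a" "cmod b"] by (simp add: mult.assoc)
    moreover have "0 \<le> cmod a * cmod b" by simp
    ultimately show ?thesis unfolding norm_mult by linarith
  qed
  then show "AE t in lborel. norm (f (complex_of_real t) * g (complex_of_real t))
     \<le> norm ((cmod (f (complex_of_real t)))\<^sup>2 + (cmod (g (complex_of_real t)))\<^sup>2)"
    by (intro AE_I2) (auto intro: order_trans)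
  show "(\<lambda>t. f (complex_of_real t) * g (complex_of_real t)) \<in> borel_measurable lborel"
    by measurable
qed

lemma sqi_cnj: "sqi f \<Longrightarrow> sqi (\<lambda>z. cnj (f z))"
  unfolding sqi_def
  by (auto intro: measurable_compose[OF _ borel_measurable_continuous_onI] continuous_intros)

lemma integrable_sqi_inner:
  assumes "sqi f" "sqi g"
  shows "integrable lborel (\<lambda>t::real. f (complex_of_real t) * cnj (g (complex_of_real t)))"
  using integrable_sqi_mult[OF assms(1) sqi_cnj[OF assms(2)]] .

lemma sqi_add:
  assumes "sqi f" "sqi g" shows "sqi (\<lambda>z. f z + g z)"
proof -
  note [measurable] = sqiD(1)[OF assms(1)] sqiD(1)[OF assms(2)]
  have "integrable lborel (\<lambda>t::real. (cmod (f (complex_of_real t) + g (complex_of_real t)))\<^sup>2)"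
  proof (rule Bochner_Integration.integrable_bound)
    show "integrable lborel (\<lambda>t::real. 2 * (cmod (f (complex_of_real t)))\<^sup>2 + 2 * (cmod (g (complex_of_real t)))\<^sup>2)"
      using assms by (intro Bochner_Integration.integrable_add integrable_mult_right sqiD)
    have "(cmod (a + b))\<^sup>2 \<le> 2 * (cmod a)\<^sup>2 + 2 * (cmod b)\<^sup>2" for a b
    proof -
      have "(cmod (a + b))\<^sup>2 \<le> (cmod a + cmod b)\<^sup>2"
        by (intro power_mono norm_triangle_ineq) auto
      also have "\<dots> \<le> 2 * (cmod a)\<^sup>2 + 2 * (cmod b)\<^sup>2"
        using sum_squares_bound[of "cmod a" "cmod b"] by (simp add: power2_sum)
      finally show ?thesis .
    qed
    then show "AE t in lborel. norm ((cmod (f (complex_of_real t) + g (complex_of_real t)))\<^sup>2)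
        \<le> norm (2 * (cmod (f (complex_of_real t)))\<^sup>2 + 2 * (cmod (g (complex_of_real t)))\<^sup>2)"
      by (intro AE_I2) auto
  qed measurable
  then show ?thesis by (auto simp: sqi_def)
qed

lemma sqi_diff:
  assumes "sqi f" "sqi g" shows "sqi (\<lambda>z. f z - g z)"
  using sqi_add[OF assms(1) sqi_scale[OF assms(2), of "-1"]] by simp

section \<open>Inner product and seminorm on square integrable functions\<close>

lemma pw_inner_add_left:
  "sqi f \<Longrightarrow> sqi g \<Longrightarrow> sqi h \<Longrightarrow> pw_inner (\<lambda>z. f z + g z) h = pw_inner f h + pw_inner g h"
  using Bochner_Integration.integral_add[OF integrable_sqi_inner[of f h] integrable_sqi_inner[of g h]]
  unfolding pw_inner_def distrib_right by blast

lemma pw_inner_diff_left: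
  "sqi f \<Longrightarrow> sqi g \<Longrightarrow> sqi h \<Longrightarrow> pw_inner (\<lambda>z. f z - g z) h = pw_inner f h - pw_inner g h"
  using Bochner_Integration.integral_diff[OF integrable_sqi_inner[of f h] integrable_sqi_inner[of g h]]
  unfolding pw_inner_def left_diff_distrib by blast

lemma pw_inner_scale_left: "pw_inner (\<lambda>z. c * f z) h = c * pw_inner f h"
  unfolding pw_inner_def by (simp add: mult.assoc)

lemma pw_inner_commute: "pw_inner g f = cnj (pw_inner f g)"
  unfolding pw_inner_def
  using Bochner_Integration.integral_cnj[of lborel "\<lambda>t. f (complex_of_real t) * cnj (g (complex_of_real t))"]
  by (simp add: mult.commute)

lemma pw_inner_add_right:
  "sqi f \<Longrightarrow> sqi g \<Longrightarrow> sqi h \<Longrightarrow> pw_inner h (\<lambda>z. f z + g z) = pw_inner h f + pw_inner h g"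
  unfolding pw_inner_commute[of h] by (simp add: pw_inner_add_left)

lemma pw_inner_diff_right:
  "sqi f \<Longrightarrow> sqi g \<Longrightarrow> sqi h \<Longrightarrow> pw_inner h (\<lambda>z. f z - g z) = pw_inner h f - pw_inner h g"
  unfolding pw_inner_commute[of h] by (simp add: pw_inner_diff_left)

lemma pw_inner_scale_right: "pw_inner h (\<lambda>z. c * f z) = cnj c * pw_inner h f"
  unfolding pw_inner_commute[of h] by (simp add: pw_inner_scale_left)

lemma pw_norm_ge_0 [simp]: "pw_norm f \<ge> 0"
  by (simp add: pw_norm_def)

lemma pw_norm_sq: "(pw_norm f)\<^sup>2 = (LINT t|lborel. (cmod (f (complex_of_real t)))\<^sup>2)"
  by (simp add: pw_norm_def)

lemma pw_inner_self: "pw_inner f f = complex_of_real ((pw_norm f)\<^sup>2)"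
  unfolding pw_norm_sq pw_inner_def
  by (simp add: complex_mult_cnj cmod_power2 flip: integral_complex_of_real)

lemma pw_norm_scale: "pw_norm (\<lambda>z. c * f z) = cmod c * pw_norm f"
  by (simp add: pw_norm_def norm_mult power_mult_distrib real_sqrt_mult)

text \<open>The integral of (\<bar>f\<bar> - s \<bar>g\<bar>)^2 is nonnegative for every real s, and
  s = I / \<parallel>g\<parallel>^2 is the optimal choice. As \<open>pw_norm\<close> is only a
  seminorm here, \<parallel>g\<parallel> = 0 is a separate case, in which s is taken large.\<close>

lemma sqi_integral_abs_mult:
  assumes "sqi f" "sqi g"
  shows "integrable lborel (\<lambda>t::real. cmod (f (complex_of_real t)) * cmod (g (complex_of_real t)))"
    and "(LINT t|lborel. cmod (f (complex_of_real t)) * cmod (g (complex_of_real t))) \<le> pw_norm f * pw_norm g"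
proof -
  let ?f = "\<lambda>t::real. cmod (f (complex_of_real t))" and ?g = "\<lambda>t::real. cmod (g (complex_of_real t))"
  show int: "integrable lborel (\<lambda>t. ?f t * ?g t)"
    using integrable_norm[OF integrable_sqi_mult[OF assms]] by (simp add: norm_mult)
  define I where "I = (LINT t|lborel. ?f t * ?g t)"
  have I0: "I \<ge> 0" unfolding I_def by (intro integral_nonneg_AE) auto
  have main: "2 * s * I \<le> (pw_norm f)\<^sup>2 + s\<^sup>2 * (pw_norm g)\<^sup>2" for s
  proof -
    have "0 \<le> (LINT t|lborel. (?f t - s * ?g t)\<^sup>2)" by simp
    also have "\<dots> = (LINT t|lborel. ((?f t)\<^sup>2 + s\<^sup>2 * (?g t)\<^sup>2) - (2 * s) * (?f t * ?g t))"
      by (rule Bochner_Integration.integral_cong) (auto simp: power2_eq_square algebra_simps)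
    also have "\<dots> = ((pw_norm f)\<^sup>2 + s\<^sup>2 * (pw_norm g)\<^sup>2) - (2 * s) * I"
    proof -
      note ints = assms[THEN sqiD(2)]
      show ?thesis unfolding pw_norm_sq I_def
        using Bochner_Integration.integral_diff[OF Bochner_Integration.integrable_add[OF ints(1)
            integrable_mult_right[OF ints(2), of "s\<^sup>2"]] integrable_mult_right[OF int, of "2 * s"]]
          Bochner_Integration.integral_add[OF ints(1) integrable_mult_right[OF ints(2), of "s\<^sup>2"]]
        by simp
    qed
    finally show ?thesis by simp
  qed
  show "I \<le> pw_norm f * pw_norm g"
  proof (cases "pw_norm g = 0")
    case True
    then have *: "2 * s * I \<le> (pw_norm f)\<^sup>2" for s using main[of s] by simp
    have "I = 0"
    proof (rule ccontr)
      assume "I \<noteq> 0"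
      then have "I > 0" using I0 by simp
      \<comment> \<open>With s = k the left side of the inequality is twice
        \<parallel>f\<parallel>^2 + 1, too large for the right side
        \<parallel>f\<parallel>^2.\<close>
      define k where "k = ((pw_norm f)\<^sup>2 + 1) / I"
      have "k * I = (pw_norm f)\<^sup>2 + 1" using \<open>I > 0\<close> by (simp add: k_def)
      then have "2 * ((pw_norm f)\<^sup>2 + 1) \<le> (pw_norm f)\<^sup>2" using *[of k] by (simp add: mult.assoc)
      moreover have "0 \<le> (pw_norm f)\<^sup>2" by simp
      ultimately show False by argo
    qed
    then show ?thesis by simp
  next
    case False
    then have g: "pw_norm g > 0" using pw_norm_ge_0[of g] by linarith
    have "2 * (I / (pw_norm g)\<^sup>2) * I \<le> (pw_norm f)\<^sup>2 + (I / (pw_norm g)\<^sup>2)\<^sup>2 * (pw_norm g)\<^sup>2"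
      by (rule main)
    moreover have "2 * (I / (pw_norm g)\<^sup>2) * I = 2 * (I\<^sup>2 / (pw_norm g)\<^sup>2)"
      by (simp add: power2_eq_square)
    moreover have "(I / (pw_norm g)\<^sup>2)\<^sup>2 * (pw_norm g)\<^sup>2 = I\<^sup>2 / (pw_norm g)\<^sup>2"
      using g by (simp add: power2_eq_square)
    ultimately have "I\<^sup>2 / (pw_norm g)\<^sup>2 \<le> (pw_norm f)\<^sup>2"
      by linarith
    then have "I\<^sup>2 \<le> (pw_norm f * pw_norm g)\<^sup>2"
      using g by (simp add: divide_le_eq power_mult_distrib)
    then show ?thesis
      by (rule power2_le_imp_le) auto
  qed
qed

lemma pw_inner_cauchy_schwarz:
  assumes "sqi f" "sqi g"
  shows "cmod (pw_inner f g) \<le> pw_norm f * pw_norm g"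
proof -
  have "cmod (pw_inner f g) \<le> (LINT t|lborel. cmod (f (complex_of_real t) * cnj (g (complex_of_real t))))"
    unfolding pw_inner_def by (rule integral_norm_bound)
  also have "\<dots> \<le> pw_norm f * pw_norm g"
    using sqi_integral_abs_mult(2)[OF assms] by (simp add: norm_mult)
  finally show ?thesis .
qed

lemma pw_norm_add_sq:
  assumes "sqi f" "sqi g"
  shows "(pw_norm (\<lambda>z. f z + g z))\<^sup>2 = (pw_norm f)\<^sup>2 + 2 * Re (pw_inner f g) + (pw_norm g)\<^sup>2"
proof -
  have "pw_inner (\<lambda>z. f z + g z) (\<lambda>z. f z + g z)
      = pw_inner f f + pw_inner f g + (cnj (pw_inner f g) + pw_inner g g)"
    using assms
    by (simp add: pw_inner_add_left pw_inner_add_right sqi_add pw_inner_commute[of g f])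
  then have "complex_of_real ((pw_norm (\<lambda>z. f z + g z))\<^sup>2)
      = pw_inner f f + pw_inner f g + (cnj (pw_inner f g) + pw_inner g g)"
    by (simp only: pw_inner_self)
  then have "Re (complex_of_real ((pw_norm (\<lambda>z. f z + g z))\<^sup>2))
      = Re (pw_inner f f + pw_inner f g + (cnj (pw_inner f g) + pw_inner g g))" by simp
  then show ?thesis by (simp add: pw_inner_self)
qed

lemma pw_norm_triangle:
  assumes "sqi f" "sqi g"
  shows "pw_norm (\<lambda>z. f z + g z) \<le> pw_norm f + pw_norm g"
proof (rule power2_le_imp_le)
  have "Re (pw_inner f g) \<le> pw_norm f * pw_norm g"
    using pw_inner_cauchy_schwarz[OF assms] complex_Re_le_cmod order_trans by blast
  then show "(pw_norm (\<lambda>z. f z + g z))\<^sup>2 \<le> (pw_norm f + pw_norm g)\<^sup>2"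
    unfolding pw_norm_add_sq[OF assms] by (simp add: power2_sum)
qed auto

lemma pw_norm_diff_commute: "pw_norm (\<lambda>z. f z - g z) = pw_norm (\<lambda>z. g z - f z)"
  by (simp add: pw_norm_def norm_minus_commute)

lemma pw_norm_triangle_diff:
  assumes "sqi f" "sqi g" "sqi h"
  shows "pw_norm (\<lambda>z. f z - h z) \<le> pw_norm (\<lambda>z. f z - g z) + pw_norm (\<lambda>z. g z - h z)"
  using pw_norm_triangle[of "\<lambda>z. f z - g z" "\<lambda>z. g z - h z"] assms by (simp add: sqi_diff)

lemma pw_norm_le_diff:
  assumes "sqi f" "sqi g"
  shows "\<bar>pw_norm f - pw_norm g\<bar> \<le> pw_norm (\<lambda>z. f z - g z)"
proof -
  have "pw_norm f \<le> pw_norm g + pw_norm (\<lambda>z. f z - g z)"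
    using pw_norm_triangle[OF assms(2) sqi_diff[OF assms]] by simp
  moreover have "pw_norm g \<le> pw_norm f + pw_norm (\<lambda>z. g z - f z)"
    using pw_norm_triangle[OF assms(1) sqi_diff[OF assms(2,1)]] by simp
  moreover have "pw_norm (\<lambda>z. g z - f z) = pw_norm (\<lambda>z. f z - g z)"
    by (rule pw_norm_diff_commute)
  ultimately show ?thesis
    by (simp only: abs_le_iff) argo
qed

section \<open>Growth in the plane\<close>

lemma holomorphic_on_compose_entire:
  assumes "Q holomorphic_on UNIV" "g holomorphic_on A"
  shows "(\<lambda>z. Q (g z)) holomorphic_on A"
  using holomorphic_on_compose[OF assms(2) holomorphic_on_subset[OF assms(1)]] by (simp add: o_def)

text \<open>For the maximum principle on a set cut out by inequalities: no frontier has to be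
  computed, it suffices to bound the function where the strict inequalities fail.\<close>

lemma frontier_subset_Diff_open:
  assumes "closed T" "open V" "V \<subseteq> T"
  shows "frontier T \<subseteq> T - V"
  using assms interior_maximal[of V T] by (auto simp: frontier_def)

text \<open>The argument is at most \<pi> / 2 in the right half plane. This estimate controls the
  comparison functions built from v Ln v, both in the sector and on the half disc.\<close>

lemma Re_mult_Ln_ge:
  assumes "Re v > 0"
  shows "Re (v * Ln v) \<ge> Re v * ln (cmod v) - \<bar>Im v\<bar> * (pi / 2)"
proof -
  have v: "v \<noteq> 0" using assms by auto
  have "\<bar>Im (Ln v)\<bar> \<le> pi / 2"
    using Re_Ln_pos_lt[OF v] assms by simp
  then have "\<bar>Im v\<bar> * \<bar>Im (Ln v)\<bar> \<le> \<bar>Im v\<bar> * (pi / 2)"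
    by (intro mult_left_mono) auto
  then have "Im v * Im (Ln v) \<le> \<bar>Im v\<bar> * (pi / 2)"
    using abs_ge_self[of "Im v * Im (Ln v)"] unfolding abs_mult by linarith
  then show ?thesis using v by simp
qed

text \<open>The comparison function \<open>exp (- \<eta> (w + 1) Ln (w + 1))\<close> decays faster than any exponential in
  the sector and tends to \<open>1\<close> pointwise as \<open>\<eta>\<close> tends to \<open>0\<close>.\<close>

lemma phragmen_lindelof_sector:
  fixes G :: "complex \<Rightarrow> complex"
  assumes hol: "G holomorphic_on U" and U: "{w. \<bar>Im w\<bar> \<le> Re w} \<subseteq> U"
    and growth: "\<And>w. \<bar>Im w\<bar> \<le> Re w \<Longrightarrow> cmod (G w) \<le> A * exp (K * cmod w)"
    and bd: "\<And>w. \<bar>Im w\<bar> = Re w \<Longrightarrow> cmod (G w) \<le> B"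
    and B: "B > 0" and w0: "\<bar>Im w0\<bar> \<le> Re w0"
  shows "cmod (G w0) \<le> B"
proof -
  \<comment> \<open>If ln \<bar>v\<bar> < \<pi> / 2 then Re v \<le> exp (\<pi> / 2), so the negative
    term of the lower bound is at most this constant; otherwise the lower bound is
    nonnegative.\<close>
  define c where "c = pi / 2 * exp (pi / 2)"
  have c: "c > 0" by (simp add: c_def)
  have key: "Re ((w + 1) * Ln (w + 1)) \<ge> - c"
    and key2: "ln (cmod (w + 1)) \<ge> pi / 2 \<Longrightarrow>
      Re ((w + 1) * Ln (w + 1)) \<ge> cmod (w + 1) / 2 * (ln (cmod (w + 1)) - pi / 2)"
    if w: "\<bar>Im w\<bar> \<le> Re w" for w
  proof -
    define v where "v = w + 1"
    have v: "Re v \<ge> 1" "\<bar>Im v\<bar> \<le> Re v" using w by (auto simp: v_def)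
    have "cmod v \<ge> 1" using v complex_Re_le_cmod[of v] by linarith
    have lnv: "ln (cmod v) \<ge> 0" using \<open>cmod v \<ge> 1\<close> by simp
    have "Re v * ln (cmod v) - \<bar>Im v\<bar> * (pi / 2) \<le> Re (v * Ln v)"
      using v by (intro Re_mult_Ln_ge) auto
    moreover have "\<bar>Im v\<bar> * (pi / 2) \<le> Re v * (pi / 2)"
      using v by (intro mult_right_mono) auto
    ultimately have lo: "Re v * (ln (cmod v) - pi / 2) \<le> Re (v * Ln v)"
      by (simp only: right_diff_distrib)
    have half: "cmod v / 2 \<le> Re v"
      using cmod_le[of v] v by linarith
    show "ln (cmod (w + 1)) \<ge> pi / 2 \<Longrightarrow>
      Re ((w + 1) * Ln (w + 1)) \<ge> cmod (w + 1) / 2 * (ln (cmod (w + 1)) - pi / 2)"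
      using lo mult_right_mono[OF half, of "ln (cmod v) - pi / 2"]
      unfolding v_def[symmetric] by linarith
    show "Re ((w + 1) * Ln (w + 1)) \<ge> - c"
    proof (cases "ln (cmod v) \<ge> pi / 2")
      case True
      then have "0 \<le> Re v * (ln (cmod v) - pi / 2)" using v by simp
      then show ?thesis using lo c unfolding v_def[symmetric] by linarith
    next
      case False
      then have "exp (ln (cmod v)) \<le> exp (pi / 2)" by (subst exp_le_cancel_iff) linarith
      moreover have "exp (ln (cmod v)) = cmod v" using \<open>cmod v \<ge> 1\<close> by (intro exp_ln) linarith
      ultimately have "cmod v \<le> exp (pi / 2)" by simp
      then have "Re v \<le> exp (pi / 2)" using complex_Re_le_cmod[of v] by linarith
      then have "Re v * (pi / 2) \<le> c" unfolding c_def by (subst mult.commute) (rule mult_left_mono, auto)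
      moreover have "0 \<le> Re v * ln (cmod v)" using v lnv by simp
      ultimately show ?thesis using lo unfolding v_def[symmetric] right_diff_distrib by linarith
    qed
  qed
  have main: "cmod (G w0) * exp (- (\<eta> * Re ((w0 + 1) * Ln (w0 + 1)))) \<le> B * exp (\<eta> * c)" if \<eta>: "\<eta> > 0" for \<eta>
  proof -
    define F where "F = (\<lambda>w. G w * exp (- (of_real \<eta> * ((w + 1) * Ln (w + 1)))))"
    have normF: "cmod (F w) = cmod (G w) * exp (- (\<eta> * Re ((w + 1) * Ln (w + 1))))" for w
      unfolding F_def norm_mult norm_exp_eq_Re
      by (simp only: uminus_complex.simps Re_complex_of_real Im_complex_of_real times_complex.simps(1)[of "of_real \<eta>"]) simp
    \<comment> \<open>The first entry puts w0 into \<open>T\<close>. The second gives A exp (- R)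
      \<le> B. The third makes the comparison function on the arc smaller than exp (- (\<bar>K\<bar>
      + 1) R), which beats the growth of \<open>G\<close> and leaves the factor exp (- R).\<close>
    define R where "R = max (cmod w0) (max (A / B) (exp (pi / 2 + 2 * (\<bar>K\<bar> + 1) / \<eta>)))"
    define T where "T = {w. \<bar>Im w\<bar> \<le> Re w} \<inter> cball 0 R"
    define V where "V = {w. \<bar>Im w\<bar> < Re w} \<inter> ball 0 R"
    have clS: "closed {w. \<bar>Im w\<bar> \<le> Re w}"
      by (intro closed_Collect_le continuous_intros)
    have clT: "closed T" unfolding T_def using clS by auto
    have opV: "open V" unfolding V_def
      by (intro open_Int open_Collect_less continuous_intros open_ball)
    have VT: "V \<subseteq> T" unfolding V_def T_def by auto
    have TU: "T \<subseteq> U" using U unfolding T_def by auto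
    have holT: "F holomorphic_on T" unfolding F_def
    proof (intro holomorphic_intros)
      show "G holomorphic_on T" using hol TU by (rule holomorphic_on_subset)
      fix z assume "z \<in> T"
      then have "Re (z + 1) > 0" unfolding T_def by auto
      then show "z + 1 \<notin> \<real>\<^sub>\<le>\<^sub>0" by (auto simp: complex_nonpos_Reals_iff)
    qed
    have "cmod (F w0) \<le> B * exp (\<eta> * c)"
    proof (rule maximum_modulus_frontier[of F T])
      show "F holomorphic_on interior T"
        using holT interior_subset by (rule holomorphic_on_subset)
      show "continuous_on (closure T) F"
        using holT clT by (simp add: closure_closed holomorphic_on_imp_continuous_on)
      show "bounded T" unfolding T_def by auto
      show "w0 \<in> T" using w0 unfolding T_def R_def by (simp add: dist_norm)
    next
      fix w assume "w \<in> frontier T"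
      then have wT: "w \<in> T" and wV: "w \<notin> V"
        using frontier_subset_Diff_open[OF clT opV VT] by auto
      have w: "\<bar>Im w\<bar> \<le> Re w" using wT by (simp add: T_def)
      show "cmod (F w) \<le> B * exp (\<eta> * c)"
      proof (cases "\<bar>Im w\<bar> = Re w")
        case True
        have "exp (- (\<eta> * Re ((w + 1) * Ln (w + 1)))) \<le> exp (\<eta> * c)"
          using mult_left_mono[OF key[OF w], of \<eta>] \<eta> by simp
        then show ?thesis unfolding normF
          using bd[OF True] B by (intro mult_mono) auto
      next
        case False
        then have "cmod w = R" using w wT wV by (auto simp: T_def V_def)
        define v where "v = cmod (w + 1)"
        have "cmod w \<le> v"
        proof -
          have "(cmod w)\<^sup>2 \<le> (cmod (w + 1))\<^sup>2" using w
            unfolding cmod_power2 by (simp add: power2_eq_square algebra_simps)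
          then show ?thesis unfolding v_def by (rule power2_le_imp_le) auto
        qed
        have R0: "R > 0" unfolding R_def by (simp add: less_max_iff_disj)
        have vR: "v \<ge> R" using \<open>cmod w = R\<close> \<open>cmod w \<le> v\<close> by simp
        have "ln (exp (pi / 2 + 2 * (\<bar>K\<bar> + 1) / \<eta>)) \<le> ln v"
          using vR R0 by (subst ln_le_cancel_iff) (auto simp: R_def)
        then have lnv: "ln v \<ge> pi / 2 + 2 * (\<bar>K\<bar> + 1) / \<eta>" by simp
        have pos: "2 * (\<bar>K\<bar> + 1) / \<eta> \<ge> 0" using \<eta> by simp
        have "v / 2 * (ln v - pi / 2) \<le> Re ((w + 1) * Ln (w + 1))"
          unfolding v_def using lnv pos unfolding v_def by (intro key2[OF w]) linarith
        moreover have "v / 2 * (2 * (\<bar>K\<bar> + 1) / \<eta>) \<le> v / 2 * (ln v - pi / 2)"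
          using lnv R0 vR by (intro mult_left_mono) auto
        moreover have "v / 2 * (2 * (\<bar>K\<bar> + 1) / \<eta>) = v * (\<bar>K\<bar> + 1) / \<eta>"
          using \<eta> by (simp add: field_simps)
        ultimately have "v * (\<bar>K\<bar> + 1) / \<eta> \<le> Re ((w + 1) * Ln (w + 1))" by linarith
        then have "v * (\<bar>K\<bar> + 1) \<le> \<eta> * Re ((w + 1) * Ln (w + 1))"
          using \<eta> by (simp only: divide_le_eq mult.commute if_True)
        moreover have "R * (\<bar>K\<bar> + 1) \<le> v * (\<bar>K\<bar> + 1)"
          using vR by (intro mult_right_mono) auto
        ultimately have e: "\<eta> * Re ((w + 1) * Ln (w + 1)) \<ge> R * \<bar>K\<bar> + R"
          by (simp only: distrib_left mult_1_right)
        have "A \<ge> 0" using order_trans[OF norm_ge_zero growth[of 0]] by simp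
        have "cmod (F w) \<le> A * exp (K * R) * exp (- (R * \<bar>K\<bar> + R))"
          unfolding normF using growth[OF w] \<open>cmod w = R\<close> e \<open>A \<ge> 0\<close> by (intro mult_mono) auto
        also have "\<dots> = A * exp (K * R - R * \<bar>K\<bar> - R)"
          by (simp add: algebra_simps flip: exp_add)
        also have "\<dots> \<le> A * exp (- R)"
        proof -
          have "K * R \<le> R * \<bar>K\<bar>" using R0 by (simp add: mult.commute)
          then show ?thesis using \<open>A \<ge> 0\<close> by (intro mult_left_mono) auto
        qed
        also have "\<dots> \<le> B"
        proof -
          have "A / B \<le> R" unfolding R_def by simp
          also have "R \<le> exp R" using exp_ge_add_one_self[of R] by linarith
          finally show ?thesis using B by (simp add: exp_minus field_simps)
        qed
        also have "\<dots> \<le> B * exp (\<eta> * c)" using B \<eta> c by simp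
        finally show ?thesis .
      qed
    qed
    then show ?thesis by (simp only: normF)
  qed
  have "((\<lambda>\<eta>. cmod (G w0) * exp (- (\<eta> * Re ((w0 + 1) * Ln (w0 + 1))))) \<longlongrightarrow>
      cmod (G w0) * exp (- (0 * Re ((w0 + 1) * Ln (w0 + 1))))) (at_right 0)"
    by (intro tendsto_intros)
  moreover have "((\<lambda>\<eta>. B * exp (\<eta> * c)) \<longlongrightarrow> B * exp (0 * c)) (at_right 0)"
    by (intro tendsto_intros)
  moreover have "\<forall>\<^sub>F \<eta> in at_right 0. cmod (G w0) * exp (- (\<eta> * Re ((w0 + 1) * Ln (w0 + 1)))) \<le> B * exp (\<eta> * c)"
    using main eventually_at_right_less[of 0] by (auto elim: eventually_mono)
  ultimately have "cmod (G w0) * exp (- (0 * Re ((w0 + 1) * Ln (w0 + 1)))) \<le> B * exp (0 * c)"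
    by (intro tendsto_le[of "at_right 0"]) auto
  then show ?thesis by simp
qed

text \<open>Multiplication by 1 + \<i> carries the sector onto the quadrant. The factor exp (\<i>
  \<tau> z) cancels the growth on the imaginary axis and has modulus 1 on the real axis, where
  division by z + 1 removes the linear growth; so the quotient is bounded on both boundary
  rays.\<close>

lemma growth_first_quadrant:
  assumes hol: "Q holomorphic_on UNIV" and \<tau>: "\<tau> \<ge> 0"
    and growth: "\<And>z. cmod (Q z) \<le> A * exp (\<tau> * cmod z)"
    and real: "\<And>x::real. cmod (Q (of_real x)) \<le> N * (1 + \<bar>x\<bar>)"
    and z: "Re z \<ge> 0" "Im z \<ge> 0"
  shows "cmod (Q z) \<le> (A + N + 1) * (1 + cmod z) * exp (\<tau> * \<bar>Im z\<bar>)"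
proof -
  define u where "u = 1 + \<i>"
  define U where "U = {w. u * w + 1 \<noteq> 0}"
  define G where "G = (\<lambda>w. Q (u * w) * exp (\<i> * of_real \<tau> * (u * w)) / (u * w + 1))"
  have A0: "A \<ge> 0" using order_trans[OF norm_ge_zero growth[of 0]] by simp
  have N0: "N \<ge> 0" using order_trans[OF norm_ge_zero real[of 0]] by simp
  have Re_u: "Re (u * w) = Re w - Im w" and Im_u: "Im (u * w) = Re w + Im w" for w
    by (auto simp: u_def algebra_simps)
  have one: "1 \<le> cmod (u * w + 1)" if "\<bar>Im w\<bar> \<le> Re w" for w
  proof -
    have "1 \<le> Re (u * w + 1)" using that unfolding plus_complex.simps Re_u by simp
    then show ?thesis using complex_Re_le_cmod[of "u * w + 1"] by linarith
  qed
  have normG: "cmod (G w) = cmod (Q (u * w)) * exp (- (\<tau> * (Re w + Im w))) / cmod (u * w + 1)" for w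
    unfolding G_def norm_divide norm_mult[of "Q _"] norm_exp_eq_Re
    using Im_u[of w] by simp
  have "cmod (G (z / u)) \<le> A + N + 1"
  proof (rule phragmen_lindelof_sector[where G = G and U = U and A = A and K = "2 * \<tau>"])
    show "G holomorphic_on U" unfolding G_def U_def
      by (intro holomorphic_intros holomorphic_on_compose_entire[OF hol]) auto
    show "{w. \<bar>Im w\<bar> \<le> Re w} \<subseteq> U" using one by (force simp: U_def)
    show "A + N + 1 > 0" using A0 N0 by simp
  next
    fix w assume w: "\<bar>Im w\<bar> \<le> Re w"
    have "cmod (G w) \<le> cmod (Q (u * w)) * 1 / 1"
      unfolding normG using one[OF w] w \<tau> by (intro frac_le mult_left_mono) auto
    also have "\<dots> \<le> A * exp (\<tau> * cmod (u * w))" using growth by simp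
    also have "\<dots> \<le> A * exp (2 * \<tau> * cmod w)"
    proof -
      have "cmod u \<le> 2" unfolding u_def using norm_triangle_ineq[of 1 \<i>] by simp
      then have "cmod (u * w) \<le> 2 * cmod w" unfolding norm_mult by (intro mult_right_mono) auto
      then have "\<tau> * cmod (u * w) \<le> \<tau> * (2 * cmod w)" using \<tau> by (intro mult_left_mono) auto
      then show ?thesis using A0 by (intro mult_left_mono) auto
    qed
    finally show "cmod (G w) \<le> A * exp (2 * \<tau> * cmod w)" .
  next
    fix w assume w: "\<bar>Im w\<bar> = Re w"
    show "cmod (G w) \<le> A + N + 1"
    proof (cases "Im w \<ge> 0")
      case True
      have re: "Re (u * w) = 0" unfolding Re_u using w True by simp
      have im: "cmod (u * w) = Re w + Im w"
        using w True unfolding cmod_def re Im_u zero_power2 add_0_left real_sqrt_abs by simp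
      have "cmod (G w) \<le> A * exp (\<tau> * cmod (u * w)) * exp (- (\<tau> * (Re w + Im w))) / 1"
        unfolding normG using one[of w] w growth[of "u * w"] A0 by (intro frac_le mult_right_mono) auto
      also have "\<dots> = A" unfolding im by (simp add: exp_minus)
      finally show ?thesis using N0 by simp
    next
      case False
      then have im: "Re w + Im w = 0" using w by simp
      define x where "x = Re w - Im w"
      have x: "u * w = of_real x" "x \<ge> 0"
        using im w False by (auto simp: x_def complex_eq_iff u_def)
      have "cmod (u * w + 1) = cmod (of_real (x + 1))" by (simp add: x)
      also have "\<dots> = 1 + x" using x(2) by (simp only: norm_of_real)
      finally have "cmod (G w) \<le> N * (1 + x) * 1 / (1 + x)"
        unfolding normG im using real[of x] x by (simp add: divide_le_eq add.commute)
      also have "\<dots> = N" using x(2) by simp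
      finally show ?thesis using A0 by simp
    qed
  next
    have zu: "z / u = Complex ((Re z + Im z) / 2) ((Im z - Re z) / 2)"
      unfolding u_def by (simp add: complex_eq_iff Re_divide Im_divide power2_eq_square)
    then show "\<bar>Im (z / u)\<bar> \<le> Re (z / u)" using z by auto
  qed
  moreover have "u \<noteq> 0" by (simp add: u_def complex_eq_iff)
  then have "u * (z / u) = z" by simp
  ultimately have "cmod (Q z * exp (\<i> * of_real \<tau> * z) / (z + 1)) \<le> A + N + 1"
    unfolding G_def by simp
  moreover have "z + 1 \<noteq> 0" using z by (auto simp: complex_eq_iff)
  then have "cmod (z + 1) > 0" by simp
  ultimately have "cmod (Q z) * exp (- (\<tau> * Im z)) \<le> (A + N + 1) * cmod (z + 1)"
    by (simp add: norm_divide norm_mult divide_le_eq)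
  also have "\<dots> \<le> (A + N + 1) * (1 + cmod z)"
    using A0 N0 norm_triangle_ineq[of z 1] by (intro mult_left_mono) auto
  finally show ?thesis using z
    by (simp add: exp_minus field_simps)
qed

lemma growth_all_quadrants:
  assumes hol: "Q holomorphic_on UNIV" and \<tau>: "\<tau> \<ge> 0"
    and growth: "\<And>z. cmod (Q z) \<le> A * exp (\<tau> * cmod z)"
    and real: "\<And>x::real. cmod (Q (of_real x)) \<le> N * (1 + \<bar>x\<bar>)"
  shows "cmod (Q z) \<le> (A + N + 1) * (1 + cmod z) * exp (\<tau> * \<bar>Im z\<bar>)"
proof -
  have upper: "cmod (P z) \<le> (A + N + 1) * (1 + cmod z) * exp (\<tau> * \<bar>Im z\<bar>)"
    if hol: "P holomorphic_on UNIV" and growth: "\<And>z. cmod (P z) \<le> A * exp (\<tau> * cmod z)"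
    and real: "\<And>x::real. cmod (P (of_real x)) \<le> N * (1 + \<bar>x\<bar>)" and z: "Re z \<ge> 0" for P z
  proof (cases "Im z \<ge> 0")
    case True
    then show ?thesis using growth_first_quadrant[OF hol \<tau> growth real z] by simp
  next
    case False
    have "(\<lambda>z. cnj (P (cnj z))) holomorphic_on UNIV"
      using holomorphic_on_compose_cnj_cnj[of P UNIV] holomorphic_on_subset[OF hol] by (simp add: o_def)
    from growth_first_quadrant[OF this \<tau>, of A N "cnj z"] growth[of "cnj _"] real z False
    show ?thesis by simp
  qed
  show ?thesis
  proof (cases "Re z \<ge> 0")
    case True
    show ?thesis by (rule upper[OF hol growth real True])
  next
    case False
    have *: "(\<lambda>z. Q (- z)) holomorphic_on UNIV"
      by (intro holomorphic_on_compose_entire[OF hol] holomorphic_intros)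
    have "cmod (Q (- of_real x)) \<le> N * (1 + \<bar>x\<bar>)" for x :: real
      using real[of "- x"] by simp
    from upper[OF * _ this, of "- z"] growth[of "- _"] False show ?thesis by simp
  qed
qed

lemma paley_wienerD:
  assumes "f \<in> paley_wiener \<sigma>"
  shows "f holomorphic_on UNIV" "exponential_type_le \<sigma> f" "sqi f"
  using assms borel_measurable_entire by (auto simp: paley_wiener_def sqi_def)

lemma paley_wienerI:
  "f holomorphic_on UNIV \<Longrightarrow> exponential_type_le \<sigma> f \<Longrightarrow> sqi f \<Longrightarrow> f \<in> paley_wiener \<sigma>"
  by (auto simp: paley_wiener_def sqi_def)

text \<open>The primitive of \<open>f\<close> grows at most linearly on the real line since \<open>\<bar>f\<bar> \<le> 1 + \<bar>f\<bar>\<^sup>2\<close>; its growth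
  is then controlled in the plane by Phragmen-Lindelof, and that of \<open>f\<close> by Cauchy's inequality.\<close>

lemma paley_wiener_growth:
  assumes f: "f \<in> paley_wiener \<sigma>" and \<sigma>: "\<sigma> > 0" and \<epsilon>: "\<epsilon> > 0"
  shows "\<exists>C. \<forall>z. cmod (f z) \<le> C * (1 + cmod z) * exp ((\<sigma> + \<epsilon>) * \<bar>Im z\<bar>)"
proof -
  note hol = paley_wienerD(1)[OF f] and sqi = paley_wienerD(3)[OF f]
  obtain Q0 where "\<And>z. z \<in> UNIV \<Longrightarrow> (Q0 has_field_derivative f z) (at z within UNIV)"
    using holomorphic_convex_primitive'[OF _ _ hol] by blast
  then have dQ0: "(Q0 has_field_derivative f z) (at z)" for z by simp
  define Q where "Q = (\<lambda>z. Q0 z - Q0 0)"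
  have dQ: "(Q has_field_derivative f z) (at z)" for z
    unfolding Q_def using dQ0[of z] by (auto intro!: derivative_eq_intros)
  have holQ: "Q holomorphic_on UNIV"
    using dQ by (auto simp: holomorphic_on_def field_differentiable_def intro: has_field_derivative_at_within)
  have Q_0: "Q 0 = 0" by (simp add: Q_def)
  define N where "N = 1 + (pw_norm f)\<^sup>2"
  have diff: "cmod (Q (of_real b) - Q (of_real a)) \<le> (b - a) + (pw_norm f)\<^sup>2" if "a \<le> b" for a b :: real
  proof -
    have "((\<lambda>t. Q (of_real t)) has_vector_derivative f (of_real t)) (at t within {a..b})" for t :: real
      using field_vector_diff_chain_within[of complex_of_real 1 t "{a..b}" Q "f (of_real t)"]
        has_field_derivative_at_within[OF dQ] has_vector_derivative_of_real[of "\<lambda>t. t" 1 "at t within {a..b}"]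
      by (simp add: o_def)
    then have I: "((\<lambda>t. f (of_real t)) has_integral Q (of_real b) - Q (of_real a)) {a..b}"
      using that by (intro fundamental_theorem_of_calculus) auto
    have sint: "set_integrable lborel {a..b} (\<lambda>t. (cmod (f (of_real t)))\<^sup>2)"
      unfolding set_integrable_def using sqiD(2)[OF sqi] by (intro integrable_mult_indicator) auto
    note s2 = set_borel_integral_eq_integral[OF sint]
    have "cmod (Q (of_real b) - Q (of_real a)) \<le> integral {a..b} (\<lambda>t. 1 + (cmod (f (of_real t)))\<^sup>2)"
      unfolding integral_unique[OF I, symmetric]
    proof (rule integral_norm_bound_integral)
      show "(\<lambda>t. f (of_real t)) integrable_on {a..b}" using I by blast
      show "(\<lambda>t. 1 + (cmod (f (of_real t)))\<^sup>2) integrable_on {a..b}"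
        using s2(1) by (intro integrable_add integrable_const_ivl)
      fix x
      have "0 \<le> (cmod (f (of_real x)) - 1)\<^sup>2 + 1 + (cmod (f (of_real x)))\<^sup>2" by (intro add_nonneg_nonneg) auto
      also have "\<dots> = 2 * (1 + (cmod (f (of_real x)))\<^sup>2 - cmod (f (of_real x)))"
        by (simp add: power2_eq_square algebra_simps)
      finally show "norm (f (of_real x)) \<le> 1 + (cmod (f (of_real x)))\<^sup>2" by simp
    qed
    also have "\<dots> = (b - a) + integral {a..b} (\<lambda>t. (cmod (f (of_real t)))\<^sup>2)"
      using s2(1) that by (subst Henstock_Kurzweil_Integration.integral_add) auto
    also have "integral {a..b} (\<lambda>t. (cmod (f (of_real t)))\<^sup>2) \<le> (pw_norm f)\<^sup>2"
      unfolding s2(2)[symmetric] pw_norm_sq set_lebesgue_integral_def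
      using sint[unfolded set_integrable_def] sqiD(2)[OF sqi]
      by (intro integral_mono) (auto simp: indicator_def)
    finally show ?thesis by simp
  qed
  have real: "cmod (Q (of_real x)) \<le> N * (1 + \<bar>x\<bar>)" for x :: real
  proof -
    have "cmod (Q (of_real x)) \<le> \<bar>x\<bar> + (pw_norm f)\<^sup>2"
    proof (cases "x \<ge> 0")
      case True
      then show ?thesis using diff[of 0 x] Q_0 by simp
    next
      case False
      then show ?thesis using diff[of x 0] Q_0 by simp
    qed
    also have "\<dots> \<le> N * (1 + \<bar>x\<bar>)"
      unfolding N_def by (simp add: algebra_simps)
    finally show ?thesis .
  qed
  obtain C where C: "\<And>z. cmod (f z) \<le> C * exp ((\<sigma> + \<epsilon> / 2) * cmod z)"
    using paley_wienerD(2)[OF f] \<epsilon> unfolding exponential_type_le_def by (meson half_gt_zero)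
  have C0: "C \<ge> 0" using order_trans[OF norm_ge_zero C[of 0]] by simp
  \<comment> \<open>Integration along the segment from 0 to z costs a factor \<bar>z\<bar>. It is
    absorbed by the second half of \<epsilon>, which is why f was first bounded with \<epsilon> /
    2.\<close>
  have growth: "cmod (Q z) \<le> (C * (2 / \<epsilon>)) * exp ((\<sigma> + \<epsilon>) * cmod z)" for z
  proof -
    have "cmod (Q z - Q 0) \<le> (C * exp ((\<sigma> + \<epsilon> / 2) * cmod z)) * cmod (z - 0)"
    proof (rule field_differentiable_bound[of "cball 0 (cmod z)" Q f])
      fix w :: complex assume w: "w \<in> cball 0 (cmod z)"
      show "(Q has_field_derivative f w) (at w within cball 0 (cmod z))"
        using dQ by (rule has_field_derivative_at_within)
      have "(\<sigma> + \<epsilon> / 2) * cmod w \<le> (\<sigma> + \<epsilon> / 2) * cmod z"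
        using w \<sigma> \<epsilon> by (intro mult_left_mono) auto
      then have "C * exp ((\<sigma> + \<epsilon> / 2) * cmod w) \<le> C * exp ((\<sigma> + \<epsilon> / 2) * cmod z)"
        using C0 by (intro mult_left_mono) auto
      then show "cmod (f w) \<le> C * exp ((\<sigma> + \<epsilon> / 2) * cmod z)" using C[of w] by linarith
    qed auto
    also have "\<dots> = C * exp ((\<sigma> + \<epsilon> / 2) * cmod z) * cmod z" by simp
    also have "\<dots> \<le> C * exp ((\<sigma> + \<epsilon> / 2) * cmod z) * (2 / \<epsilon> * exp (\<epsilon> / 2 * cmod z))"
    proof (intro mult_left_mono)
      have "\<epsilon> / 2 * cmod z \<le> exp (\<epsilon> / 2 * cmod z)"
        using exp_ge_add_one_self[of "\<epsilon> / 2 * cmod z"] by linarith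
      then show "cmod z \<le> 2 / \<epsilon> * exp (\<epsilon> / 2 * cmod z)" using \<epsilon> by (simp add: field_simps)
    qed (use C0 in auto)
    also have "\<dots> = (C * (2 / \<epsilon>)) * (exp ((\<sigma> + \<epsilon> / 2) * cmod z) * exp (\<epsilon> / 2 * cmod z))" by simp
    also have "exp ((\<sigma> + \<epsilon> / 2) * cmod z) * exp (\<epsilon> / 2 * cmod z) = exp ((\<sigma> + \<epsilon>) * cmod z)"
      unfolding exp_add[symmetric] by (simp add: algebra_simps)
    finally show ?thesis by (simp add: Q_0)
  qed
  define B where "B = C * (2 / \<epsilon>) + N + 1"
  have B0: "B \<ge> 0" unfolding B_def N_def using C0 \<epsilon> by simp
  have QB: "cmod (Q z) \<le> B * (1 + cmod z) * exp ((\<sigma> + \<epsilon>) * \<bar>Im z\<bar>)" for z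
    unfolding B_def using \<sigma> \<epsilon> by (intro growth_all_quadrants[OF holQ _ growth real]) auto
  have "cmod (f z) \<le> (2 * B * exp (\<sigma> + \<epsilon>)) * (1 + cmod z) * exp ((\<sigma> + \<epsilon>) * \<bar>Im z\<bar>)" for z
  proof -
    have "cmod ((deriv ^^ 1) Q z) \<le> fact 1 * (B * (2 + cmod z) * exp ((\<sigma> + \<epsilon>) * (\<bar>Im z\<bar> + 1))) / 1 ^ 1"
    proof (rule Cauchy_inequality)
      show "Q holomorphic_on ball z 1" "continuous_on (cball z 1) Q"
        using holQ by (auto intro: holomorphic_on_subset holomorphic_on_imp_continuous_on)
      fix w assume w: "cmod (z - w) = 1"
      have "cmod w \<le> cmod z + 1" using w norm_triangle_ineq4[of z "z - w"] by simp
      moreover have "\<bar>Im w\<bar> \<le> \<bar>Im z\<bar> + 1" using w abs_Im_le_cmod[of "z - w"] by simp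
      ultimately have "B * (1 + cmod w) * exp ((\<sigma> + \<epsilon>) * \<bar>Im w\<bar>)
          \<le> B * (2 + cmod z) * exp ((\<sigma> + \<epsilon>) * (\<bar>Im z\<bar> + 1))"
        using B0 \<sigma> \<epsilon> by (intro mult_mono mult_left_mono) auto
      then show "cmod (Q w) \<le> B * (2 + cmod z) * exp ((\<sigma> + \<epsilon>) * (\<bar>Im z\<bar> + 1))"
        using QB[of w] by linarith
    qed auto
    moreover have "deriv Q z = f z" by (rule DERIV_imp_deriv[OF dQ])
    ultimately have "cmod (f z) \<le> B * (2 + cmod z) * exp ((\<sigma> + \<epsilon>) * (\<bar>Im z\<bar> + 1))" by simp
    also have "\<dots> \<le> B * (2 * (1 + cmod z)) * exp ((\<sigma> + \<epsilon>) * (\<bar>Im z\<bar> + 1))"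
      using B0 by (intro mult_right_mono mult_left_mono) auto
    also have "exp ((\<sigma> + \<epsilon>) * (\<bar>Im z\<bar> + 1)) = exp (\<sigma> + \<epsilon>) * exp ((\<sigma> + \<epsilon>) * \<bar>Im z\<bar>)"
      unfolding exp_add[symmetric] by (simp add: algebra_simps)
    finally show ?thesis by (simp add: algebra_simps)
  qed
  then show ?thesis by blast
qed

section \<open>An absolutely convergent reproducing formula\<close>

lemma contour_integral_circlepath_halves:
  assumes I: "(f has_contour_integral I) (circlepath c r)"
  shows "I = contour_integral (part_circlepath c r 0 pi) f + contour_integral (part_circlepath c r pi (2 * pi)) f"
proof -
  have "((\<lambda>t. f (c + r * cis t) * r * \<i> * cis t) has_integral I) {0..2 * pi}"
    using I unfolding circlepath_def by (subst (asm) has_contour_integral_part_circlepath_iff) auto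
  then have "I = integral {0..2 * pi} (\<lambda>t. f (c + r * cis t) * r * \<i> * cis t)"
    and int: "(\<lambda>t. f (c + r * cis t) * r * \<i> * cis t) integrable_on {0..2 * pi}"
    by (auto simp: integral_unique)
  then show ?thesis
    using Henstock_Kurzweil_Integration.integral_combine[OF _ _ int, of pi]
    by (simp add: contour_integral_part_circlepath_eq)
qed

lemma has_limit_integral_symmetric:
  fixes g :: "real \<Rightarrow> complex"
  assumes "integrable lborel g"
  shows "(\<lambda>n. integral {- real n..real n} g) \<longlonglongrightarrow> (LINT t|lborel. g t)"
proof -
  have sint: "set_integrable lborel {- real n..real n} g" for n
    unfolding set_integrable_def using assms by (intro integrable_mult_indicator) auto
  have "(\<lambda>n. LINT t|lborel. indicator {- real n..real n} t *\<^sub>R g t) \<longlonglongrightarrow> (LINT t|lborel. g t)"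
  proof (rule integral_dominated_convergence)
    show "integrable lborel (\<lambda>t. norm (g t))" using assms by simp
    show "AE t in lborel. (\<lambda>n. indicator {- real n..real n} t *\<^sub>R g t) \<longlonglongrightarrow> g t"
    proof (rule AE_I2)
      fix t :: real
      obtain m :: nat where m: "\<bar>t\<bar> \<le> real m" using real_arch_simple by blast
      have "\<forall>\<^sub>F n in sequentially. indicator {- real n..real n} t *\<^sub>R g t = g t"
        using eventually_ge_at_top[of m] by eventually_elim (use m in \<open>auto simp: indicator_def\<close>)
      then show "(\<lambda>n. indicator {- real n..real n} t *\<^sub>R g t) \<longlonglongrightarrow> g t"
        by (rule tendsto_eventually)
    qed
    show "AE t in lborel. norm (indicator {- real n..real n} t *\<^sub>R g t) \<le> norm (g t)" for n
      by (intro AE_I2) (auto simp: indicator_def)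
  qed (use assms in auto)
  moreover have "(LINT t|lborel. indicator {- real n..real n} t *\<^sub>R g t) = integral {- real n..real n} g" for n
    using set_borel_integral_eq_integral(2)[OF sint[of n]] by (simp add: set_lebesgue_integral_def)
  ultimately show ?thesis by simp
qed

text \<open>A kernel reproducing the functions of type less than \<open>\<tau> - 2 \<epsilon>\<close>; unlike the reproducing kernel of
  the space it is absolutely integrable on the real line.\<close>

definition conv_kernel :: "real \<Rightarrow> real \<Rightarrow> complex \<Rightarrow> complex" where
  "conv_kernel \<epsilon> \<tau> z = of_real (\<tau> / pi) * (csinc (of_real \<epsilon> * z))\<^sup>2 * csinc (of_real \<tau> * z)"

lemma holomorphic_conv_kernel: "conv_kernel \<epsilon> \<tau> holomorphic_on UNIV"
  unfolding conv_kernel_def[abs_def] by (intro holomorphic_intros)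

lemma conv_kernel_minus [simp]: "conv_kernel \<epsilon> \<tau> (- z) = conv_kernel \<epsilon> \<tau> z"
  by (simp add: conv_kernel_def)

lemma cnj_conv_kernel: "cnj (conv_kernel \<epsilon> \<tau> z) = conv_kernel \<epsilon> \<tau> (cnj z)"
  by (simp add: conv_kernel_def)

lemma csinc_shift_bound:
  assumes "\<tau> > 0"
  shows "\<exists>B\<ge>0. \<forall>t::real. cmod (csinc (of_real \<tau> * (of_real t - w))) \<le> B / (1 + \<bar>t\<bar>)"
proof (intro exI conjI allI)
  \<comment> \<open>M compares 1 + x with 1 + \<tau> x: it covers small and large \<tau> at
    once.\<close>
  define M where "M = max 1 (1 / \<tau>)"
  define B where "B = 6 * exp (\<tau> * cmod w) * ((1 + cmod w) * M)"
  have M: "M \<ge> 1" "M * \<tau> \<ge> 1" using assms unfolding M_def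
    by (auto simp: max_def field_simps)
  show "B \<ge> 0" unfolding B_def using M by simp
  fix t :: real
  define x where "x = cmod (of_real t - w)"
  have x: "x \<ge> 0" by (simp add: x_def)
  have "\<bar>t\<bar> \<le> cmod w + x"
    using norm_triangle_ineq[of w "of_real t - w"] by (simp add: x_def)
  moreover have "0 \<le> cmod w * x" using x by simp
  ultimately have "1 + \<bar>t\<bar> \<le> (1 + cmod w) * (1 + x)" by (simp add: algebra_simps)
  also have "\<dots> \<le> (1 + cmod w) * (M * (1 + \<tau> * x))"
  proof (intro mult_left_mono)
    have "x \<le> M * \<tau> * x" using M x mult_right_mono[of 1 "M * \<tau>" x] by simp
    then show "1 + x \<le> M * (1 + \<tau> * x)" using M by (simp add: algebra_simps)
  qed auto
  finally have t: "1 + \<bar>t\<bar> \<le> (1 + cmod w) * M * (1 + \<tau> * x)" by (simp add: mult.assoc)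
  have pos: "1 + \<tau> * x > 0" using assms x by (simp add: add_pos_nonneg)
  have "\<bar>Im (of_real \<tau> * (of_real t - w))\<bar> = \<tau> * \<bar>Im w\<bar>" using assms by (simp add: abs_mult)
  moreover have "\<tau> * \<bar>Im w\<bar> \<le> \<tau> * cmod w" using assms abs_Im_le_cmod by (intro mult_left_mono) auto
  ultimately have e: "exp \<bar>Im (of_real \<tau> * (of_real t - w))\<bar> \<le> exp (\<tau> * cmod w)" by simp
  have "cmod (csinc (of_real \<tau> * (of_real t - w))) \<le> 6 * exp \<bar>Im (of_real \<tau> * (of_real t - w))\<bar> / (1 + \<tau> * x)"
    using cmod_csinc_le[of "of_real \<tau> * (of_real t - w)"] assms by (simp add: norm_mult x_def)
  also have "\<dots> \<le> 6 * exp (\<tau> * cmod w) / (1 + \<tau> * x)"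
    using e pos by (intro divide_right_mono) auto
  also have "\<dots> \<le> B / (1 + \<bar>t\<bar>)"
  proof -
    have "6 * exp (\<tau> * cmod w) * (1 + \<bar>t\<bar>) \<le> 6 * exp (\<tau> * cmod w) * ((1 + cmod w) * M * (1 + \<tau> * x))"
      using t by (intro mult_left_mono) auto
    then show ?thesis using pos
      unfolding B_def by (simp add: divide_le_eq pos_le_divide_eq add_pos_nonneg mult_ac)
  qed
  finally show "cmod (csinc (of_real \<tau> * (of_real t - w))) \<le> B / (1 + \<bar>t\<bar>)" .
qed

lemma sqi_if_decay:
  assumes [measurable]: "(\<lambda>t::real. f (complex_of_real t)) \<in> borel_measurable borel"
    and B: "\<And>t::real. cmod (f (complex_of_real t)) \<le> B / (1 + \<bar>t\<bar>)"
  shows "sqi f"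
proof -
  have "integrable lborel (\<lambda>t::real. (cmod (f (complex_of_real t)))\<^sup>2)"
  proof (rule Bochner_Integration.integrable_bound)
    show "integrable lborel (\<lambda>t. B\<^sup>2 * inverse (1 + t\<^sup>2))"
      using integrable_inverse_1_plus_sq by simp
    have "(cmod (f (complex_of_real t)))\<^sup>2 \<le> B\<^sup>2 * inverse (1 + t\<^sup>2)" for t
    proof -
      have "(cmod (f (complex_of_real t)))\<^sup>2 \<le> (B / (1 + \<bar>t\<bar>))\<^sup>2" using B by (intro power_mono) auto
      also have "\<dots> = B\<^sup>2 * inverse ((1 + \<bar>t\<bar>)\<^sup>2)" by (simp add: power_mult_distrib divide_inverse power_inverse)
      also have "\<dots> \<le> B\<^sup>2 * inverse (1 + t\<^sup>2)"
      proof (intro mult_left_mono le_imp_inverse_le)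
        show "1 + t\<^sup>2 \<le> (1 + \<bar>t\<bar>)\<^sup>2" by (simp add: power2_sum)
        show "0 < 1 + t\<^sup>2" by (simp add: add_pos_nonneg)
      qed auto
      finally show ?thesis .
    qed
    then show "AE t in lborel. norm ((cmod (f (complex_of_real t)))\<^sup>2) \<le> norm (B\<^sup>2 * inverse (1 + t\<^sup>2))"
      by (intro AE_I2) auto
  qed measurable
  then show ?thesis by (auto simp: sqi_def)
qed

lemma sqi_csinc_shift:
  assumes "\<tau> > 0"
  shows "sqi (\<lambda>z. csinc (of_real \<tau> * (z - w)))"
proof -
  obtain B where "\<forall>t::real. cmod (csinc (of_real \<tau> * (of_real t - w))) \<le> B / (1 + \<bar>t\<bar>)"
    using csinc_shift_bound[OF assms] by blast
  then show ?thesis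
    by (intro sqi_if_decay[where B = B] borel_measurable_entire holomorphic_intros) auto
qed

text \<open>The squared factor of width \<epsilon> alone supplies the decay of order two; the factor
  of width \<tau> is merely bounded.\<close>

lemma conv_kernel_shift_bound:
  assumes "\<epsilon> > 0" "\<tau> > 0"
  shows "\<exists>B\<ge>0. \<forall>t::real. cmod (conv_kernel \<epsilon> \<tau> (of_real t - w)) \<le> B / (1 + \<bar>t\<bar>)\<^sup>2"
proof -
  obtain B1 where B1: "B1 \<ge> 0" "\<And>t::real. cmod (csinc (of_real \<epsilon> * (of_real t - w))) \<le> B1 / (1 + \<bar>t\<bar>)"
    using csinc_shift_bound[OF assms(1)] by blast
  obtain B2 where B2: "B2 \<ge> 0" "\<And>t::real. cmod (csinc (of_real \<tau> * (of_real t - w))) \<le> B2 / (1 + \<bar>t\<bar>)"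
    using csinc_shift_bound[OF assms(2)] by blast
  show ?thesis
  proof (intro exI conjI allI)
    show "\<tau> / pi * (B1\<^sup>2 * B2) \<ge> 0" using assms B1 B2 by simp
    fix t :: real
    have "cmod (conv_kernel \<epsilon> \<tau> (of_real t - w)) \<le> \<tau> / pi * ((B1 / (1 + \<bar>t\<bar>))\<^sup>2 * (B2 / 1))"
      unfolding conv_kernel_def norm_mult norm_power mult.assoc
    proof (intro mult_mono power_mono)
      have "B2 / (1 + \<bar>t\<bar>) \<le> B2 / 1" using B2(1) by (intro divide_left_mono) auto
      then show "cmod (csinc (of_real \<tau> * (of_real t - w))) \<le> B2 / 1"
        using B2(2)[of t] by linarith
    qed (use assms B1 in \<open>auto simp: norm_divide\<close>)
    then show "cmod (conv_kernel \<epsilon> \<tau> (of_real t - w)) \<le> \<tau> / pi * (B1\<^sup>2 * B2) / (1 + \<bar>t\<bar>)\<^sup>2"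
      by (simp add: power_divide)
  qed
qed

lemma sqi_conv_kernel:
  assumes "\<epsilon> > 0" "\<tau> > 0"
  shows "sqi (\<lambda>z. conv_kernel \<epsilon> \<tau> (z - w))"
proof -
  obtain B where B: "B \<ge> 0" "\<And>t::real. cmod (conv_kernel \<epsilon> \<tau> (of_real t - w)) \<le> B / (1 + \<bar>t\<bar>)\<^sup>2"
    using conv_kernel_shift_bound[OF assms] by blast
  show ?thesis
  proof (rule sqi_if_decay[where B = B])
    show "(\<lambda>t. conv_kernel \<epsilon> \<tau> (of_real t - w)) \<in> borel_measurable borel"
      by (intro borel_measurable_entire[of "\<lambda>z. conv_kernel \<epsilon> \<tau> (z - w)"]
          holomorphic_on_compose_entire[OF holomorphic_conv_kernel] holomorphic_intros)
    fix t :: real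
    have "B / (1 + \<bar>t\<bar>)\<^sup>2 \<le> B / (1 + \<bar>t\<bar>)"
      using B(1) by (intro divide_left_mono) (auto simp: power2_eq_square add_pos_nonneg)
    then show "cmod (conv_kernel \<epsilon> \<tau> (of_real t - w)) \<le> B / (1 + \<bar>t\<bar>)"
      using B(2)[of t] by linarith
  qed
qed

text \<open>The integral over a real segment is moved to the lower semicircle; splitting the sine in
  exponentials there, the half with \<open>exp (\<i> \<tau> z)\<close> is completed by the upper semicircle to a full circle.
  Both remaining semicircle integrals tend to zero.\<close>

lemma paley_wiener_conv:
  assumes f: "f \<in> paley_wiener \<sigma>" and \<sigma>: "\<sigma> > 0" and \<epsilon>: "\<epsilon> > 0"
  defines "\<tau> \<equiv> \<sigma> + 3 * \<epsilon>"
  shows "f w = (LINT t|lborel. f (of_real t) * conv_kernel \<epsilon> \<tau> (of_real t - w))"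
proof -
  note hol = paley_wienerD(1)[OF f] and sqi = paley_wienerD(3)[OF f]
  have \<tau>: "\<tau> > 0" using \<sigma> \<epsilon> by (simp add: \<tau>_def)
  obtain C where C: "\<And>z. cmod (f z) \<le> C * (1 + cmod z) * exp ((\<sigma> + \<epsilon>) * \<bar>Im z\<bar>)"
    using paley_wiener_growth[OF f \<sigma> \<epsilon>] by blast
  have C0: "C \<ge> 0" using order_trans[OF norm_ge_zero C[of 0]] by simp
  define \<Psi> where "\<Psi> = (\<lambda>z. f z * conv_kernel \<epsilon> \<tau> (z - w))"
  \<comment> \<open>\<open>E s\<close> arises from \<Psi> on replacing the sine by exp (\<i> s
    \<tau> (z - w)) and leaving out the constants and the denominator z - w; only s = 1 and s = -1
    are used, and each decays in one half plane.\<close>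
  define E where "E = (\<lambda>s z. f z * (csinc (of_real \<epsilon> * (z - w)))\<^sup>2 * exp (\<i> * of_real (s * \<tau>) * (z - w)))"
  have hol\<Psi>: "\<Psi> holomorphic_on UNIV" unfolding \<Psi>_def
    by (intro holomorphic_intros hol holomorphic_on_compose_entire[OF holomorphic_conv_kernel])
  have holE: "E s holomorphic_on UNIV" for s unfolding E_def
    by (intro holomorphic_intros hol)
  have Ew: "E s w = f w" for s by (simp add: E_def)
  have split: "\<Psi> z = (E 1 z / (z - w) - E (-1) z / (z - w)) / (2 * of_real pi * \<i>)" if "z \<noteq> w" for z
  proof -
    have "csinc (of_real \<tau> * (z - w)) = sin (of_real \<tau> * (z - w)) / (of_real \<tau> * (z - w))"
      using that \<tau> by (simp add: csinc_def)
    moreover have "sin (of_real \<tau> * (z - w)) = (exp (\<i> * of_real (1 * \<tau>) * (z - w)) - exp (\<i> * of_real (-1 * \<tau>) * (z - w))) / (2 * \<i>)"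
    proof -
      have "\<i> * of_real (1 * \<tau>) * (z - w) = \<i> * (of_real \<tau> * (z - w))"
        "\<i> * of_real (-1 * \<tau>) * (z - w) = - (\<i> * (of_real \<tau> * (z - w)))" by simp_all
      then show ?thesis by (simp only: sin_exp_eq)
    qed
    moreover have "F * (T / p * S * ((A - B) / (2 * \<i>) / (T * \<zeta>))) = (F * S * A / \<zeta> - F * S * B / \<zeta>) / (2 * p * \<i>)"
      if "T \<noteq> 0" "p \<noteq> 0" "\<zeta> \<noteq> 0" for F T p S A B \<zeta> :: complex
    proof -
      have "T * S / (p * (2 * \<i>) * (T * \<zeta>)) = S / (2 * p * \<i> * \<zeta>)" using that(1) by simp
      then have "F * (A - B) * (T * S / (p * (2 * \<i>) * (T * \<zeta>))) = F * (A - B) * (S / (2 * p * \<i> * \<zeta>))" by (rule arg_cong)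
      then show ?thesis using that(1) by (simp add: diff_divide_distrib algebra_simps)
    qed
    moreover have "z - w \<noteq> 0" "of_real \<tau> \<noteq> (0::complex)" "of_real pi \<noteq> (0::complex)" using that \<tau> by auto
    ultimately show ?thesis
      unfolding \<Psi>_def conv_kernel_def E_def of_real_divide by (simp only:)
  qed
  define D where "D = C * (36 * exp (2 * \<epsilon> * cmod w)) * exp (\<tau> * cmod w) * 16 / \<epsilon>\<^sup>2"
  have D0: "D \<ge> 0" unfolding D_def using C0 by simp
  \<comment> \<open>The types add up to \<tau>: \<sigma> + \<epsilon> from f and 2 \<epsilon> from
    the squared factor, so the exponentials in \<bar>Im z\<bar> cancel exactly. What remains are the
    powers R from f, R^(-2) from the squared factor and R^(-1) from z - w. After multiplication by
    the length of the arc this is of order 1 / R; a single factor \<open>csinc\<close> would leave a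
    bound of order 1.\<close>
  have bound: "cmod (E s z / (z - w)) \<le> D / R\<^sup>2"
    if s: "\<bar>s\<bar> = 1" "s * Im z \<ge> 0" and R: "cmod z = R" "R \<ge> 2 * cmod w + 1" for s z R
  proof -
    define \<zeta> where "\<zeta> = z - w"
    have R1: "R \<ge> 1" using R norm_ge_zero[of w] by linarith
    have \<zeta>: "cmod \<zeta> \<ge> R / 2"
      using norm_triangle_ineq2[of z w] R norm_ge_zero[of w] unfolding \<zeta>_def by linarith
    have sy: "s * Im z = \<bar>Im z\<bar>"
    proof -
      have "\<bar>s * Im z\<bar> = \<bar>Im z\<bar>" unfolding abs_mult s(1) by simp
      then show ?thesis using s(2) by simp
    qed
    have Im1: "\<bar>Im \<zeta>\<bar> \<le> \<bar>Im z\<bar> + cmod w" unfolding \<zeta>_def using abs_Im_le_cmod[of w] by simp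
    have Im2: "s * Im \<zeta> \<ge> \<bar>Im z\<bar> - cmod w"
    proof -
      have "\<bar>s * Im w\<bar> \<le> cmod w" using s abs_Im_le_cmod[of w] by (simp add: abs_mult)
      then show ?thesis unfolding \<zeta>_def using sy by (simp add: right_diff_distrib abs_le_iff)
    qed
    have 1: "cmod (f z) \<le> C * (2 * R) * exp ((\<sigma> + \<epsilon>) * \<bar>Im z\<bar>)"
    proof -
      have "C * (1 + cmod z) \<le> C * (2 * R)" using R R1 C0 by (intro mult_left_mono) auto
      from order_trans[OF C[of z] mult_right_mono[OF this, of "exp ((\<sigma> + \<epsilon>) * \<bar>Im z\<bar>)"]] show ?thesis by simp
    qed
    have 2: "cmod (csinc (of_real \<epsilon> * \<zeta>)) \<le> 6 * exp (\<epsilon> * (\<bar>Im z\<bar> + cmod w)) / (\<epsilon> * (R / 2))"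
    proof -
      have "cmod (csinc (of_real \<epsilon> * \<zeta>)) \<le> 6 * exp \<bar>Im (of_real \<epsilon> * \<zeta>)\<bar> / (1 + cmod (of_real \<epsilon> * \<zeta>))"
        by (rule cmod_csinc_le)
      also have "\<dots> \<le> 6 * exp (\<epsilon> * (\<bar>Im z\<bar> + cmod w)) / (\<epsilon> * (R / 2))"
      proof (rule frac_le)
        have "\<bar>Im (of_real \<epsilon> * \<zeta>)\<bar> = \<epsilon> * \<bar>Im \<zeta>\<bar>" using \<epsilon> by (simp add: abs_mult)
        also have "\<dots> \<le> \<epsilon> * (\<bar>Im z\<bar> + cmod w)" using Im1 \<epsilon> by (intro mult_left_mono) auto
        finally show "6 * exp \<bar>Im (of_real \<epsilon> * \<zeta>)\<bar> \<le> 6 * exp (\<epsilon> * (\<bar>Im z\<bar> + cmod w))" by simp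
        have "\<epsilon> * (R / 2) \<le> \<epsilon> * cmod \<zeta>" using \<zeta> \<epsilon> by (intro mult_left_mono) auto
        moreover have "cmod (of_real \<epsilon> * \<zeta>) = \<epsilon> * cmod \<zeta>" using \<epsilon> by (simp add: norm_mult)
        ultimately show "\<epsilon> * (R / 2) \<le> 1 + cmod (of_real \<epsilon> * \<zeta>)" by linarith
      qed (use \<epsilon> R1 in auto)
      finally show ?thesis .
    qed
    have 3: "cmod (exp (\<i> * of_real (s * \<tau>) * \<zeta>)) \<le> exp (\<tau> * (cmod w - \<bar>Im z\<bar>))"
    proof -
      have "\<tau> * (\<bar>Im z\<bar> - cmod w) \<le> \<tau> * (s * Im \<zeta>)" using Im2 \<tau> by (intro mult_left_mono) auto
      then show ?thesis by (simp add: algebra_simps)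
    qed
    have "cmod (E s z / (z - w)) = cmod (f z) * (cmod (csinc (of_real \<epsilon> * \<zeta>)))\<^sup>2 * cmod (exp (\<i> * of_real (s * \<tau>) * \<zeta>)) / cmod \<zeta>"
      by (simp only: E_def \<zeta>_def norm_divide norm_mult norm_power)
    also have "\<dots> \<le> (C * (2 * R) * exp ((\<sigma> + \<epsilon>) * \<bar>Im z\<bar>)) * (6 * exp (\<epsilon> * (\<bar>Im z\<bar> + cmod w)) / (\<epsilon> * (R / 2)))\<^sup>2
        * exp (\<tau> * (cmod w - \<bar>Im z\<bar>)) / (R / 2)"
      using 1 2 3 \<zeta> R1 C0 \<epsilon> by (intro frac_le mult_mono power_mono) auto
    also have "(6 * exp (\<epsilon> * (\<bar>Im z\<bar> + cmod w)) / (\<epsilon> * (R / 2)))\<^sup>2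
        = 144 * exp (2 * \<epsilon> * (\<bar>Im z\<bar> + cmod w)) / (\<epsilon>\<^sup>2 * R\<^sup>2)"
      by (simp add: power_divide power_mult_distrib exp_double[symmetric] mult.assoc)
    also have "(C * (2 * R) * exp ((\<sigma> + \<epsilon>) * \<bar>Im z\<bar>)) * (144 * exp (2 * \<epsilon> * (\<bar>Im z\<bar> + cmod w)) / (\<epsilon>\<^sup>2 * R\<^sup>2))
        * exp (\<tau> * (cmod w - \<bar>Im z\<bar>)) / (R / 2)
      = C * 576 / (\<epsilon>\<^sup>2 * R\<^sup>2) * (exp ((\<sigma> + \<epsilon>) * \<bar>Im z\<bar>) * exp (2 * \<epsilon> * (\<bar>Im z\<bar> + cmod w)) * exp (\<tau> * (cmod w - \<bar>Im z\<bar>)))"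
    proof -
      have "(C * (2 * R) * a) * (144 * b / (\<epsilon>\<^sup>2 * R\<^sup>2)) * c / (R / 2) = C * 576 / (\<epsilon>\<^sup>2 * R\<^sup>2) * (a * b * c)" for a b c
        using R1 by simp
      then show ?thesis .
    qed
    also have "exp ((\<sigma> + \<epsilon>) * \<bar>Im z\<bar>) * exp (2 * \<epsilon> * (\<bar>Im z\<bar> + cmod w)) * exp (\<tau> * (cmod w - \<bar>Im z\<bar>))
        = exp (2 * \<epsilon> * cmod w) * exp (\<tau> * cmod w)"
      unfolding exp_add[symmetric] \<tau>_def by (simp add: algebra_simps)
    also have "C * 576 / (\<epsilon>\<^sup>2 * R\<^sup>2) * (exp (2 * \<epsilon> * cmod w) * exp (\<tau> * cmod w)) = D / R\<^sup>2"
      unfolding D_def by simp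
    finally show ?thesis .
  qed
  have est: "cmod (integral {- real n..real n} (\<lambda>t. \<Psi> (of_real t)) - f w) \<le> D / real n"
    if n: "real n \<ge> 2 * cmod w + 1" for n
  proof -
    define R where "R = real n"
    have R: "R \<ge> 1" "cmod w < R" using n norm_ge_zero[of w] unfolding R_def by linarith+
    define up where "up = part_circlepath 0 R 0 pi"
    define low where "low = part_circlepath 0 R pi (2 * pi)"
    have img: "z \<in> path_image up \<Longrightarrow> cmod z = R \<and> Im z \<ge> 0" "z \<in> path_image low \<Longrightarrow> cmod z = R \<and> Im z \<le> 0" for z
    proof -
      show "z \<in> path_image up \<Longrightarrow> cmod z = R \<and> Im z \<ge> 0"
        using R unfolding up_def by (auto simp: path_image_part_circlepath norm_mult Im_exp intro!: mult_nonneg_nonneg sin_ge_zero)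
      have "sin x \<le> 0" if "pi \<le> x" "x \<le> 2 * pi" for x :: real
        using that sin_ge_zero[of "x - pi"] by simp
      then show "z \<in> path_image low \<Longrightarrow> cmod z = R \<and> Im z \<le> 0"
        using R unfolding low_def by (auto simp: path_image_part_circlepath norm_mult Im_exp mult_le_0_iff)
    qed
    have ne: "z \<noteq> w" if "z \<in> path_image up \<or> z \<in> path_image low" for z
      using img that R by auto
    have ci: "(\<lambda>z. E s z / (z - w)) contour_integrable_on up" "(\<lambda>z. E s z / (z - w)) contour_integrable_on low" for s
    proof -
      have cont: "continuous_on A (\<lambda>z. E s z / (z - w))" if "w \<notin> A" for A
        using that by (intro continuous_intros holomorphic_on_imp_continuous_on
          holomorphic_on_subset[OF holE]) auto
      show "(\<lambda>z. E s z / (z - w)) contour_integrable_on up" "(\<lambda>z. E s z / (z - w)) contour_integrable_on low"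
        unfolding up_def low_def using ne unfolding up_def low_def
        by (auto intro!: contour_integrable_continuous_part_circlepath cont)
    qed
    have "((\<lambda>u. E 1 u / (u - w)) has_contour_integral (2 * of_real pi * \<i> * E 1 w)) (circlepath 0 R)"
      using R by (intro Cauchy_integral_circlepath_simple holomorphic_on_subset[OF holE]) auto
    then have circ: "2 * of_real pi * \<i> * f w =
        contour_integral up (\<lambda>z. E 1 z / (z - w)) + contour_integral low (\<lambda>z. E 1 z / (z - w))"
      unfolding up_def low_def Ew by (rule contour_integral_circlepath_halves)
    obtain P where "\<And>z. z \<in> UNIV \<Longrightarrow> (P has_field_derivative \<Psi> z) (at z within UNIV)"
      using holomorphic_convex_primitive'[OF _ _ hol\<Psi>] by blast
    note prim = contour_integral_primitive[OF this]
    have "(\<Psi> has_contour_integral P (pathfinish low) - P (pathstart low)) low"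
      unfolding low_def by (rule prim) auto
    moreover have "(\<Psi> has_contour_integral P (pathfinish (linepath (of_real (- R)) (of_real R)))
        - P (pathstart (linepath (of_real (- R)) (of_real R)))) (linepath (of_real (- R)) (of_real R))"
      by (rule prim) auto
    moreover have "pathfinish low = of_real R" "pathstart low = of_real (- R)"
      unfolding low_def by (simp_all add: pathfinish_def pathstart_def part_circlepath_def linepath_def exp_two_pi_i' mult.commute[of \<i>])
    ultimately have "contour_integral (linepath (of_real (- R)) (of_real R)) \<Psi> = contour_integral low \<Psi>"
      by (simp add: contour_integral_unique)
    moreover have "contour_integral (linepath (of_real (- R)) (of_real R)) \<Psi> = integral {- R..R} (\<lambda>t. \<Psi> (of_real t))"
      using R by (subst contour_integral_linepath_Reals_eq) auto
    moreover have "contour_integral low \<Psi> = contour_integral low (\<lambda>z. (E 1 z / (z - w) - E (-1) z / (z - w)) / (2 * of_real pi * \<i>))"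
      using split ne by (intro contour_integral_eq) auto
    moreover have "\<dots> = (contour_integral low (\<lambda>z. E 1 z / (z - w)) - contour_integral low (\<lambda>z. E (-1) z / (z - w))) / (2 * of_real pi * \<i>)"
      using ci by (simp add: contour_integral_div contour_integrable_diff contour_integral_diff)
    ultimately have "integral {- R..R} (\<lambda>t. \<Psi> (of_real t)) = (contour_integral low (\<lambda>z. E 1 z / (z - w)) - contour_integral low (\<lambda>z. E (-1) z / (z - w))) / (2 * of_real pi * \<i>)"
      by (simp only:)
    note Ieq = this
    \<comment> \<open>The integral of the \<open>E 1\<close> term over the lower semicircle occurs
      in both formulas. Subtraction leaves each exponential on the semicircle on which it
      decays.\<close>
    have "integral {- R..R} (\<lambda>t. \<Psi> (of_real t)) - f w
      = - (contour_integral up (\<lambda>z. E 1 z / (z - w)) + contour_integral low (\<lambda>z. E (-1) z / (z - w))) / (2 * of_real pi * \<i>)"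
    proof -
      have "I - fw = - (U + L2) / k" if "k * fw = U + L1" "I = (L1 - L2) / k" "k \<noteq> 0" for I fw U L1 L2 k :: complex
      proof -
        have "fw = (U + L1) / k" using that(1,3) by (metis nonzero_mult_div_cancel_left)
        then have "I - fw = (L1 - L2 - (U + L1)) / k" unfolding that(2) by (simp only: diff_divide_distrib)
        moreover have "L1 - L2 - (U + L1) = - (U + L2)" by simp
        ultimately show ?thesis by (simp only:)
      qed
      from this[OF circ Ieq] show ?thesis by simp
    qed
    then have "cmod (integral {- R..R} (\<lambda>t. \<Psi> (of_real t)) - f w)
      = cmod (contour_integral up (\<lambda>z. E 1 z / (z - w)) + contour_integral low (\<lambda>z. E (-1) z / (z - w))) / (2 * pi)"
      by (simp only: norm_divide norm_minus_cancel) (simp add: norm_mult)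
    also have "\<dots> \<le> (cmod (contour_integral up (\<lambda>z. E 1 z / (z - w))) + cmod (contour_integral low (\<lambda>z. E (-1) z / (z - w)))) / (2 * pi)"
      by (intro divide_right_mono norm_triangle_ineq) auto
    also have "\<dots> \<le> (D / R\<^sup>2 * R * pi + D / R\<^sup>2 * R * pi) / (2 * pi)"
    proof (intro divide_right_mono add_mono)
      have "cmod (contour_integral up (\<lambda>z. E 1 z / (z - w))) \<le> D / R\<^sup>2 * R * \<bar>pi - 0\<bar>"
        unfolding up_def
        by (rule contour_integral_bound_part_circlepath)
           (use ci img bound[of 1 _ R] D0 R n in \<open>auto simp: up_def[symmetric] R_def[symmetric]\<close>)
      then show "cmod (contour_integral up (\<lambda>z. E 1 z / (z - w))) \<le> D / R\<^sup>2 * R * pi" by simp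
      have "cmod (contour_integral low (\<lambda>z. E (-1) z / (z - w))) \<le> D / R\<^sup>2 * R * \<bar>2 * pi - pi\<bar>"
        unfolding low_def
        by (rule contour_integral_bound_part_circlepath)
           (use ci img bound[of "-1" _ R] D0 R n in \<open>auto simp: low_def[symmetric] R_def[symmetric]\<close>)
      then show "cmod (contour_integral low (\<lambda>z. E (-1) z / (z - w))) \<le> D / R\<^sup>2 * R * pi" by simp
    qed auto
    also have "\<dots> = D / R" using R by (simp add: field_simps power2_eq_square)
    finally show ?thesis unfolding R_def .
  qed
  have "(\<lambda>n. integral {- real n..real n} (\<lambda>t. \<Psi> (of_real t)) - f w) \<longlonglongrightarrow> 0"
  proof (rule Lim_null_comparison)
    obtain m :: nat where m: "2 * cmod w + 1 \<le> real m" using real_arch_simple by blast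
    show "\<forall>\<^sub>F n in sequentially. norm (integral {- real n..real n} (\<lambda>t. \<Psi> (of_real t)) - f w) \<le> D / real n"
      using eventually_ge_at_top[of m] by eventually_elim (use est m in force)
    show "(\<lambda>n. D / real n) \<longlonglongrightarrow> 0" by (rule lim_const_over_n)
  qed
  then have "(\<lambda>n. integral {- real n..real n} (\<lambda>t. \<Psi> (of_real t))) \<longlonglongrightarrow> f w"
    by (rule LIM_zero_cancel)
  moreover have "integrable lborel (\<lambda>t::real. \<Psi> (of_real t))"
    unfolding \<Psi>_def using integrable_sqi_mult[OF sqi sqi_conv_kernel[OF \<epsilon> \<tau>, of w]] by simp
  from has_limit_integral_symmetric[OF this]
  have "(\<lambda>n. integral {- real n..real n} (\<lambda>t. \<Psi> (of_real t))) \<longlonglongrightarrow> (LINT t|lborel. \<Psi> (of_real t))" .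
  ultimately show ?thesis unfolding \<Psi>_def by (rule LIMSEQ_unique)
qed

section \<open>Translations and the reproducing kernel\<close>

text \<open>Integrable majorant of the shifted convolution kernel, up to a constant. Its square root
  is still square integrable, as the splitting in \<open>weak_young\<close> requires.\<close>

definition wt :: "real \<Rightarrow> real" where
  "wt s = 1 / (1 + \<bar>s\<bar>)\<^sup>2"

lemma wt_nonneg [simp]: "wt s \<ge> 0"
  by (simp add: wt_def)

lemma wt_minus_commute: "wt (s - t) = wt (t - s)"
  by (simp add: wt_def abs_minus_commute)

lemma borel_measurable_wt [measurable]: "wt \<in> borel_measurable borel"
  unfolding wt_def[abs_def] by measurable

lemma integrable_wt: "integrable lborel wt"
proof (rule Bochner_Integration.integrable_bound[OF integrable_inverse_1_plus_sq])
  show "AE s in lborel. norm (wt s) \<le> norm (inverse (1 + s\<^sup>2))"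
  proof (rule AE_I2)
    fix s :: real
    have "1 / (1 + \<bar>s\<bar>)\<^sup>2 \<le> 1 / (1 + s\<^sup>2)"
      by (intro divide_left_mono) (auto simp: power2_sum add_pos_nonneg)
    then show "norm (wt s) \<le> norm (inverse (1 + s\<^sup>2))"
      by (simp add: wt_def inverse_eq_divide)
  qed
qed simp

lemma integrable_wt_shift: "integrable lborel (\<lambda>t. wt (t - x))"
  using lborel_integrable_real_affine[OF integrable_wt, of 1 "- x"] by simp

lemma integral_wt_shift: "(LINT t|lborel. wt (t - x)) = (LINT t|lborel. wt t)"
  using lborel_integral_real_affine[of 1 wt "- x"] by simp

lemma integrable_prod_wt:
  assumes F: "integrable lborel F"
  shows "integrable (lborel \<Otimes>\<^sub>M lborel) (\<lambda>(x, t). F x * wt (t - x))"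
proof (rule lborel_pair.Fubini_integrable)
  have [measurable]: "F \<in> borel_measurable borel" using F by auto
  show "(\<lambda>(x, t). F x * wt (t - x)) \<in> borel_measurable (lborel \<Otimes>\<^sub>M lborel)" by measurable
  have "(LINT t|lborel. norm (case (x, t) of (x, t) \<Rightarrow> F x * wt (t - x))) = \<bar>F x\<bar> * (LINT t|lborel. wt t)" for x
    by (simp add: abs_mult integral_wt_shift)
  then show "integrable lborel (\<lambda>x. LINT t|lborel. norm (case (x, t) of (x, t) \<Rightarrow> F x * wt (t - x)))"
    using F by simp
  show "AE x in lborel. integrable lborel (\<lambda>t. case (x, t) of (x, t) \<Rightarrow> F x * wt (t - x))"
    using integrable_wt_shift by simp
qed

lemma integrable_prod_wt':
  assumes F: "integrable lborel F"
  shows "integrable (lborel \<Otimes>\<^sub>M lborel) (\<lambda>(x, t). F t * wt (t - x))"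
  using lborel_pair.integrable_product_swap[OF integrable_prod_wt[OF F]]
  by (simp add: wt_minus_commute)

lemma sqi_sqrt_wt: "sqi (\<lambda>z. of_real (1 / (1 + \<bar>Re z - x\<bar>)))"
proof -
  have "integrable lborel (\<lambda>t::real. (cmod (of_real (1 / (1 + \<bar>Re (of_real t) - x\<bar>))))\<^sup>2)"
    using integrable_wt_shift[of x] unfolding norm_of_real by (simp add: wt_def power_divide)
  then show ?thesis unfolding sqi_def by simp
qed

text \<open>Young's inequality for convolution with an integrable weight, stated for a function that
  is only majorised by the convolution. Cauchy-Schwarz is applied to f times the root of the weight
  and the root of the weight; Fubini then integrates the weight out.\<close>

lemma weak_young:
  assumes f: "sqi f" and h: "(\<lambda>t::real. h (complex_of_real t)) \<in> borel_measurable borel"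
    and B: "B \<ge> 0"
    and le: "\<And>x::real. cmod (h (of_real x)) \<le> (LINT t|lborel. cmod (f (of_real t)) * (B * wt (t - x)))"
  shows "sqi h" "pw_norm h \<le> B * (LINT t|lborel. wt t) * pw_norm f"
proof -
  define c where "c = (LINT t|lborel. wt t)"
  have c: "c \<ge> 0" unfolding c_def by simp
  define I where "I = (\<lambda>x. LINT t|lborel. (cmod (f (of_real t)))\<^sup>2 * wt (t - x))"
  have int: "integrable (lborel \<Otimes>\<^sub>M lborel) (\<lambda>(x, t). (cmod (f (complex_of_real t)))\<^sup>2 * wt (t - x))"
    by (rule integrable_prod_wt'[OF sqiD(2)[OF f]])
  have I: "integrable lborel I"
    using lborel_pair.integrable_fst'[OF int] by (simp add: I_def)
  have Ival: "(LINT x|lborel. I x) = c * (pw_norm f)\<^sup>2"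
  proof -
    have "(LINT x|lborel. I x) = (LINT t|lborel. LINT x|lborel. (cmod (f (of_real t)))\<^sup>2 * wt (t - x))"
      using lborel_pair.Fubini_integral[OF int] by (simp add: I_def)
    also have "\<dots> = (LINT t|lborel. (cmod (f (of_real t)))\<^sup>2 * c)"
    proof -
      have "(LINT x|lborel. wt (t - x)) = c" for t
        using integral_wt_shift[of t] by (simp add: wt_minus_commute[of t] c_def)
      then show ?thesis by simp
    qed
    finally show ?thesis by (simp add: pw_norm_sq)
  qed
  have sq: "(cmod (h (of_real x)))\<^sup>2 \<le> B\<^sup>2 * c * I x" for x :: real
  proof -
    define G where "G = (\<lambda>z. complex_of_real (1 / (1 + \<bar>Re z - x\<bar>)))"
    have G: "sqi G" unfolding G_def by (rule sqi_sqrt_wt)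
    have normG: "cmod (G (of_real t)) = 1 / (1 + \<bar>t - x\<bar>)" for t unfolding G_def norm_of_real by simp
    have Gf: "sqi (\<lambda>z. G z * f z)"
      by (rule sqi_mult_bounded[OF f sqiD(1)[OF G], of 1]) (simp add: normG)
    have "(LINT t|lborel. cmod (f (of_real t)) * wt (t - x))
        = (LINT t|lborel. cmod (G (of_real t) * f (of_real t)) * cmod (G (of_real t)))"
      by (simp add: norm_mult normG wt_def power2_eq_square)
    also have "\<dots> \<le> pw_norm (\<lambda>z. G z * f z) * pw_norm G"
      by (rule sqi_integral_abs_mult(2)[OF Gf G])
    finally have "cmod (h (of_real x)) \<le> B * (pw_norm (\<lambda>z. G z * f z) * pw_norm G)"
      using le[of x] mult_left_mono[OF _ B] by (fastforce simp: mult.left_commute[of _ B])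
    then have "(cmod (h (of_real x)))\<^sup>2 \<le> (B * (pw_norm (\<lambda>z. G z * f z) * pw_norm G))\<^sup>2"
      by (intro power_mono) auto
    also have "\<dots> = B\<^sup>2 * (pw_norm G)\<^sup>2 * (pw_norm (\<lambda>z. G z * f z))\<^sup>2"
      by (simp add: power_mult_distrib)
    also have "(pw_norm G)\<^sup>2 = c"
      unfolding pw_norm_sq normG c_def using integral_wt_shift[of x] by (simp add: wt_def[abs_def] power_divide)
    also have "(pw_norm (\<lambda>z. G z * f z))\<^sup>2 = I x"
      unfolding pw_norm_sq norm_mult normG I_def by (simp add: wt_def power_divide power_mult_distrib)
    finally show ?thesis .
  qed
  show "sqi h"
    unfolding sqi_def
  proof (rule conjI[OF h], rule Bochner_Integration.integrable_bound)
    show "integrable lborel (\<lambda>x. B\<^sup>2 * c * I x)" using I by simp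
    show "AE x in lborel. norm ((cmod (h (of_real x)))\<^sup>2) \<le> norm (B\<^sup>2 * c * I x)"
      using order_trans[OF sq abs_ge_self] by (intro AE_I2) simp
    show "(\<lambda>x. (cmod (h (complex_of_real x)))\<^sup>2) \<in> borel_measurable lborel" using h by simp
  qed
  then have "(pw_norm h)\<^sup>2 \<le> (LINT x|lborel. B\<^sup>2 * c * I x)"
    unfolding pw_norm_sq using sq I by (intro integral_mono sqiD) auto
  also have "\<dots> = (B * c * pw_norm f)\<^sup>2" by (simp add: Ival power2_eq_square)
  finally show "pw_norm h \<le> B * c * pw_norm f"
    by (rule power2_le_imp_le) (use B c in auto)
qed

lemma exponential_type_le_affine:
  assumes f: "exponential_type_le \<sigma> f" and a: "\<bar>a\<bar> \<le> 1" and \<sigma>: "\<sigma> \<ge> 0" "\<bar>a\<bar> * \<sigma> \<le> \<sigma>'"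
  shows "exponential_type_le \<sigma>' (\<lambda>z. f (of_real a * z + b))"
  unfolding exponential_type_le_def
proof (intro allI impI)
  fix \<epsilon> :: real assume \<epsilon>: "\<epsilon> > 0"
  obtain C where C: "\<And>z. cmod (f z) \<le> C * exp ((\<sigma> + \<epsilon>) * cmod z)"
    using f \<epsilon> unfolding exponential_type_le_def by blast
  have C0: "C \<ge> 0" using order_trans[OF norm_ge_zero C[of 0]] by simp
  have "cmod (f (of_real a * z + b)) \<le> (C * exp ((\<sigma> + \<epsilon>) * cmod b)) * exp ((\<sigma>' + \<epsilon>) * cmod z)" for z
  proof -
    have "cmod (of_real a * z + b) \<le> \<bar>a\<bar> * cmod z + cmod b"
      using norm_triangle_ineq[of "of_real a * z" b] by (simp add: norm_mult)
    then have "(\<sigma> + \<epsilon>) * cmod (of_real a * z + b) \<le> (\<sigma> + \<epsilon>) * (\<bar>a\<bar> * cmod z + cmod b)"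
      using \<sigma> \<epsilon> by (intro mult_left_mono) auto
    also have "\<dots> = (\<bar>a\<bar> * \<sigma> + \<bar>a\<bar> * \<epsilon>) * cmod z + (\<sigma> + \<epsilon>) * cmod b" by (simp add: algebra_simps)
    also have "\<dots> \<le> (\<sigma>' + \<epsilon>) * cmod z + (\<sigma> + \<epsilon>) * cmod b"
    proof -
      have "\<bar>a\<bar> * \<epsilon> \<le> 1 * \<epsilon>" using a \<epsilon> by (intro mult_right_mono) auto
      then show ?thesis using \<sigma> by (intro add_right_mono mult_right_mono) auto
    qed
    finally have "C * exp ((\<sigma> + \<epsilon>) * cmod (of_real a * z + b)) \<le> C * exp ((\<sigma>' + \<epsilon>) * cmod z + (\<sigma> + \<epsilon>) * cmod b)"
      using C0 by (intro mult_left_mono) auto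
    then show ?thesis using C[of "of_real a * z + b"] by (simp add: exp_add mult_ac)
  qed
  then show "\<exists>C. \<forall>z. cmod (f (of_real a * z + b)) \<le> C * exp ((\<sigma>' + \<epsilon>) * cmod z)" by blast
qed

text \<open>All three claims come from evaluating the reproducing convolution at x + c: the kernel
  is at most a constant times \<open>wt (t - x)\<close> uniformly in real x, so
  \<open>weak_young\<close> gives square integrability and the bound, and Fubini moves the complex
  shift to the other factor. The parameter \<epsilon> = 1 is an arbitrary choice, whence the type
  \<sigma> + 3.\<close>

lemma
  assumes \<sigma>: "\<sigma> > 0"
  shows paley_wiener_translate: "f \<in> paley_wiener \<sigma> \<Longrightarrow> (\<lambda>z. f (z + c)) \<in> paley_wiener \<sigma>"
    and translate_bounded: "\<exists>M. \<forall>f\<in>paley_wiener \<sigma>. pw_norm (\<lambda>z. f (z + c)) \<le> M * pw_norm f"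
    and pw_inner_translate:
      "f \<in> paley_wiener \<sigma> \<Longrightarrow> g \<in> paley_wiener \<sigma> \<Longrightarrow>
        pw_inner (\<lambda>z. f (z + c)) g = pw_inner f (\<lambda>z. g (z - cnj c))"
proof -
  define k where "k = (\<lambda>z. conv_kernel 1 (\<sigma> + 3) z)"
  obtain B where B: "B \<ge> 0" "\<And>t::real. cmod (k (of_real t - c)) \<le> B * wt t"
    using conv_kernel_shift_bound[of 1 "\<sigma> + 3" c] \<sigma> unfolding k_def wt_def by auto
  have holk: "k holomorphic_on UNIV" unfolding k_def by (rule holomorphic_conv_kernel)
  have repr: "f w = (LINT t|lborel. f (of_real t) * k (of_real t - w))" if "f \<in> paley_wiener \<sigma>" for f w
    unfolding k_def using paley_wiener_conv[OF that \<sigma>, of 1 w] by simp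
  have hol: "(\<lambda>z. f (z + c)) holomorphic_on UNIV" if "f \<in> paley_wiener \<sigma>" for f
    by (intro holomorphic_on_compose_entire[OF paley_wienerD(1)[OF that]] holomorphic_intros)
  have le: "cmod (f (of_real x + c)) \<le> (LINT t|lborel. cmod (f (of_real t)) * (B * wt (t - x)))"
    if f: "f \<in> paley_wiener \<sigma>" for f and x :: real
  proof -
    have kb: "cmod (k (of_real t - (of_real x + c))) \<le> B * wt (t - x)" for t
      using B(2)[of "t - x"] by (simp add: algebra_simps)
    have "cmod (f (of_real x + c)) \<le> (LINT t|lborel. cmod (f (of_real t) * k (of_real t - (of_real x + c))))"
      by (subst repr[OF f]) (rule integral_norm_bound)
    also have "\<dots> \<le> (LINT t|lborel. cmod (f (of_real t)) * (B * wt (t - x)))"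
    proof (rule integral_mono)
      show "integrable lborel (\<lambda>t::real. cmod (f (of_real t) * k (of_real t - (of_real x + c))))"
        using integrable_norm[OF integrable_sqi_mult[OF paley_wienerD(3)[OF f] sqi_conv_kernel[of 1 "\<sigma> + 3" "of_real x + c"]]] \<sigma>
        unfolding k_def by simp
      have "sqi (\<lambda>z. of_real (B * wt (Re z - x)))"
      proof (rule sqi_if_decay)
        show "(\<lambda>t. complex_of_real (B * wt (Re (complex_of_real t) - x))) \<in> borel_measurable borel" by simp
        fix t :: real
        have "(1 + \<bar>t\<bar>) \<le> (1 + \<bar>x\<bar>) * (1 + \<bar>t - x\<bar>)"
        proof -
          have "0 \<le> \<bar>x\<bar> * \<bar>t - x\<bar>" by simp
          moreover have "\<bar>t\<bar> \<le> \<bar>x\<bar> + \<bar>t - x\<bar>" by linarith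
          moreover have "(1 + \<bar>x\<bar>) * (1 + \<bar>t - x\<bar>) = 1 + \<bar>x\<bar> + \<bar>t - x\<bar> + \<bar>x\<bar> * \<bar>t - x\<bar>"
            by (simp add: algebra_simps)
          ultimately show ?thesis by linarith
        qed
        also have "\<dots> \<le> (1 + \<bar>x\<bar>) * (1 + \<bar>t - x\<bar>)\<^sup>2"
          using self_le_power[of "1 + \<bar>t - x\<bar>" 2] by (intro mult_left_mono) auto
        finally have "B * (1 + \<bar>t\<bar>) \<le> B * ((1 + \<bar>x\<bar>) * (1 + \<bar>t - x\<bar>)\<^sup>2)"
          using B(1) by (intro mult_left_mono)
        then have "B / (1 + \<bar>t - x\<bar>)\<^sup>2 \<le> B * (1 + \<bar>x\<bar>) / (1 + \<bar>t\<bar>)"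
          by (simp add: divide_le_eq pos_le_divide_eq add_pos_nonneg mult_ac)
        then show "cmod (complex_of_real (B * wt (Re (complex_of_real t) - x))) \<le> B * (1 + \<bar>x\<bar>) / (1 + \<bar>t\<bar>)"
          using B(1) unfolding norm_of_real by (simp add: wt_def)
      qed
      from integrable_norm[OF integrable_sqi_mult[OF paley_wienerD(3)[OF f] this]]
      show "integrable lborel (\<lambda>t. cmod (f (of_real t)) * (B * wt (t - x)))"
        using B(1) unfolding norm_mult norm_of_real by simp
    qed (use kb in \<open>auto simp: norm_mult intro!: mult_left_mono\<close>)
    finally show ?thesis .
  qed
  have meas: "(\<lambda>t::real. f (of_real t + c)) \<in> borel_measurable borel" if "f \<in> paley_wiener \<sigma>" for f
    using borel_measurable_entire[OF hol[OF that]] by simp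
  have young: "sqi (\<lambda>z. f (z + c))" "pw_norm (\<lambda>z. f (z + c)) \<le> B * (LINT t|lborel. wt t) * pw_norm f"
    if f: "f \<in> paley_wiener \<sigma>" for f
    by (rule weak_young[where h = "\<lambda>z. f (z + c)", OF paley_wienerD(3)[OF f] meas[OF f] B(1) le[OF f]])+
  show mem: "(\<lambda>z. f (z + c)) \<in> paley_wiener \<sigma>" if "f \<in> paley_wiener \<sigma>" for f
    using hol[OF that] young(1)[OF that] exponential_type_le_affine[OF paley_wienerD(2)[OF that], of 1 \<sigma> c] \<sigma> that
    by (auto intro: paley_wienerI)
  show "\<exists>M. \<forall>f\<in>paley_wiener \<sigma>. pw_norm (\<lambda>z. f (z + c)) \<le> M * pw_norm f"
    using young(2) by blast
  show "pw_inner (\<lambda>z. f (z + c)) g = pw_inner f (\<lambda>z. g (z - cnj c))"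
    if f: "f \<in> paley_wiener \<sigma>" and g: "g \<in> paley_wiener \<sigma>" for f g
  proof -
    note sf = paley_wienerD(3)[OF f] and sg = paley_wienerD(3)[OF g]
    note [measurable] = sqiD(1)[OF sf] sqiD(1)[OF sg]
    have [measurable]: "(\<lambda>s::real. k (of_real s - c)) \<in> borel_measurable borel"
      by (intro borel_measurable_entire[of "\<lambda>z. k (z - c)"] holomorphic_on_compose_entire[OF holk] holomorphic_intros)
    define H where "H = (\<lambda>(x::real) (t::real). f (of_real t) * k (of_real (t - x) - c) * cnj (g (of_real x)))"
    have cnjm: "(\<lambda>x::real. cnj (g (of_real x))) \<in> borel_measurable borel"
      using sqiD(1)[OF sqi_cnj[OF sg]] .
    note [measurable] = cnjm
    \<comment> \<open>The product of the moduli of f at t and g at x is at most the sum of their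
      squares, and each square times the weight is integrable on the plane.\<close>
    have int: "integrable (lborel \<Otimes>\<^sub>M lborel) (\<lambda>(x, t). H x t)"
    proof (rule Bochner_Integration.integrable_bound)
      show "integrable (lborel \<Otimes>\<^sub>M lborel)
        (\<lambda>p. B * ((case p of (x, t) \<Rightarrow> (cmod (f (of_real t)))\<^sup>2 * wt (t - x)) + (case p of (x, t) \<Rightarrow> (cmod (g (of_real x)))\<^sup>2 * wt (t - x))))"
        by (intro integrable_mult_right Bochner_Integration.integrable_add integrable_prod_wt integrable_prod_wt' sqiD sf sg)
      show "(\<lambda>(x, t). H x t) \<in> borel_measurable (lborel \<Otimes>\<^sub>M lborel)" unfolding H_def by measurable
      have "cmod (H x t) \<le> B * ((cmod (f (of_real t)))\<^sup>2 * wt (t - x) + (cmod (g (of_real x)))\<^sup>2 * wt (t - x))" for x t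
      proof -
        have "cmod (H x t) = (cmod (f (of_real t)) * cmod (g (of_real x))) * cmod (k (of_real (t - x) - c))"
          by (simp add: H_def norm_mult)
        also have "\<dots> \<le> ((cmod (f (of_real t)))\<^sup>2 + (cmod (g (of_real x)))\<^sup>2) * (B * wt (t - x))"
        proof (intro mult_mono B(2))
          have "2 * (cmod (f (of_real t)) * cmod (g (of_real x))) \<le> (cmod (f (of_real t)))\<^sup>2 + (cmod (g (of_real x)))\<^sup>2"
            using sum_squares_bound by (simp add: mult.assoc)
          moreover have "0 \<le> cmod (f (of_real t)) * cmod (g (of_real x))" by simp
          ultimately show "cmod (f (of_real t)) * cmod (g (of_real x)) \<le> (cmod (f (of_real t)))\<^sup>2 + (cmod (g (of_real x)))\<^sup>2"
            by linarith
        qed auto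
        finally show ?thesis by (simp add: algebra_simps)
      qed
      then show "AE p in lborel \<Otimes>\<^sub>M lborel. norm (case p of (x, t) \<Rightarrow> H x t) \<le>
        norm (B * ((case p of (x, t) \<Rightarrow> (cmod (f (of_real t)))\<^sup>2 * wt (t - x)) + (case p of (x, t) \<Rightarrow> (cmod (g (of_real x)))\<^sup>2 * wt (t - x))))"
        by (intro AE_I2) (auto intro: order_trans[OF _ abs_ge_self])
    qed
    have "pw_inner (\<lambda>z. f (z + c)) g = (LINT x|lborel. LINT t|lborel. H x t)"
      unfolding pw_inner_def
    proof (rule Bochner_Integration.integral_cong[OF refl])
      fix x :: real
      have "f (of_real x + c) = (LINT t|lborel. f (of_real t) * k (of_real (t - x) - c))"
        using repr[OF f, of "of_real x + c"] by (simp add: algebra_simps)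
      then show "f (of_real x + c) * cnj (g (of_real x)) = (LINT t|lborel. H x t)"
        unfolding H_def by simp
    qed
    also have "\<dots> = (LINT t|lborel. LINT x|lborel. H x t)"
      using lborel_pair.Fubini_integral[OF int] by simp
    also have "\<dots> = pw_inner f (\<lambda>z. g (z - cnj c))"
      unfolding pw_inner_def
    proof (rule Bochner_Integration.integral_cong[OF refl])
      fix t :: real
      \<comment> \<open>Here the kernel being even and real on the real axis turns the shift by c
        into the shift by minus its conjugate.\<close>
      have "k (of_real (t - x) - c) = cnj (k (of_real x - (of_real t - cnj c)))" for x
      proof -
        have "cnj (k (of_real x - (of_real t - cnj c))) = k (- (of_real (t - x) - c))"
          unfolding k_def cnj_conv_kernel by (simp add: algebra_simps)
        also have "\<dots> = k (of_real (t - x) - c)" unfolding k_def by (rule conv_kernel_minus)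
        finally show ?thesis ..
      qed
      then have "(LINT x|lborel. H x t) = (LINT x|lborel. f (of_real t) * cnj (g (of_real x) * k (of_real x - (of_real t - cnj c))))"
        unfolding H_def by (simp add: mult_ac)
      also have "\<dots> = f (of_real t) * cnj (g (of_real t - cnj c))"
        using repr[OF g, of "of_real t - cnj c"] by (simp flip: Bochner_Integration.integral_cnj)
      finally show "(LINT x|lborel. H x t) = f (of_real t) * cnj (g (of_real t - cnj c))" .
    qed
    finally show ?thesis .
  qed
qed

text \<open>The sinc kernel sin (\<sigma> (z - w')) / (\<pi> (z - w')), w' the conjugate of w, with
  its removable singularity filled in.\<close>

definition rkernel :: "real \<Rightarrow> complex \<Rightarrow> complex \<Rightarrow> complex" where
  "rkernel \<sigma> w z = of_real (\<sigma> / pi) * csinc (of_real \<sigma> * (z - cnj w))"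

lemma exponential_type_leI:
  assumes "\<And>z. cmod (f z) \<le> C * exp (\<sigma> * cmod z)"
  shows "exponential_type_le \<sigma> f"
  unfolding exponential_type_le_def
proof (intro allI impI exI)
  fix \<epsilon> :: real and z assume "\<epsilon> > 0"
  have C0: "C \<ge> 0" using order_trans[OF norm_ge_zero assms[of 0]] by simp
  have "\<sigma> * cmod z \<le> (\<sigma> + \<epsilon>) * cmod z" using \<open>\<epsilon> > 0\<close> by (intro mult_right_mono) auto
  then have "C * exp (\<sigma> * cmod z) \<le> C * exp ((\<sigma> + \<epsilon>) * cmod z)" using C0 by (intro mult_left_mono) auto
  then show "cmod (f z) \<le> C * exp ((\<sigma> + \<epsilon>) * cmod z)" using assms[of z] by linarith
qed

lemma rkernel_in_paley_wiener:
  assumes \<sigma>: "\<sigma> > 0"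
  shows "rkernel \<sigma> w \<in> paley_wiener \<sigma>"
proof (rule paley_wienerI)
  show "rkernel \<sigma> w holomorphic_on UNIV" unfolding rkernel_def[abs_def] by (intro holomorphic_intros)
  show "sqi (rkernel \<sigma> w)" unfolding rkernel_def[abs_def]
    by (intro sqi_scale sqi_csinc_shift \<sigma>)
  have "cmod (rkernel \<sigma> w z) \<le> (\<sigma> / pi * (6 * exp (\<sigma> * cmod w))) * exp (\<sigma> * cmod z)" for z
  proof -
    let ?u = "of_real \<sigma> * (z - cnj w)"
    have "cmod (csinc ?u) \<le> 6 * exp \<bar>Im ?u\<bar> / (1 + cmod ?u)" by (rule cmod_csinc_le)
    also have "\<dots> \<le> 6 * exp \<bar>Im ?u\<bar> / 1" by (intro divide_left_mono) (auto simp: add_pos_nonneg)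
    also have "\<dots> \<le> 6 * (exp (\<sigma> * cmod w) * exp (\<sigma> * cmod z))"
    proof -
      have "\<bar>Im ?u\<bar> \<le> cmod ?u" by (rule abs_Im_le_cmod)
      also have "\<dots> \<le> \<sigma> * (cmod z + cmod w)"
        using norm_triangle_ineq4[of z "cnj w"] \<sigma> by (simp add: norm_mult)
      finally have "exp \<bar>Im ?u\<bar> \<le> exp (\<sigma> * (cmod z + cmod w))" by simp
      then show ?thesis by (simp add: exp_add[symmetric] algebra_simps)
    qed
    finally have "\<sigma> / pi * cmod (csinc ?u) \<le> \<sigma> / pi * (6 * (exp (\<sigma> * cmod w) * exp (\<sigma> * cmod z)))"
      using \<sigma> by (intro mult_left_mono) auto
    moreover have "cmod (complex_of_real (\<sigma> / pi)) = \<sigma> / pi" using \<sigma> unfolding norm_of_real by simp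
    ultimately show ?thesis unfolding rkernel_def norm_mult by (simp add: mult.assoc)
  qed
  then show "exponential_type_le \<sigma> (rkernel \<sigma> w)" by (rule exponential_type_leI)
qed

lemma sqi_rkernel: "\<sigma> > 0 \<Longrightarrow> sqi (rkernel \<sigma> w)"
  using paley_wienerD(3)[OF rkernel_in_paley_wiener] .

lemma rkernel_translate: "rkernel \<sigma> w (z + c) = rkernel \<sigma> (w - cnj c) z"
  by (simp add: rkernel_def algebra_simps)

text \<open>The limit \<epsilon> \<rightarrow> 0 of the convolution formula. The kernels lose their
  uniform integrable majorant, but B / (1 + \<bar>t\<bar>) still majorises all of them; it is square
  integrable, so its product with \<bar>f\<bar> dominates the integrands.\<close>

lemma reproducing_at_0:
  assumes f: "f \<in> paley_wiener \<sigma>" and \<sigma>: "\<sigma> > 0"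
  shows "f 0 = pw_inner f (rkernel \<sigma> 0)"
proof -
  note sf = paley_wienerD(3)[OF f]
  define \<epsilon> where "\<epsilon> = (\<lambda>n. 1 / real (Suc n))"
  have \<epsilon>: "\<epsilon> n > 0" "\<epsilon> n \<le> 1" for n by (auto simp: \<epsilon>_def)
  have lim: "\<epsilon> \<longlonglongrightarrow> 0" unfolding \<epsilon>_def by (rule LIMSEQ_Suc[OF lim_const_over_n])
  define k where "k = (\<lambda>n z. conv_kernel (\<epsilon> n) (\<sigma> + 3 * \<epsilon> n) z)"
  have eq: "f 0 = (LINT t|lborel. f (of_real t) * k n (of_real t))" for n
    unfolding k_def using paley_wiener_conv[OF f \<sigma> \<epsilon>(1)[of n], of 0] by simp
  define M where "M = max 1 (1 / \<sigma>)"
  define B where "B = (\<sigma> + 3) / pi * 6 * M"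
  have M: "M \<ge> 1" "M * \<sigma> \<ge> 1" using \<sigma> unfolding M_def by (auto simp: max_def field_simps)
  have B0: "B \<ge> 0" unfolding B_def using \<sigma> M by simp
  have kb: "cmod (k n (of_real t)) \<le> B / (1 + \<bar>t\<bar>)" for n and t :: real
  proof -
    define \<tau> where "\<tau> = \<sigma> + 3 * \<epsilon> n"
    have \<tau>: "\<tau> \<ge> \<sigma>" "\<tau> \<le> \<sigma> + 3" using \<epsilon>[of n] unfolding \<tau>_def by auto
    have 1: "cmod (csinc (of_real (\<epsilon> n) * of_real t)) \<le> 1"
      using cmod_csinc_real_le_1[of "\<epsilon> n * t"] by simp
    have 2: "cmod (csinc (of_real \<tau> * of_real t)) \<le> 6 * M / (1 + \<bar>t\<bar>)"
    proof -
      have "cmod (csinc (of_real \<tau> * of_real t)) \<le> 6 / (1 + \<tau> * \<bar>t\<bar>)"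
        using cmod_csinc_le[of "of_real \<tau> * of_real t"] \<tau> \<sigma> by (simp add: norm_mult)
      also have "\<dots> \<le> 6 * M / (1 + \<bar>t\<bar>)"
      proof -
        have "\<bar>t\<bar> \<le> M * \<sigma> * \<bar>t\<bar>" using mult_right_mono[OF M(2), of "\<bar>t\<bar>"] by simp
        also have "\<dots> \<le> M * \<tau> * \<bar>t\<bar>" using \<tau> M by (intro mult_right_mono mult_left_mono) auto
        finally have "1 + \<bar>t\<bar> \<le> M * (1 + \<tau> * \<bar>t\<bar>)" using M(1) by (simp add: algebra_simps)
        moreover have "1 + \<tau> * \<bar>t\<bar> > 0" using \<tau> \<sigma> by (simp add: add_pos_nonneg)
        moreover have "6 / A \<le> 6 * M / S" if "S \<le> M * A" "A > 0" "S > 0" for A S :: real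
          using that by (simp add: divide_le_eq pos_le_divide_eq mult_ac)
        ultimately show ?thesis by simp
      qed
      finally show ?thesis .
    qed
    have "cmod (k n (of_real t)) = \<tau> / pi * (cmod (csinc (of_real (\<epsilon> n) * of_real t)))\<^sup>2 * cmod (csinc (of_real \<tau> * of_real t))"
      unfolding k_def conv_kernel_def \<tau>_def[symmetric] norm_mult norm_power norm_of_real using \<tau> \<sigma> by simp
    also have "\<dots> \<le> (\<sigma> + 3) / pi * 1\<^sup>2 * (6 * M / (1 + \<bar>t\<bar>))"
      using 1 2 \<tau> \<sigma> by (intro mult_mono power_mono divide_right_mono) auto
    also have "\<dots> = B / (1 + \<bar>t\<bar>)" unfolding B_def by simp
    finally show ?thesis .
  qed
  define G where "G = (\<lambda>z. complex_of_real (B / (1 + \<bar>Re z\<bar>)))"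
  have G: "sqi G" unfolding G_def
  proof (rule sqi_if_decay[where B = B])
    show "cmod (complex_of_real (B / (1 + \<bar>Re (complex_of_real t)\<bar>))) \<le> B / (1 + \<bar>t\<bar>)" for t :: real
      unfolding norm_of_real using B0 by simp
  qed simp
  have kmeas: "(\<lambda>t::real. k n (of_real t)) \<in> borel_measurable borel" for n
    unfolding k_def by (intro borel_measurable_entire holomorphic_conv_kernel)
  have rmeas: "(\<lambda>t::real. rkernel \<sigma> 0 (of_real t)) \<in> borel_measurable borel"
    using sqiD(1)[OF sqi_rkernel[OF \<sigma>]] .
  have "(\<lambda>n. LINT t|lborel. f (of_real t) * k n (of_real t)) \<longlonglongrightarrow> (LINT t|lborel. f (of_real t) * rkernel \<sigma> 0 (of_real t))"
  proof (rule integral_dominated_convergence)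
    show "integrable lborel (\<lambda>t. cmod (f (of_real t)) * cmod (G (of_real t)))"
      by (rule sqi_integral_abs_mult(1)[OF sf G])
    show "(\<lambda>t. f (of_real t) * rkernel \<sigma> 0 (of_real t)) \<in> borel_measurable lborel"
      using sqiD(1)[OF sf] rmeas by simp
    show "(\<lambda>t. f (of_real t) * k n (of_real t)) \<in> borel_measurable lborel" for n
      using sqiD(1)[OF sf] kmeas by simp
    show "AE t in lborel. norm (f (of_real t) * k n (of_real t)) \<le> cmod (f (of_real t)) * cmod (G (of_real t))" for n
    proof (rule AE_I2)
      fix t :: real
      have "cmod (G (of_real t)) = B / (1 + \<bar>t\<bar>)" unfolding G_def norm_of_real using B0 by simp
      then show "norm (f (of_real t) * k n (of_real t)) \<le> cmod (f (of_real t)) * cmod (G (of_real t))"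
        using kb[of n t] unfolding norm_mult by (intro mult_left_mono) auto
    qed
    have cont: "isCont csinc z" for z
      using holomorphic_on_imp_continuous_on[OF holomorphic_csinc] by (simp add: continuous_on_eq_continuous_at)
    show "AE t in lborel. (\<lambda>n. f (of_real t) * k n (of_real t)) \<longlonglongrightarrow> f (of_real t) * rkernel \<sigma> 0 (of_real t)"
    proof (rule AE_I2)
      fix t :: real
      have "(\<lambda>n. csinc (of_real (\<epsilon> n) * of_real t)) \<longlonglongrightarrow> csinc (of_real 0 * of_real t)"
        by (rule isCont_tendsto_compose[OF cont]) (intro tendsto_intros lim)
      moreover have "(\<lambda>n. csinc (of_real (\<sigma> + 3 * \<epsilon> n) * of_real t)) \<longlonglongrightarrow> csinc (of_real (\<sigma> + 3 * 0) * of_real t)"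
        by (rule isCont_tendsto_compose[OF cont]) (intro tendsto_intros lim)
      ultimately have "(\<lambda>n. f (of_real t) * k n (of_real t)) \<longlonglongrightarrow>
          f (of_real t) * (of_real ((\<sigma> + 3 * 0) / pi) * (csinc (of_real 0 * of_real t))\<^sup>2 * csinc (of_real (\<sigma> + 3 * 0) * of_real t))"
        unfolding k_def conv_kernel_def by (intro tendsto_intros lim) auto
      then show "(\<lambda>n. f (of_real t) * k n (of_real t)) \<longlonglongrightarrow> f (of_real t) * rkernel \<sigma> 0 (of_real t)"
        by (simp add: rkernel_def)
    qed
  qed
  then have "(\<lambda>n. f 0) \<longlonglongrightarrow> (LINT t|lborel. f (of_real t) * rkernel \<sigma> 0 (of_real t))"
    unfolding eq[symmetric] .
  then have "f 0 = (LINT t|lborel. f (of_real t) * rkernel \<sigma> 0 (of_real t))"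
    by (simp add: LIMSEQ_const_iff)
  also have "\<dots> = pw_inner f (rkernel \<sigma> 0)"
    unfolding pw_inner_def by (simp add: rkernel_def)
  finally show ?thesis .
qed

text \<open>A complex shift moves w to the origin, and its adjoint moves the kernel back; so nonreal
  points need no contour argument of their own.\<close>

lemma reproducing:
  assumes f: "f \<in> paley_wiener \<sigma>" and \<sigma>: "\<sigma> > 0"
  shows "pw_inner f (rkernel \<sigma> w) = f w"
proof -
  have "f w = pw_inner (\<lambda>z. f (z + w)) (rkernel \<sigma> 0)"
    using reproducing_at_0[OF paley_wiener_translate[OF \<sigma> f, of w] \<sigma>] by simp
  also have "\<dots> = pw_inner f (\<lambda>z. rkernel \<sigma> 0 (z - cnj w))"
    by (rule pw_inner_translate[OF \<sigma> f rkernel_in_paley_wiener[OF \<sigma>]])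
  also have "(\<lambda>z. rkernel \<sigma> 0 (z - cnj w)) = rkernel \<sigma> w"
    by (simp add: rkernel_def fun_eq_iff)
  finally show ?thesis ..
qed

text \<open>The squared norm of the kernel at w is its own value at w. In contrast to
  \<open>paley_wiener_growth\<close> there is neither a polynomial factor nor a loss in the type;
  the uniqueness theorem is applied with this form of the bound.\<close>

lemma paley_wiener_pointwise_bound:
  assumes f: "f \<in> paley_wiener \<sigma>" and \<sigma>: "\<sigma> > 0"
  shows "cmod (f w) \<le> sqrt (6 * \<sigma> / pi) * exp (\<sigma> * \<bar>Im w\<bar>) * pw_norm f"
proof -
  have "complex_of_real ((pw_norm (rkernel \<sigma> w))\<^sup>2) = rkernel \<sigma> w w"
    using reproducing[OF rkernel_in_paley_wiener[OF \<sigma>] \<sigma>, of w w] by (simp add: pw_inner_self)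
  then have "(pw_norm (rkernel \<sigma> w))\<^sup>2 = cmod (rkernel \<sigma> w w)"
    by (metis abs_of_nonneg norm_of_real zero_le_power2)
  also have "\<dots> = \<sigma> / pi * cmod (csinc (of_real \<sigma> * (w - cnj w)))"
    unfolding rkernel_def norm_mult norm_of_real using \<sigma> by simp
  also have "\<dots> \<le> \<sigma> / pi * (6 * exp (2 * \<sigma> * \<bar>Im w\<bar>))"
  proof (intro mult_left_mono)
    let ?u = "of_real \<sigma> * (w - cnj w)"
    have "cmod (csinc ?u) \<le> 6 * exp \<bar>Im ?u\<bar> / (1 + cmod ?u)" by (rule cmod_csinc_le)
    also have "\<dots> \<le> 6 * exp \<bar>Im ?u\<bar> / 1" by (intro divide_left_mono) (auto simp: add_pos_nonneg)
    also have "\<bar>Im ?u\<bar> = 2 * \<sigma> * \<bar>Im w\<bar>" using \<sigma> by (simp add: abs_mult)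
    finally show "cmod (csinc ?u) \<le> 6 * exp (2 * \<sigma> * \<bar>Im w\<bar>)" by simp
  qed (use \<sigma> in auto)
  also have "\<dots> = (sqrt (6 * \<sigma> / pi) * exp (\<sigma> * \<bar>Im w\<bar>))\<^sup>2"
    using \<sigma> by (simp add: power_mult_distrib exp_double[symmetric] mult.assoc)
  finally have "pw_norm (rkernel \<sigma> w) \<le> sqrt (6 * \<sigma> / pi) * exp (\<sigma> * \<bar>Im w\<bar>)"
    by (rule power2_le_imp_le) (use \<sigma> in auto)
  then have "pw_norm f * pw_norm (rkernel \<sigma> w) \<le> pw_norm f * (sqrt (6 * \<sigma> / pi) * exp (\<sigma> * \<bar>Im w\<bar>))"
    by (intro mult_left_mono) auto
  moreover have "cmod (f w) \<le> pw_norm f * pw_norm (rkernel \<sigma> w)"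
    using pw_inner_cauchy_schwarz[OF paley_wienerD(3)[OF f] sqi_rkernel[OF \<sigma>], of w] reproducing[OF f \<sigma>] by simp
  ultimately show ?thesis by (simp add: mult_ac)
qed

section \<open>Completeness and orthogonal projections\<close>

lemma exponential_type_le_add:
  assumes "exponential_type_le \<sigma> f" "exponential_type_le \<sigma> g"
  shows "exponential_type_le \<sigma> (\<lambda>z. f z + g z)"
  unfolding exponential_type_le_def
proof (intro allI impI)
  fix \<epsilon> :: real assume \<epsilon>: "\<epsilon> > 0"
  obtain C D where C: "\<And>z. cmod (f z) \<le> C * exp ((\<sigma> + \<epsilon>) * cmod z)" and D: "\<And>z. cmod (g z) \<le> D * exp ((\<sigma> + \<epsilon>) * cmod z)"
    using assms \<epsilon> unfolding exponential_type_le_def by meson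
  have "cmod (f z + g z) \<le> (C + D) * exp ((\<sigma> + \<epsilon>) * cmod z)" for z
    using norm_triangle_le[OF add_mono[OF C[of z] D[of z]]] by (simp only: distrib_right[of C D])
  then show "\<exists>C. \<forall>z. cmod (f z + g z) \<le> C * exp ((\<sigma> + \<epsilon>) * cmod z)" by blast
qed

lemma exponential_type_le_scale:
  assumes "exponential_type_le \<sigma> f"
  shows "exponential_type_le \<sigma> (\<lambda>z. c * f z)"
  unfolding exponential_type_le_def
proof (intro allI impI)
  fix \<epsilon> :: real assume \<epsilon>: "\<epsilon> > 0"
  obtain C where C: "\<And>z. cmod (f z) \<le> C * exp ((\<sigma> + \<epsilon>) * cmod z)"
    using assms \<epsilon> unfolding exponential_type_le_def by meson
  have "cmod (c * f z) \<le> (cmod c * C) * exp ((\<sigma> + \<epsilon>) * cmod z)" for z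
    unfolding norm_mult mult.assoc using C[of z] by (intro mult_left_mono) auto
  then show "\<exists>C. \<forall>z. cmod (c * f z) \<le> C * exp ((\<sigma> + \<epsilon>) * cmod z)" by blast
qed

lemma paley_wiener_add:
  "f \<in> paley_wiener \<sigma> \<Longrightarrow> g \<in> paley_wiener \<sigma> \<Longrightarrow> (\<lambda>z. f z + g z) \<in> paley_wiener \<sigma>"
  by (rule paley_wienerI)
     (auto intro!: holomorphic_on_add sqi_add exponential_type_le_add dest: paley_wienerD)

lemma paley_wiener_scale: "f \<in> paley_wiener \<sigma> \<Longrightarrow> (\<lambda>z. c * f z) \<in> paley_wiener \<sigma>"
  by (rule paley_wienerI)
     (auto intro!: holomorphic_intros sqi_scale exponential_type_le_scale dest: paley_wienerD)

lemma paley_wiener_diff: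
  "f \<in> paley_wiener \<sigma> \<Longrightarrow> g \<in> paley_wiener \<sigma> \<Longrightarrow> (\<lambda>z. f z - g z) \<in> paley_wiener \<sigma>"
  using paley_wiener_add[of f \<sigma> "\<lambda>z. (-1) * g z"] paley_wiener_scale[of g \<sigma> "-1"] by simp

lemma paley_wiener_0: "(\<lambda>z. 0) \<in> paley_wiener \<sigma>"
  by (auto intro!: paley_wienerI exponential_type_leI[of _ 0] simp: sqi_def)

lemma paley_wiener_sum:
  "(\<And>i. i \<in> A \<Longrightarrow> f i \<in> paley_wiener \<sigma>) \<Longrightarrow> (\<lambda>z. \<Sum>i\<in>A. f i z) \<in> paley_wiener \<sigma>"
  by (induction A rule: infinite_finite_induct) (auto intro: paley_wiener_0 paley_wiener_add)

lemma paley_wiener_mono: "\<sigma> \<le> \<sigma>' \<Longrightarrow> f \<in> paley_wiener \<sigma> \<Longrightarrow> f \<in> paley_wiener \<sigma>'"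
proof (rule paley_wienerI)
  assume le: "\<sigma> \<le> \<sigma>'" and f: "f \<in> paley_wiener \<sigma>"
  show "exponential_type_le \<sigma>' f" unfolding exponential_type_le_def
  proof (intro allI impI)
    fix \<epsilon> :: real assume "\<epsilon> > 0"
    then have "\<sigma>' - \<sigma> + \<epsilon> > 0" using le by simp
    then obtain C where "\<forall>z. cmod (f z) \<le> C * exp ((\<sigma> + (\<sigma>' - \<sigma> + \<epsilon>)) * cmod z)"
      using paley_wienerD(2)[OF f] unfolding exponential_type_le_def by blast
    then have "\<forall>z. cmod (f z) \<le> C * exp ((\<sigma>' + \<epsilon>) * cmod z)" by simp
    then show "\<exists>C. \<forall>z. cmod (f z) \<le> C * exp ((\<sigma>' + \<epsilon>) * cmod z)" by blast
  qed
qed (rule paley_wienerD; assumption)+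

lemma paley_wiener_norm_eq_0:
  assumes "f \<in> paley_wiener \<sigma>" "\<sigma> > 0" "pw_norm f = 0"
  shows "f = (\<lambda>z. 0)"
  using paley_wiener_pointwise_bound[OF assms(1,2)] assms(3) by auto

lemma paley_wiener_tendsto_pointwise:
  assumes "\<And>n. f n \<in> paley_wiener \<sigma>" "g \<in> paley_wiener \<sigma>" "\<sigma> > 0"
    and lim: "(\<lambda>n. pw_norm (\<lambda>z. f n z - g z)) \<longlonglongrightarrow> 0"
  shows "(\<lambda>n. f n w) \<longlonglongrightarrow> g w"
proof -
  have "(\<lambda>n. f n w - g w) \<longlonglongrightarrow> 0"
  proof (rule Lim_null_comparison)
    show "\<forall>\<^sub>F n in sequentially. norm (f n w - g w) \<le>
        sqrt (6 * \<sigma> / pi) * exp (\<sigma> * \<bar>Im w\<bar>) * pw_norm (\<lambda>z. f n z - g z)"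
      by (intro always_eventually allI paley_wiener_pointwise_bound[OF paley_wiener_diff] assms)
    show "(\<lambda>n. sqrt (6 * \<sigma> / pi) * exp (\<sigma> * \<bar>Im w\<bar>) * pw_norm (\<lambda>z. f n z - g z)) \<longlonglongrightarrow> 0"
      using tendsto_mult_right_zero[OF lim] by simp
  qed
  then show ?thesis by (rule LIM_zero_cancel)
qed

lemma pw_inner_tendsto_left:
  assumes "\<And>n. sqi (f n)" "sqi g" "sqi h" and lim: "(\<lambda>n. pw_norm (\<lambda>z. f n z - g z)) \<longlonglongrightarrow> 0"
  shows "(\<lambda>n. pw_inner (f n) h) \<longlonglongrightarrow> pw_inner g h"
proof -
  have "(\<lambda>n. pw_inner (f n) h - pw_inner g h) \<longlonglongrightarrow> 0"
  proof (rule Lim_null_comparison)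
    show "\<forall>\<^sub>F n in sequentially. norm (pw_inner (f n) h - pw_inner g h) \<le> pw_norm (\<lambda>z. f n z - g z) * pw_norm h"
    proof (intro always_eventually allI)
      fix n
      show "norm (pw_inner (f n) h - pw_inner g h) \<le> pw_norm (\<lambda>z. f n z - g z) * pw_norm h"
        using pw_inner_cauchy_schwarz[OF sqi_diff[OF assms(1)[of n] assms(2)] assms(3)] assms
        by (simp add: pw_inner_diff_left)
    qed
    show "(\<lambda>n. pw_norm (\<lambda>z. f n z - g z) * pw_norm h) \<longlonglongrightarrow> 0"
      using tendsto_mult_left_zero[OF lim] by simp
  qed
  then show ?thesis by (rule LIM_zero_cancel)
qed

lemma pw_inner_tendsto_right:
  assumes "\<And>n. sqi (f n)" "sqi g" "sqi h" and lim: "(\<lambda>n. pw_norm (\<lambda>z. f n z - g z)) \<longlonglongrightarrow> 0"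
  shows "(\<lambda>n. pw_inner h (f n)) \<longlonglongrightarrow> pw_inner h g"
  using tendsto_cnj[OF pw_inner_tendsto_left[OF assms]] by (simp add: pw_inner_commute[of h])

text \<open>By the pointwise bound a Cauchy sequence in norm converges locally uniformly, so the
  limit is entire and its type is controlled. Convergence in norm follows by Fatou's lemma.\<close>

lemma paley_wiener_complete:
  assumes f: "\<And>n. f n \<in> paley_wiener \<sigma>" and \<sigma>: "\<sigma> > 0"
    and Cauchy: "\<And>e. e > 0 \<Longrightarrow> \<exists>N. \<forall>m\<ge>N. \<forall>n\<ge>N. pw_norm (\<lambda>z. f m z - f n z) \<le> e"
  obtains g where "g \<in> paley_wiener \<sigma>" "(\<lambda>n. pw_norm (\<lambda>z. f n z - g z)) \<longlonglongrightarrow> 0"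
proof -
  define K where "K = (\<lambda>z::complex. sqrt (6 * \<sigma> / pi) * exp (\<sigma> * \<bar>Im z\<bar>))"
  have K: "K z > 0" for z using \<sigma> by (simp add: K_def)
  have pt: "cmod (f m z - f n z) \<le> K z * pw_norm (\<lambda>z. f m z - f n z)" for m n z
    unfolding K_def using paley_wiener_pointwise_bound[OF paley_wiener_diff[OF f f] \<sigma>] by simp
  have "Cauchy (\<lambda>n. f n z)" for z
  proof (rule CauchyI)
    fix e :: real assume e: "e > 0"
    then obtain N where N: "\<And>m n. m \<ge> N \<Longrightarrow> n \<ge> N \<Longrightarrow> pw_norm (\<lambda>z. f m z - f n z) \<le> e / (2 * K z)"
      using Cauchy[of "e / (2 * K z)"] K[of z] by auto
    have "norm (f m z - f n z) < e" if "m \<ge> N" "n \<ge> N" for m n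
    proof -
      have "norm (f m z - f n z) \<le> K z * (e / (2 * K z))"
        using pt[of m z n] mult_left_mono[OF N[OF that], of "K z"] K[of z] by linarith
      also have "\<dots> = e / 2" using K[of z] by simp
      finally show ?thesis using e by simp
    qed
    then show "\<exists>M. \<forall>m\<ge>M. \<forall>n\<ge>M. norm (f m z - f n z) < e" by blast
  qed
  then have "\<exists>l. (\<lambda>n. f n z) \<longlonglongrightarrow> l" for z
    using Cauchy_convergent unfolding convergent_def by blast
  then obtain g where g: "\<And>z. (\<lambda>n. f n z) \<longlonglongrightarrow> g z" by metis
  have lim_le: "cmod (f n z - g z) \<le> K z * e"
    if N: "\<And>m n. m \<ge> N \<Longrightarrow> n \<ge> N \<Longrightarrow> pw_norm (\<lambda>z. f m z - f n z) \<le> e" and n: "n \<ge> N" for e N n z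
  proof (rule Lim_bounded)
    show "(\<lambda>m. cmod (f n z - f m z)) \<longlonglongrightarrow> cmod (f n z - g z)" by (intro tendsto_intros g)
    show "\<forall>m\<ge>N. cmod (f n z - f m z) \<le> K z * e"
    proof (intro allI impI)
      fix m assume "m \<ge> N"
      show "cmod (f n z - f m z) \<le> K z * e"
        using pt[of n z m] mult_left_mono[OF N[OF n \<open>m \<ge> N\<close>], of "K z"] K[of z] by linarith
    qed
  qed
  have holg: "g holomorphic_on UNIV"
  proof (rule holomorphic_uniform_sequence)
    show "f n holomorphic_on UNIV" for n using paley_wienerD(1)[OF f] .
    fix x :: complex
    have "uniform_limit (cball x 1) f g sequentially"
    proof (rule uniform_limitI)
      fix e :: real assume e: "e > 0"
      define M where "M = sqrt (6 * \<sigma> / pi) * exp (\<sigma> * (\<bar>Im x\<bar> + 1))"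
      have M: "M > 0" using \<sigma> by (simp add: M_def)
      obtain N where N: "\<And>m n. m \<ge> N \<Longrightarrow> n \<ge> N \<Longrightarrow> pw_norm (\<lambda>z. f m z - f n z) \<le> e / (2 * M)"
        using Cauchy[of "e / (2 * M)"] M e by auto
      show "\<forall>\<^sub>F n in sequentially. \<forall>z\<in>cball x 1. dist (f n z) (g z) < e"
        using eventually_ge_at_top[of N]
      proof eventually_elim
        case (elim n)
        show ?case
        proof
          fix z assume z: "z \<in> cball x 1"
          have "\<bar>Im z\<bar> \<le> \<bar>Im x\<bar> + 1"
            using z abs_Im_le_cmod[of "x - z"] by (simp add: dist_norm)
          then have "K z \<le> M" unfolding K_def M_def using \<sigma> by (intro mult_left_mono) auto
          then have "K z * (e / (2 * M)) \<le> M * (e / (2 * M))" using e M by (intro mult_right_mono) auto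
          also have "\<dots> = e / 2" using M by simp
          finally have "K z * (e / (2 * M)) \<le> e / 2" .
          moreover have "cmod (f n z - g z) \<le> K z * (e / (2 * M))"
            by (rule lim_le[OF _ elim]) (rule N)
          ultimately show "dist (f n z) (g z) < e" using e by (simp add: dist_norm)
        qed
      qed
    qed
    then show "\<exists>d>0. cball x d \<subseteq> UNIV \<and> uniform_limit (cball x d) f g sequentially"
      by (intro exI[of _ 1]) auto
  qed auto
  have type: "exponential_type_le \<sigma> g"
  proof -
    obtain N where N: "\<And>m n. m \<ge> N \<Longrightarrow> n \<ge> N \<Longrightarrow> pw_norm (\<lambda>z. f m z - f n z) \<le> 1"
      using Cauchy[of 1] by auto
    show ?thesis
    proof (rule exponential_type_leI)
      fix z
      have fg: "cmod (f N z - g z) \<le> K z * 1" by (rule lim_le[OF _ order_refl]) (rule N)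
      have "cmod (g z) \<le> cmod (f N z) + cmod (f N z - g z)"
        using norm_triangle_ineq4[of "f N z" "f N z - g z"] by simp
      also have "\<dots> \<le> K z * pw_norm (f N) + K z * 1"
        using paley_wiener_pointwise_bound[OF f \<sigma>, of N z] fg unfolding K_def by (rule add_mono)
      also have "\<dots> = (sqrt (6 * \<sigma> / pi) * (pw_norm (f N) + 1)) * exp (\<sigma> * \<bar>Im z\<bar>)"
        unfolding K_def by (simp add: algebra_simps)
      also have "\<dots> \<le> (sqrt (6 * \<sigma> / pi) * (pw_norm (f N) + 1)) * exp (\<sigma> * cmod z)"
        using \<sigma> abs_Im_le_cmod[of z] by (intro mult_left_mono) auto
      finally show "cmod (g z) \<le> (sqrt (6 * \<sigma> / pi) * (pw_norm (f N) + 1)) * exp (\<sigma> * cmod z)" .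
    qed
  qed
  have meas: "(\<lambda>t::real. f n (of_real t) - h (of_real t)) \<in> borel_measurable borel"
    if "h holomorphic_on UNIV" for n h
    by (intro borel_measurable_diff borel_measurable_entire that paley_wienerD(1)[OF f])
  \<comment> \<open>The index m tends to infinity in the Cauchy condition; the lower semicontinuity
    gives square integrability of the difference together with the bound.\<close>
  have fatou: "sqi (\<lambda>z. f n z - g z) \<and> pw_norm (\<lambda>z. f n z - g z) \<le> e"
    if N: "\<And>m n. m \<ge> N \<Longrightarrow> n \<ge> N \<Longrightarrow> pw_norm (\<lambda>z. f m z - f n z) \<le> e" and n: "n \<ge> N" and e: "e > 0" for e N n
  proof -
    let ?u = "\<lambda>m t. ennreal ((cmod (f n (complex_of_real t) - f m (complex_of_real t)))\<^sup>2)"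
    let ?v = "\<lambda>t. ennreal ((cmod (f n (complex_of_real t) - g (complex_of_real t)))\<^sup>2)"
    have lim: "liminf (\<lambda>m. ?u m t) = ?v t" for t
      by (rule lim_imp_Liminf) (auto intro!: tendsto_intros g)
    have "(\<integral>\<^sup>+t. ?v t \<partial>lborel) = (\<integral>\<^sup>+t. liminf (\<lambda>m. ?u m t) \<partial>lborel)" by (simp only: lim)
    also have "\<dots> \<le> liminf (\<lambda>m. \<integral>\<^sup>+t. ?u m t \<partial>lborel)"
      using meas[OF paley_wienerD(1)[OF f]] by (intro nn_integral_liminf) auto
    also have "\<dots> \<le> limsup (\<lambda>m. \<integral>\<^sup>+t. ?u m t \<partial>lborel)"
      by (rule Liminf_le_Limsup) simp
    also have "\<dots> \<le> ennreal (e\<^sup>2)"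
    proof (rule Limsup_bounded)
      show "\<forall>\<^sub>F m in sequentially. (\<integral>\<^sup>+t. ?u m t \<partial>lborel) \<le> ennreal (e\<^sup>2)"
        using eventually_ge_at_top[of N]
      proof eventually_elim
        case (elim m)
        have "(\<integral>\<^sup>+t. ?u m t \<partial>lborel) = ennreal ((pw_norm (\<lambda>z. f n z - f m z))\<^sup>2)"
          unfolding pw_norm_sq
          using sqiD(2)[OF sqi_diff[OF paley_wienerD(3)[OF f[of n]] paley_wienerD(3)[OF f[of m]]]]
          by (intro nn_integral_eq_integral) auto
        also have "\<dots> \<le> ennreal (e\<^sup>2)"
          using N[OF n elim] by (intro ennreal_leI power_mono) auto
        finally show ?case .
      qed
    qed
    finally have le: "(\<integral>\<^sup>+t. ?v t \<partial>lborel) \<le> ennreal (e\<^sup>2)" .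
    have int: "integrable lborel (\<lambda>t::real. (cmod (f n (of_real t) - g (of_real t)))\<^sup>2)"
      unfolding integrable_iff_bounded using meas[OF holg] le by (auto simp: less_top[symmetric] top_unique)
    then have sqi: "sqi (\<lambda>z. f n z - g z)" unfolding sqi_def using meas[OF holg] by auto
    have "ennreal ((pw_norm (\<lambda>z. f n z - g z))\<^sup>2) = (\<integral>\<^sup>+t. ?v t \<partial>lborel)"
      unfolding pw_norm_sq using int by (intro nn_integral_eq_integral[symmetric]) auto
    then have "ennreal ((pw_norm (\<lambda>z. f n z - g z))\<^sup>2) \<le> ennreal (e\<^sup>2)" using le by (simp only:)
    then have "(pw_norm (\<lambda>z. f n z - g z))\<^sup>2 \<le> e\<^sup>2" by (subst (asm) ennreal_le_iff) auto
    then have "pw_norm (\<lambda>z. f n z - g z) \<le> e"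
      by (rule power2_le_imp_le) (use e in auto)
    then show ?thesis using sqi by blast
  qed
  obtain N where "\<And>m n. m \<ge> N \<Longrightarrow> n \<ge> N \<Longrightarrow> pw_norm (\<lambda>z. f m z - f n z) \<le> 1"
    using Cauchy[of 1] by auto
  then have "sqi (\<lambda>z. f N z - g z)" using fatou[of N 1 N] by auto
  from sqi_diff[OF paley_wienerD(3)[OF f[of N]] this] have "sqi g" by simp
  then have "g \<in> paley_wiener \<sigma>" using holg type by (intro paley_wienerI)
  moreover have "(\<lambda>n. pw_norm (\<lambda>z. f n z - g z)) \<longlonglongrightarrow> 0"
  proof (rule LIMSEQ_I)
    fix r :: real assume r: "r > 0"
    then obtain N where N: "\<And>m n. m \<ge> N \<Longrightarrow> n \<ge> N \<Longrightarrow> pw_norm (\<lambda>z. f m z - f n z) \<le> r / 2"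
      using Cauchy[of "r / 2"] by auto
    have "pw_norm (\<lambda>z. f n z - g z) < r" if "n \<ge> N" for n
    proof -
      have "pw_norm (\<lambda>z. f n z - g z) \<le> r / 2" using fatou[of N "r / 2" n] N that r by auto
      then show ?thesis using r by simp
    qed
    then show "\<exists>no. \<forall>n\<ge>no. norm (pw_norm (\<lambda>z. f n z - g z) - 0) < r" by auto
  qed
  ultimately show ?thesis by (rule that)
qed

lemma pw_norm_diff_sq:
  assumes "sqi f" "sqi g"
  shows "(pw_norm (\<lambda>z. f z - g z))\<^sup>2 = (pw_norm f)\<^sup>2 - 2 * Re (pw_inner f g) + (pw_norm g)\<^sup>2"
proof -
  have "pw_norm (\<lambda>z. (-1) * g z) = pw_norm g" unfolding pw_norm_scale by simp
  moreover have "pw_inner f (\<lambda>z. (-1) * g z) = - pw_inner f g" unfolding pw_inner_scale_right by simp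
  moreover have "(\<lambda>z. f z + (-1) * g z) = (\<lambda>z. f z - g z)" by simp
  ultimately show ?thesis
    using pw_norm_add_sq[OF assms(1) sqi_scale[OF assms(2), of "-1"]] by simp
qed

text \<open>Perturb along x with coefficient s q, q the inner product of u and x: the decrease of
  first order is 2 s \<bar>q\<bar>^2, and s is so small that the term of second order cannot make up
  for it. The summand 1 in s avoids division by a vanishing norm.\<close>

lemma orthogonal_if_minimal:
  assumes u: "sqi u" and x: "sqi x"
    and min: "\<And>c. pw_norm u \<le> pw_norm (\<lambda>z. u z - c * x z)"
  shows "pw_inner u x = 0"
proof (rule ccontr)
  define q where "q = pw_inner u x"
  assume "pw_inner u x \<noteq> 0"
  then have q: "(cmod q)\<^sup>2 > 0" by (simp add: q_def)
  define s where "s = 1 / ((pw_norm x)\<^sup>2 + 1)"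
  have X: "(pw_norm x)\<^sup>2 \<ge> 0" by simp
  have s: "s > 0" unfolding s_def using X by (simp add: add_nonneg_pos)
  have sx: "s * (pw_norm x)\<^sup>2 < 1" unfolding s_def using X by (simp add: add_nonneg_pos divide_less_eq)
  let ?c = "of_real s * q"
  have "(pw_norm u)\<^sup>2 \<le> (pw_norm (\<lambda>z. u z - ?c * x z))\<^sup>2"
    using min[of ?c] by (intro power_mono) auto
  also have "\<dots> = (pw_norm u)\<^sup>2 - 2 * Re (cnj ?c * q) + (cmod ?c * pw_norm x)\<^sup>2"
    unfolding pw_norm_diff_sq[OF u sqi_scale[OF x]] pw_inner_scale_right pw_norm_scale q_def ..
  also have "Re (cnj ?c * q) = s * (cmod q)\<^sup>2"
  proof -
    have "q * cnj q = of_real ((cmod q)\<^sup>2)" by (rule complex_norm_square[symmetric])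
    then have "cnj ?c * q = of_real (s * (cmod q)\<^sup>2)" by (simp add: mult_ac)
    then show ?thesis by (simp only: Re_complex_of_real)
  qed
  also have "(cmod ?c * pw_norm x)\<^sup>2 = s * (cmod q)\<^sup>2 * (s * (pw_norm x)\<^sup>2)"
    using s by (simp add: norm_mult power2_eq_square)
  finally have "2 * (s * (cmod q)\<^sup>2) \<le> s * (cmod q)\<^sup>2 * (s * (pw_norm x)\<^sup>2)" by linarith
  also have "\<dots> \<le> s * (cmod q)\<^sup>2 * 1" using s q sx by (intro mult_left_mono) auto
  finally show False using mult_pos_pos[OF s q] by linarith
qed

text \<open>S need not be closed, so p is described as a limit of elements of S, as fits spans of
  orbits. A minimising sequence is Cauchy by the parallelogram identity, the midpoint of two of its
  members being no closer to g than the infimum.\<close>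

lemma paley_wiener_projection:
  assumes S: "S \<subseteq> paley_wiener \<sigma>" "S \<noteq> {}" and \<sigma>: "\<sigma> > 0"
    and add: "\<And>x y. x \<in> S \<Longrightarrow> y \<in> S \<Longrightarrow> (\<lambda>z. x z + y z) \<in> S"
    and scale: "\<And>c x. x \<in> S \<Longrightarrow> (\<lambda>z. c * x z) \<in> S"
    and g: "g \<in> paley_wiener \<sigma>"
  obtains p s where "p \<in> paley_wiener \<sigma>" "\<And>n. s n \<in> S" "(\<lambda>n. pw_norm (\<lambda>z. s n z - p z)) \<longlonglongrightarrow> 0"
    "\<And>x. x \<in> S \<Longrightarrow> pw_inner (\<lambda>z. g z - p z) x = 0"
proof -
  define D where "D = (\<lambda>x. pw_norm (\<lambda>z. g z - x z)) ` S"
  define d where "d = Inf D"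
  have bdd: "bdd_below D" unfolding D_def by (rule bdd_belowI2[of _ 0]) simp
  have Dne: "D \<noteq> {}" using S by (auto simp: D_def)
  have dle: "d \<le> pw_norm (\<lambda>z. g z - x z)" if "x \<in> S" for x
    unfolding d_def by (rule cInf_lower[OF _ bdd]) (use that in \<open>auto simp: D_def\<close>)
  have d0: "d \<ge> 0" unfolding d_def by (rule cInf_greatest[OF Dne]) (auto simp: D_def)
  have "\<exists>x\<in>S. pw_norm (\<lambda>z. g z - x z) < d + 1 / real (Suc n)" for n
  proof -
    have "Inf D < d + 1 / real (Suc n)" unfolding d_def by simp
    then show ?thesis using cInf_less_iff[OF Dne bdd] by (auto simp: D_def)
  qed
  then obtain s where s: "\<And>n. s n \<in> S" "\<And>n. pw_norm (\<lambda>z. g z - s n z) < d + 1 / real (Suc n)" by metis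
  have sp: "s n \<in> paley_wiener \<sigma>" for n using s S by blast
  note sg = paley_wienerD(3)[OF g] and ss = paley_wienerD(3)[OF sp]
  have par: "(pw_norm (\<lambda>z. s m z - s n z))\<^sup>2 \<le> 2 * (pw_norm (\<lambda>z. g z - s m z))\<^sup>2 + 2 * (pw_norm (\<lambda>z. g z - s n z))\<^sup>2 - 4 * d\<^sup>2" for m n
  proof -
    let ?a = "\<lambda>z. g z - s m z" and ?b = "\<lambda>z. g z - s n z"
    let ?h = "\<lambda>z. (1 / 2) * (s m z + s n z)"
    have ab: "sqi ?a" "sqi ?b" using sg ss by (auto intro: sqi_diff)
    have "?h \<in> S" by (intro scale add s)
    then have "d\<^sup>2 \<le> (pw_norm (\<lambda>z. g z - ?h z))\<^sup>2" using dle[of ?h] d0 by (intro power_mono) auto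
    also have "(\<lambda>z. g z - ?h z) = (\<lambda>z. (1 / 2) * (?a z + ?b z))" by (simp add: fun_eq_iff field_simps)
    also have "(pw_norm (\<lambda>z. (1 / 2) * (?a z + ?b z)))\<^sup>2 = (pw_norm (\<lambda>z. ?a z + ?b z))\<^sup>2 / 4"
      unfolding pw_norm_scale power_mult_distrib by (simp add: power2_eq_square)
    finally have "4 * d\<^sup>2 \<le> (pw_norm (\<lambda>z. ?a z + ?b z))\<^sup>2" by simp
    moreover have "(pw_norm (\<lambda>z. ?b z - ?a z))\<^sup>2 + (pw_norm (\<lambda>z. ?a z + ?b z))\<^sup>2 = 2 * (pw_norm ?a)\<^sup>2 + 2 * (pw_norm ?b)\<^sup>2"
      unfolding pw_norm_diff_commute[of ?b ?a] pw_norm_diff_sq[OF ab] pw_norm_add_sq[OF ab] by simp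
    moreover have "(\<lambda>z. ?b z - ?a z) = (\<lambda>z. s m z - s n z)" by simp
    ultimately show ?thesis by simp
  qed
  have lims: "(\<lambda>n. d + 1 / real (Suc n)) \<longlonglongrightarrow> d + 0"
    by (intro tendsto_intros LIMSEQ_Suc[OF lim_const_over_n])
  have cau: "\<exists>N. \<forall>m\<ge>N. \<forall>n\<ge>N. pw_norm (\<lambda>z. s m z - s n z) \<le> e" if e: "e > 0" for e
  proof -
    have "(\<lambda>n. (d + 1 / real (Suc n))\<^sup>2) \<longlonglongrightarrow> (d + 0)\<^sup>2" by (intro tendsto_power lims)
    then have "\<forall>\<^sub>F n in sequentially. (d + 1 / real (Suc n))\<^sup>2 < d\<^sup>2 + e\<^sup>2 / 4"
      using e by (intro order_tendstoD(2)) auto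
    then obtain N where N: "\<And>n. n \<ge> N \<Longrightarrow> (d + 1 / real (Suc n))\<^sup>2 < d\<^sup>2 + e\<^sup>2 / 4"
      unfolding eventually_sequentially by blast
    have a: "(pw_norm (\<lambda>z. g z - s n z))\<^sup>2 \<le> d\<^sup>2 + e\<^sup>2 / 4" if "n \<ge> N" for n
    proof -
      have "(pw_norm (\<lambda>z. g z - s n z))\<^sup>2 \<le> (d + 1 / real (Suc n))\<^sup>2"
        using s(2)[of n] by (intro power_mono) auto
      then show ?thesis using N[OF that] by linarith
    qed
    have "pw_norm (\<lambda>z. s m z - s n z) \<le> e" if "m \<ge> N" "n \<ge> N" for m n
    proof (rule power2_le_imp_le)
      show "(pw_norm (\<lambda>z. s m z - s n z))\<^sup>2 \<le> e\<^sup>2"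
        using par[of m n] a[OF that(1)] a[OF that(2)] by linarith
    qed (use e in auto)
    then show ?thesis by blast
  qed
  obtain p where p: "p \<in> paley_wiener \<sigma>" and lim: "(\<lambda>n. pw_norm (\<lambda>z. s n z - p z)) \<longlonglongrightarrow> 0"
    by (rule paley_wiener_complete[OF sp \<sigma>]) (erule cau, rule that)
  note sqp = paley_wienerD(3)[OF p]
  have gp: "pw_norm (\<lambda>z. g z - p z) \<le> d"
  proof (rule LIMSEQ_le_const)
    show "(\<lambda>n. (d + 1 / real (Suc n)) + pw_norm (\<lambda>z. s n z - p z)) \<longlonglongrightarrow> d"
      using tendsto_add[OF lims lim] by simp
    have "pw_norm (\<lambda>z. g z - p z) \<le> (d + 1 / real (Suc n)) + pw_norm (\<lambda>z. s n z - p z)" for n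
      using pw_norm_triangle_diff[OF sg ss[of n] sqp] s(2)[of n] by linarith
    then show "\<exists>N. \<forall>n\<ge>N. pw_norm (\<lambda>z. g z - p z) \<le> (d + 1 / real (Suc n)) + pw_norm (\<lambda>z. s n z - p z)" by blast
  qed
  have "pw_inner (\<lambda>z. g z - p z) x = 0" if x: "x \<in> S" for x
  proof (rule orthogonal_if_minimal)
    show sgp: "sqi (\<lambda>z. g z - p z)" using sg sqp by (rule sqi_diff)
    show sx: "sqi x" using x S paley_wienerD(3) by blast
    fix c
    have "d \<le> pw_norm (\<lambda>z. (g z - p z) - c * x z)"
    proof (rule LIMSEQ_le_const)
      show "(\<lambda>n. pw_norm (\<lambda>z. (g z - p z) - c * x z) + pw_norm (\<lambda>z. s n z - p z)) \<longlonglongrightarrow> pw_norm (\<lambda>z. (g z - p z) - c * x z)"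
        using tendsto_add[OF tendsto_const lim] by simp
      have "d \<le> pw_norm (\<lambda>z. (g z - p z) - c * x z) + pw_norm (\<lambda>z. s n z - p z)" for n
      proof -
        have "(\<lambda>z. s n z + c * x z) \<in> S" by (intro add scale s x)
        then have "d \<le> pw_norm (\<lambda>z. g z - (s n z + c * x z))" by (rule dle)
        also have "(\<lambda>z. g z - (s n z + c * x z)) = (\<lambda>z. ((g z - p z) - c * x z) - (s n z - p z))" by (simp add: fun_eq_iff)
        also have "pw_norm \<dots> \<le> pw_norm (\<lambda>z. (g z - p z) - c * x z) + pw_norm (\<lambda>z. (-1) * (s n z - p z))"
          using pw_norm_triangle[OF sqi_diff[OF sgp sqi_scale[OF sx, of c]] sqi_scale[OF sqi_diff[OF ss[of n] sqp], of "-1"]] by simp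
        also have "pw_norm (\<lambda>z. (-1) * (s n z - p z)) = pw_norm (\<lambda>z. s n z - p z)"
          unfolding pw_norm_scale by simp
        finally show ?thesis .
      qed
      then show "\<exists>N. \<forall>n\<ge>N. d \<le> pw_norm (\<lambda>z. (g z - p z) - c * x z) + pw_norm (\<lambda>z. s n z - p z)" by blast
    qed
    then show "pw_norm (\<lambda>z. g z - p z) \<le> pw_norm (\<lambda>z. g z - p z - c * x z)" using gp by linarith
  qed
  then show ?thesis by (rule that[OF p s(1) lim])
qed

section \<open>Criteria for density, cyclicity and adjoints\<close>

lemma pw_dense_if_orthogonal_trivial:
  assumes S: "S \<subseteq> paley_wiener \<sigma>" "S \<noteq> {}" and \<sigma>: "\<sigma> > 0"
    and add: "\<And>x y. x \<in> S \<Longrightarrow> y \<in> S \<Longrightarrow> (\<lambda>z. x z + y z) \<in> S"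
    and scale: "\<And>c x. x \<in> S \<Longrightarrow> (\<lambda>z. c * x z) \<in> S"
    and orth: "\<And>h. h \<in> paley_wiener \<sigma> \<Longrightarrow> (\<And>x. x \<in> S \<Longrightarrow> pw_inner h x = 0) \<Longrightarrow> h = (\<lambda>z. 0)"
  shows "pw_dense \<sigma> S"
  unfolding pw_dense_def
proof (intro ballI allI impI)
  fix g \<epsilon> assume g: "g \<in> paley_wiener \<sigma>" and \<epsilon>: "\<epsilon> > (0::real)"
  obtain p s where p: "p \<in> paley_wiener \<sigma>" "\<And>n. s n \<in> S" "(\<lambda>n. pw_norm (\<lambda>z. s n z - p z)) \<longlonglongrightarrow> 0"
    "\<And>x. x \<in> S \<Longrightarrow> pw_inner (\<lambda>z. g z - p z) x = 0"
    by (rule paley_wiener_projection[OF S \<sigma> add scale g]) (assumption | rule that)+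
  have "(\<lambda>z. g z - p z) = (\<lambda>z. 0)"
    by (rule orth[OF paley_wiener_diff[OF g p(1)] p(4)])
  then have "p = g" by (simp add: fun_eq_iff)
  have "\<forall>\<^sub>F n in sequentially. pw_norm (\<lambda>z. s n z - p z) < \<epsilon>"
    by (rule order_tendstoD(2)[OF p(3) \<epsilon>])
  then obtain n where "pw_norm (\<lambda>z. s n z - p z) < \<epsilon>"
    unfolding eventually_sequentially by blast
  then have "pw_norm (g - s n) < \<epsilon>"
    unfolding \<open>p = g\<close> fun_diff_def using pw_norm_diff_commute[of "s n" g] by simp
  then show "\<exists>h\<in>S \<inter> paley_wiener \<sigma>. pw_norm (g - h) < \<epsilon>" using p(2)[of n] S by blast
qed

lemma paley_wiener_subspace: "cfun.subspace (paley_wiener \<sigma>)"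
  using paley_wiener_0[of \<sigma>] paley_wiener_add[of _ \<sigma>] paley_wiener_scale[of _ \<sigma>]
  unfolding cfun.subspace_def zero_fun_def plus_fun_def by blast

lemma pw_cyclicI:
  assumes \<sigma>: "\<sigma> > 0" and T: "\<And>n. (T ^^ n) f \<in> paley_wiener \<sigma>"
    and orth: "\<And>h. h \<in> paley_wiener \<sigma> \<Longrightarrow> (\<And>n. pw_inner h ((T ^^ n) f) = 0) \<Longrightarrow> h = (\<lambda>z. 0)"
  shows "pw_cyclic \<sigma> T"
  unfolding pw_cyclic_def
proof (intro bexI)
  let ?S = "cfun.span (range (\<lambda>n. (T ^^ n) f))"
  have gen: "(T ^^ n) f \<in> ?S" for n by (rule cfun.span_base) blast
  show "pw_dense \<sigma> ?S"
  proof (rule pw_dense_if_orthogonal_trivial[OF _ _ \<sigma>])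
    show "?S \<subseteq> paley_wiener \<sigma>"
      using T by (intro cfun.span_minimal paley_wiener_subspace) auto
    show "?S \<noteq> {}" using gen by blast
    show "(\<lambda>z. x z + y z) \<in> ?S" if "x \<in> ?S" "y \<in> ?S" for x y
      using cfun.span_add[OF that] by (simp add: plus_fun_def)
    show "(\<lambda>z. c * x z) \<in> ?S" if "x \<in> ?S" for c x
      using cfun.span_scale[OF that] by simp
    show "h = (\<lambda>z. 0)" if "h \<in> paley_wiener \<sigma>" "\<And>x. x \<in> ?S \<Longrightarrow> pw_inner h x = 0" for h
      using orth[OF that(1)] that(2) gen by blast
  qed
  show "f \<in> paley_wiener \<sigma>" using T[of 0] by simp
qed

lemma pw_denseD:
  assumes "pw_dense \<sigma> D" "g \<in> paley_wiener \<sigma>"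
  obtains s where "\<And>n. s n \<in> D" "\<And>n. s n \<in> paley_wiener \<sigma>" "(\<lambda>n. pw_norm (\<lambda>z. s n z - g z)) \<longlonglongrightarrow> 0"
proof -
  have "\<exists>h\<in>D \<inter> paley_wiener \<sigma>. pw_norm (g - h) < 1 / real (Suc n)" for n
    using assms unfolding pw_dense_def by simp
  then obtain s where s: "\<And>n. s n \<in> D \<inter> paley_wiener \<sigma>" "\<And>n. pw_norm (g - s n) < 1 / real (Suc n)"
    by metis
  have "(\<lambda>n. pw_norm (\<lambda>z. s n z - g z)) \<longlonglongrightarrow> 0"
  proof (rule Lim_null_comparison)
    show "(\<lambda>n. 1 / real (Suc n)) \<longlonglongrightarrow> 0" by (rule LIMSEQ_Suc[OF lim_const_over_n])
    have "norm (pw_norm (\<lambda>z. s n z - g z)) \<le> 1 / real (Suc n)" for n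
      using s(2)[of n] pw_norm_diff_commute[of "s n" g] by (simp add: fun_diff_def)
    then show "\<forall>\<^sub>F n in sequentially. norm (pw_norm (\<lambda>z. s n z - g z)) \<le> 1 / real (Suc n)"
      by (intro always_eventually allI)
  qed
  then show ?thesis using s(1) by (intro that[of s]) auto
qed

lemma pw_adjoint_eqI:
  assumes \<sigma>: "\<sigma> > 0" and h: "h \<in> paley_wiener \<sigma>"
    and adj: "\<And>f. f \<in> paley_wiener \<sigma> \<Longrightarrow> pw_inner (T f) g = pw_inner f h"
  shows "pw_adjoint \<sigma> T g = h"
  unfolding pw_adjoint_def
proof (rule the_equality)
  show "h \<in> paley_wiener \<sigma> \<and> (\<forall>f\<in>paley_wiener \<sigma>. pw_inner (T f) g = pw_inner f h)"
    using h adj by blast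
next
  fix k assume k: "k \<in> paley_wiener \<sigma> \<and> (\<forall>f\<in>paley_wiener \<sigma>. pw_inner (T f) g = pw_inner f k)"
  let ?d = "\<lambda>z. k z - h z"
  have d: "?d \<in> paley_wiener \<sigma>" using k h by (intro paley_wiener_diff) auto
  have "pw_inner ?d ?d = pw_inner ?d k - pw_inner ?d h"
    using paley_wienerD(3)[OF d] paley_wienerD(3)[OF h] k paley_wienerD(3)[of k \<sigma>] by (intro pw_inner_diff_right) auto
  also have "\<dots> = 0" using k adj[OF d] d by auto
  finally have "pw_norm ?d = 0" by (simp add: pw_inner_self)
  then have "?d = (\<lambda>z. 0)" by (rule paley_wiener_norm_eq_0[OF d \<sigma>])
  then show "k = h" by (simp add: fun_eq_iff)
qed

section \<open>A uniqueness theorem of Carlson type\<close>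

text \<open>The singularities are filled with the value that l'Hopital's rule prescribes. Near a
  zero z0 numerator and denominator are both divided by z - z0, and the new denominator no longer
  vanishes at z0 because the zero is simple.\<close>

lemma holomorphic_quotient_simple_zeros:
  assumes K: "K holomorphic_on UNIV" and C: "C holomorphic_on UNIV" and U: "open U"
    and zero: "\<And>z. z \<in> U \<Longrightarrow> C z = 0 \<Longrightarrow> K z = 0 \<and> deriv C z \<noteq> 0"
  shows "(\<lambda>z. if C z = 0 then deriv K z / deriv C z else K z / C z) holomorphic_on U" (is "?g holomorphic_on U")
proof -
  have contC: "continuous_on UNIV C" by (rule holomorphic_on_imp_continuous_on[OF C])
  have loc: "\<exists>V. open V \<and> z0 \<in> V \<and> ?g holomorphic_on V" if z0: "z0 \<in> U" for z0
  proof (cases "C z0 = 0")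
    case False
    let ?V = "{z. C z \<noteq> 0}"
    have "open ?V" using contC by (rule open_Collect_neq[OF _ continuous_on_const])
    moreover have "(\<lambda>z. K z / C z) holomorphic_on ?V"
      using K C by (intro holomorphic_intros) (auto intro: holomorphic_on_subset)
    then have "?g holomorphic_on ?V" by (rule holomorphic_transform) auto
    ultimately show ?thesis using False by blast
  next
    case True
    define K1 where "K1 = (\<lambda>z. if z = z0 then deriv K z0 else (K z - K z0) / (z - z0))"
    define C1 where "C1 = (\<lambda>z. if z = z0 then deriv C z0 else (C z - C z0) / (z - z0))"
    have K1: "K1 holomorphic_on UNIV" and C1: "C1 holomorphic_on UNIV"
      unfolding K1_def C1_def using K C by (auto intro: pole_lemma)
    let ?V = "{z. C1 z \<noteq> 0}"
    have "open ?V"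
      using holomorphic_on_imp_continuous_on[OF C1] by (rule open_Collect_neq[OF _ continuous_on_const])
    moreover have "z0 \<in> ?V" using zero[OF z0 True] by (simp add: C1_def)
    moreover have "(\<lambda>z. K1 z / C1 z) holomorphic_on ?V"
      using K1 C1 by (intro holomorphic_intros) (auto intro: holomorphic_on_subset)
    then have "?g holomorphic_on ?V"
    proof (rule holomorphic_transform)
      fix z assume "z \<in> ?V"
      then show "K1 z / C1 z = ?g z"
        using True zero[OF z0 True] by (cases "z = z0") (auto simp: K1_def C1_def)
    qed
    ultimately show ?thesis by blast
  qed
  then obtain V where V: "\<And>z. z \<in> U \<Longrightarrow> open (V z) \<and> z \<in> V z \<and> ?g holomorphic_on V z" by metis
  have "?g holomorphic_on (\<Union>z\<in>U. V z)"
    by (rule holomorphic_on_UN_open) (use V in auto)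
  then show ?thesis by (rule holomorphic_on_subset) (use V in auto)
qed

text \<open>On the imaginary axis \<open>exp (c (z + 1) (Ln (z + 1) - ln R))\<close> decays like the bound on \<open>g\<close>, on the
  circle of radius \<open>R\<close> it is bounded below by that bound, and at a fixed point \<open>x > 0\<close> it tends to \<open>0\<close> as
  \<open>c ln R\<close> tends to infinity.\<close>

lemma half_disc_decay:
  fixes g :: "complex \<Rightarrow> complex"
  assumes hol: "g holomorphic_on {z. Re z > - \<eta>}" and \<eta>: "\<eta> > 0" and R: "R \<ge> 1" and \<delta>: "\<delta> \<ge> 0" and C: "C \<ge> 0"
    and bd: "\<And>z. Re z \<ge> 0 \<Longrightarrow> cmod z \<le> R \<Longrightarrow> Re z = 0 \<or> cmod z = R \<Longrightarrow> cmod (g z) \<le> C * exp (- (\<delta> * \<bar>Im z\<bar>))"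
    and x: "0 \<le> x" "x \<le> R"
  defines "c \<equiv> 2 * \<delta> / pi"
  shows "cmod (g (of_real x)) \<le> C * exp (c * ((x + 1) * ln (x + 1)) - c * (x * ln R))"
proof -
  \<comment> \<open>The constant is chosen so that the term with the argument in
    \<open>Re_mult_Ln_ge\<close> costs exactly the decay rate \<delta> of g.\<close>
  have c: "c \<ge> 0" "c * (pi / 2) = \<delta>" using \<delta> by (auto simp: c_def)
  have lnR: "ln R \<ge> 0" using R by simp
  define F where "F = (\<lambda>z. g z * exp (- (of_real c * ((z + 1) * Ln (z + 1) - of_real (ln R) * (z + 1)))))"
  define E where "E = (\<lambda>z. c * (Re ((z + 1) * Ln (z + 1)) - ln R * (Re z + 1)))"
  have normF: "cmod (F z) = cmod (g z) * exp (- E z)" for z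
    unfolding F_def E_def norm_mult norm_exp_eq_Re by (simp add: algebra_simps)
  have Ele: "- E z \<le> \<delta> * \<bar>Im z\<bar> - c * ((Re z + 1) * (ln (cmod (z + 1)) - ln R))" if "Re z \<ge> 0" for z
  proof -
    have "Re (z + 1) * ln (cmod (z + 1)) - \<bar>Im (z + 1)\<bar> * (pi / 2) \<le> Re ((z + 1) * Ln (z + 1))"
      using that by (intro Re_mult_Ln_ge) auto
    then have "c * ((Re z + 1) * ln (cmod (z + 1)) - \<bar>Im z\<bar> * (pi / 2)) \<le> c * Re ((z + 1) * Ln (z + 1))"
      using c by (intro mult_left_mono) auto
    moreover have "c * ((Re z + 1) * ln (cmod (z + 1)) - \<bar>Im z\<bar> * (pi / 2))
        = c * (Re z + 1) * ln (cmod (z + 1)) - c * (pi / 2) * \<bar>Im z\<bar>" by (simp add: algebra_simps)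
    moreover have "- (c * (Q - l * r)) \<le> D - c * (r * (L - l))" if "c * r * L - D \<le> c * Q" for Q L l r D
      using that by (simp add: algebra_simps)
    ultimately show ?thesis unfolding E_def c(2) by simp
  qed
  define T where "T = {z. Re z \<ge> 0} \<inter> cball 0 R"
  define V where "V = {z. Re z > 0} \<inter> ball 0 R"
  have clT: "closed T" unfolding T_def by (intro closed_Int closed_halfspace_Re_ge closed_cball)
  have opV: "open V" unfolding V_def by (intro open_Int open_halfspace_Re_gt open_ball)
  have VT: "V \<subseteq> T" unfolding V_def T_def by auto
  have holT: "F holomorphic_on T" unfolding F_def
  proof (intro holomorphic_intros)
    show "g holomorphic_on T" by (rule holomorphic_on_subset[OF hol]) (use \<eta> in \<open>auto simp: T_def\<close>)
    fix z assume "z \<in> T"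
    then have "Re (z + 1) > 0" by (simp add: T_def)
    then show "z + 1 \<notin> \<real>\<^sub>\<le>\<^sub>0" by (auto simp: complex_nonpos_Reals_iff)
  qed
  have "cmod (F (of_real x)) \<le> C * exp (c * ln R)"
  proof (rule maximum_modulus_frontier[of F T])
    show "F holomorphic_on interior T" using holT interior_subset by (rule holomorphic_on_subset)
    show "continuous_on (closure T) F"
      using holT clT by (simp add: closure_closed holomorphic_on_imp_continuous_on)
    show "bounded T" unfolding T_def by auto
    show "complex_of_real x \<in> T" using x by (simp add: T_def)
  next
    fix z assume "z \<in> frontier T"
    then have z: "z \<in> T" "z \<notin> V" using frontier_subset_Diff_open[OF clT opV VT] by auto
    then have re: "Re z \<ge> 0" and zR: "cmod z \<le> R" and alt: "Re z = 0 \<or> cmod z = R"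
      by (auto simp: T_def V_def)
    \<comment> \<open>On the imaginary axis the left side is c (ln R - ln \<bar>z + 1\<bar>) with
      \<bar>z + 1\<bar> \<ge> 1; on the circle it is not positive, since \<bar>z + 1\<bar> \<ge>
      \<bar>z\<bar> = R.\<close>
    have "- (c * ((Re z + 1) * (ln (cmod (z + 1)) - ln R))) \<le> c * ln R"
    proof (cases "Re z = 0")
      case True
      have "1 \<le> cmod (z + 1)" using complex_Re_le_cmod[of "z + 1"] True by simp
      then have "0 \<le> ln (cmod (z + 1))" by simp
      then have "0 \<le> c * ln (cmod (z + 1))" using c by simp
      then show ?thesis using True by (simp add: algebra_simps)
    next
      case False
      then have "cmod z = R" using alt by simp
      have "(cmod z)\<^sup>2 \<le> (cmod (z + 1))\<^sup>2" using re
        unfolding cmod_power2 by (simp add: power2_eq_square algebra_simps)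
      then have "cmod z \<le> cmod (z + 1)" by (rule power2_le_imp_le) auto
      then have "ln R \<le> ln (cmod (z + 1))" using \<open>cmod z = R\<close> R by (subst ln_le_cancel_iff) auto
      then have "0 \<le> c * ((Re z + 1) * (ln (cmod (z + 1)) - ln R))" using c re by simp
      moreover have "0 \<le> c * ln R" using c lnR by simp
      ultimately show ?thesis by linarith
    qed
    then have "- E z \<le> \<delta> * \<bar>Im z\<bar> + c * ln R" using Ele[OF re] by linarith
    then have "cmod (F z) \<le> C * exp (- (\<delta> * \<bar>Im z\<bar>)) * exp (\<delta> * \<bar>Im z\<bar> + c * ln R)"
      unfolding normF using bd[OF re zR alt] C by (intro mult_mono) auto
    also have "\<dots> = C * exp (c * ln R)" by (simp add: mult.assoc flip: exp_add)
    finally show "cmod (F z) \<le> C * exp (c * ln R)" .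
  qed
  moreover have "E (of_real x) = c * ((x + 1) * ln (x + 1) - ln R * (x + 1))"
  proof -
    have "complex_of_real x + 1 = of_real (x + 1)" by simp
    moreover have "Ln (of_real (x + 1)) = of_real (ln (x + 1))" using x by (intro Ln_of_real) auto
    ultimately have "(of_real x + 1) * Ln (of_real x + 1) = complex_of_real ((x + 1) * ln (x + 1))"
      by (simp only: of_real_mult)
    then show ?thesis unfolding E_def by (simp only: Re_complex_of_real)
  qed
  ultimately have "cmod (g (of_real x)) * exp (- (c * ((x + 1) * ln (x + 1) - ln R * (x + 1)))) \<le> C * exp (c * ln R)"
    by (simp only: normF)
  then have "cmod (g (of_real x)) \<le> C * exp (c * ln R) * exp (c * ((x + 1) * ln (x + 1) - ln R * (x + 1)))"
  proof -
    have "G \<le> B * exp P" if "G * exp (- P) \<le> B" for G P B :: real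
      using mult_right_mono[OF that, of "exp P"] by (simp add: mult.assoc flip: exp_add)
    then show "cmod (g (of_real x)) * exp (- (c * ((x + 1) * ln (x + 1) - ln R * (x + 1)))) \<le> C * exp (c * ln R) \<Longrightarrow> ?thesis" .
  qed
  also have "\<dots> = C * exp (c * ln R + c * ((x + 1) * ln (x + 1) - ln R * (x + 1)))"
    by (simp only: mult.assoc exp_add)
  also have "c * ln R + c * ((x + 1) * ln (x + 1) - ln R * (x + 1)) = c * ((x + 1) * ln (x + 1)) - c * (x * ln R)"
    by (simp add: algebra_simps)
  finally show ?thesis .
qed

lemma cmod_cos_ge:
  "\<bar>cos (Re z)\<bar> \<le> cmod (cos z)" "(exp \<bar>Im z\<bar> - exp (- \<bar>Im z\<bar>)) / 2 \<le> cmod (cos z)"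
proof -
  have sq: "(cmod (cos z))\<^sup>2 = (cos (Re z))\<^sup>2 + ((exp (Im z) - exp (- Im z)) / 2)\<^sup>2"
    by (simp add: norm_cos_squared power_divide exp_minus)
  show "\<bar>cos (Re z)\<bar> \<le> cmod (cos z)"
    by (rule power2_le_imp_le) (auto simp: sq)
  have "((exp \<bar>Im z\<bar> - exp (- \<bar>Im z\<bar>)) / 2)\<^sup>2 = ((exp (Im z) - exp (- Im z)) / 2)\<^sup>2"
    by (cases "Im z \<ge> 0") (auto simp: power2_eq_square algebra_simps)
  then have "((exp \<bar>Im z\<bar> - exp (- \<bar>Im z\<bar>)) / 2)\<^sup>2 \<le> (cmod (cos z))\<^sup>2" by (simp add: sq)
  then show "(exp \<bar>Im z\<bar> - exp (- \<bar>Im z\<bar>)) / 2 \<le> cmod (cos z)"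
    by (rule power2_le_imp_le) simp
qed

lemma cos_pi_ge_half:
  assumes "\<bar>x\<bar> \<le> 1 / 4"
  shows "cos (pi * x) \<ge> 1 / 2"
proof -
  have "pi * \<bar>x\<bar> \<le> pi * (1 / 3)" using assms by (intro mult_left_mono) auto
  then have "cos (pi / 3) \<le> cos (pi * \<bar>x\<bar>)" by (intro cos_monotone_0_pi_le) auto
  then show ?thesis by (simp add: cos_60 abs_if split: if_splits)
qed

text \<open>Circles of integral radius and the rotated imaginary axis keep away from the zeros,
  which are the half integers. Away from the real line the hyperbolic part is large; close to it, a
  point on these curves has real part within 1 / 4 of an integer, where the cosine is at least 1 / 2
  in modulus.\<close>

lemma cos_pi_lower_bound:
  fixes u :: complex
  assumes u: "cmod u = 1" "Re u > 0"
  obtains c where "c > 0"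
    "\<And>z. Re z = 0 \<or> (\<exists>N::nat. N \<ge> 1 \<and> cmod z = real N) \<Longrightarrow> cmod (cos (of_real pi * (u * z))) \<ge> c * exp (pi * \<bar>Im (u * z)\<bar>)"
proof -
  define a where "a = Re u / 4"
  have a: "a > 0" "a \<le> 1 / 4" using u complex_Re_le_cmod[of u] by (auto simp: a_def)
  define c where "c = min ((1 - exp (- (2 * pi * a))) / 2) (exp (- (pi / 2)) / 2)"
  have c: "c > 0" using a by (auto simp: c_def)
  have big: "c * exp (pi * Y) \<le> cmod (cos (of_real pi * w))" if "Y = \<bar>Im w\<bar>" "Y \<ge> a" for w Y
  proof -
    have "c * exp (pi * Y) \<le> (1 - exp (- (2 * pi * a))) / 2 * exp (pi * Y)"
      unfolding c_def by (intro mult_right_mono min.cobounded1) auto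
    also have "\<dots> = (exp (pi * Y) - exp (pi * Y - 2 * pi * a)) / 2"
    proof -
      have "exp (pi * Y - 2 * pi * a) = exp (- (2 * pi * a)) * exp (pi * Y)" by (simp flip: exp_add)
      then show ?thesis by (simp only: left_diff_distrib times_divide_eq_left mult_1)
    qed
    also have "\<dots> \<le> (exp (pi * Y) - exp (- (pi * Y))) / 2"
    proof -
      have "2 * pi * a \<le> 2 * pi * Y" using that by (intro mult_left_mono) auto
      then have "exp (- (pi * Y)) \<le> exp (pi * Y - 2 * pi * a)" by simp
      then show ?thesis by simp
    qed
    also have "\<dots> \<le> cmod (cos (of_real pi * w))"
      using cmod_cos_ge(2)[of "of_real pi * w"] that by (simp add: abs_mult)
    finally show ?thesis .
  qed
  have small: "c * exp (pi * Y) \<le> cmod (cos (of_real pi * w))"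
    if "Y = \<bar>Im w\<bar>" "Y \<le> 1 / 2" "\<bar>cos (pi * Re w)\<bar> \<ge> 1 / 2" for w Y
  proof -
    have "pi * Y \<le> pi / 2" using mult_left_mono[OF that(2), of pi] by simp
    then have "c * exp (pi * Y) \<le> exp (- (pi / 2)) / 2 * exp (pi / 2)"
      unfolding c_def by (intro mult_mono) auto
    also have "\<dots> = 1 / 2" by (simp flip: exp_add)
    also have "\<dots> \<le> cmod (cos (of_real pi * w))"
      using that cmod_cos_ge(1)[of "of_real pi * w"] by simp
    finally show ?thesis .
  qed
  show ?thesis
  proof (rule that[OF c])
    fix z assume z: "Re z = 0 \<or> (\<exists>N::nat. N \<ge> 1 \<and> cmod z = real N)"
    define w where "w = u * z"
    define Y where "Y = \<bar>Im w\<bar>"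
    have "c * exp (pi * Y) \<le> cmod (cos (of_real pi * w))"
      using z
    proof
      assume re: "Re z = 0"
      have Y: "Y = Re u * \<bar>Im z\<bar>" using re u unfolding Y_def w_def by (simp add: abs_mult)
      show ?thesis
      proof (cases "\<bar>Im z\<bar> \<le> 1 / 4")
        case True
        have "cmod w \<le> 1 / 4" using True re u by (simp add: w_def norm_mult cmod_eq_Im)
        then have "\<bar>Re w\<bar> \<le> 1 / 4" "Y \<le> 1 / 4"
          unfolding Y_def using abs_Re_le_cmod[of w] abs_Im_le_cmod[of w] by auto
        then show ?thesis using cos_pi_ge_half[of "Re w"] by (intro small Y_def) auto
      next
        case False
        then have "Re u * (1 / 4) \<le> Re u * \<bar>Im z\<bar>" using u by (intro mult_left_mono) auto
        then have "a \<le> Y" unfolding Y a_def by simp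
        then show ?thesis by (intro big Y_def)
      qed
    next
      assume "\<exists>N::nat. N \<ge> 1 \<and> cmod z = real N"
      then obtain N :: nat where N: "N \<ge> 1" "cmod w = real N" using u by (auto simp: w_def norm_mult)
      show ?thesis
      proof (cases "Y \<le> 1 / 2")
        case False
        then show ?thesis using a by (intro big Y_def) auto
      next
        case True
        \<comment> \<open>From (N - X) (N + X) = Y^2 \<le> 1 / 4 and N + X \<ge> 1: close to the
          real line the circle of radius N lies within 1 / 4 of \<plusminus>N in its real
          part.\<close>
        define X where "X = \<bar>Re w\<bar>"
        have "X\<^sup>2 + Y\<^sup>2 = (real N)\<^sup>2" unfolding X_def Y_def N(2)[symmetric] cmod_power2 by simp
        then have "(real N - X) * (real N + X) = Y\<^sup>2" by (simp add: power2_eq_square algebra_simps)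
        moreover have X: "0 \<le> X" "X \<le> real N" unfolding X_def N(2)[symmetric] using abs_Re_le_cmod by auto
        moreover have "(real N - X) * 1 \<le> (real N - X) * (real N + X)" using X N(1) by (intro mult_left_mono) auto
        moreover have "Y\<^sup>2 \<le> (1 / 2)\<^sup>2" using True by (intro power_mono) (auto simp: Y_def)
        ultimately have d: "\<bar>X - real N\<bar> \<le> 1 / 4" by (simp add: power2_eq_square)
        have "cos (pi * Re w) = cos (pi * X)" unfolding X_def by (auto simp: abs_if)
        also have "pi * X = pi * (X - real N) + real N * pi" by (simp add: algebra_simps)
        also have "cos (pi * (X - real N) + real N * pi) = cos (pi * (X - real N)) * (- 1) ^ N"
          by (simp add: cos_add cos_npi)
        finally have "\<bar>cos (pi * Re w)\<bar> = \<bar>cos (pi * (X - real N))\<bar>" by (simp add: abs_mult power_abs)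
        then show ?thesis using True cos_pi_ge_half[OF d] by (intro small Y_def) auto
      qed
    qed
    then show "cmod (cos (of_real pi * (u * z))) \<ge> c * exp (pi * \<bar>Im (u * z)\<bar>)"
      by (simp only: w_def Y_def)
  qed
qed

text \<open>The bound is only required on the discs of radii \<open>R J\<close>, with a gap \<open>\<delta> J\<close> to the critical exponential
  type that may tend to zero; this allows for the critical shift \<open>\<pi> / \<sigma>\<close>.\<close>

lemma carlson_type:
  fixes K :: "complex \<Rightarrow> complex" and R :: "nat \<Rightarrow> nat"
  assumes hol: "K holomorphic_on UNIV" and zeros: "\<And>n::nat. K (of_nat n + 1 / 2) = 0"
    and u: "cmod u = 1" "Re u > 0"
    and \<delta>: "\<And>J. 0 \<le> \<delta> J" "\<And>J. \<delta> J \<le> pi"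
    and R: "\<And>J. R J \<ge> 1" "filterlim (\<lambda>J. real (R J)) at_top sequentially"
    and lim: "filterlim (\<lambda>J. \<delta> J * ln (real (R J))) at_top sequentially"
    and bound: "\<And>J z. Re z \<ge> 0 \<Longrightarrow> cmod z \<le> real (R J) \<Longrightarrow>
      cmod (K (u * z)) \<le> C * exp (M * Re z + (pi - \<delta> J) * \<bar>Im (u * z)\<bar>)"
  shows "K w = 0"
proof -
  obtain c1 where c1: "c1 > 0" and cosb: "\<And>z. Re z = 0 \<or> (\<exists>N::nat. N \<ge> 1 \<and> cmod z = real N) \<Longrightarrow>
      cmod (cos (of_real pi * (u * z))) \<ge> c1 * exp (pi * \<bar>Im (u * z)\<bar>)"
    using cos_pi_lower_bound[OF u] by blast
  have C0: "C \<ge> 0" using order_trans[OF norm_ge_zero bound[of 0 0]] by simp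
  define Ku where "Ku = (\<lambda>z. K (u * z))"
  define Cu where "Cu = (\<lambda>z. cos (of_real pi * (u * z)))"
  have holK: "Ku holomorphic_on UNIV" unfolding Ku_def
    by (intro holomorphic_on_compose_entire[OF hol] holomorphic_intros)
  have holC: "Cu holomorphic_on UNIV" unfolding Cu_def by (intro holomorphic_intros)
  \<comment> \<open>The half plane extends beyond the imaginary axis so that the axis is interior,
    but stops short of the zero of the cosine at -1 / 2, which has real part - Re u / 2 in the
    variable z and where nothing is known about K.\<close>
  define U where "U = {z. Re z > - (Re u / 4)}"
  define g0 where "g0 = (\<lambda>z. if Cu z = 0 then deriv Ku z / deriv Cu z else Ku z / Cu z)"
  have holg0: "g0 holomorphic_on U" unfolding g0_def
  proof (rule holomorphic_quotient_simple_zeros[OF holK holC])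
    show "open U" unfolding U_def by (rule open_halfspace_Re_gt)
    fix z assume z: "z \<in> U" and "Cu z = 0"
    then obtain m :: int where "of_real pi * (u * z) = of_real (of_int m * pi) + of_real pi / 2"
      unfolding Cu_def cos_eq_0 by blast
    then have "of_real pi * (u * z) = of_real pi * (of_int m + 1 / 2)" by (simp add: algebra_simps)
    then have uz: "u * z = of_int m + 1 / 2" by simp
    have "cnj u * u = 1" using u by (simp add: complex_norm_square[symmetric] mult.commute)
    then have "z = cnj u * (u * z)" by (simp add: mult.assoc[symmetric])
    also have "\<dots> = cnj u * of_real (of_int m + 1 / 2)" by (simp add: uz)
    finally have "Re z = Re (cnj u * of_real (of_int m + 1 / 2))" by (rule arg_cong)
    also have "\<dots> = Re u * (of_int m + 1 / 2)" by simp
    finally have "Re z = Re u * (of_int m + 1 / 2)" .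
    then have "Re u * (- (1 / 4)) < Re u * (of_int m + 1 / 2)" using z by (simp add: U_def)
    then have "- (1 / 4) < real_of_int m + 1 / 2" using u by (simp only: mult_less_cancel_left_pos)
    then have "m \<ge> 0" by linarith
    then have "u * z = of_nat (nat m) + 1 / 2" using uz by (simp add: of_nat_nat)
    then have "Ku z = 0" unfolding Ku_def using zeros[of "nat m"] by simp
    moreover have "deriv Cu z = - (sin (of_real pi * (u * z)) * (of_real pi * u))"
      unfolding Cu_def by (rule DERIV_imp_deriv) (auto intro!: derivative_eq_intros)
    moreover have "sin (of_real pi * (u * z)) \<noteq> 0"
    proof
      assume "sin (of_real pi * (u * z)) = 0"
      then show False using sin_cos_squared_add[of "of_real pi * (u * z)"] \<open>Cu z = 0\<close> by (simp add: Cu_def)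
    qed
    moreover have "u \<noteq> 0" using u by auto
    ultimately show "Ku z = 0 \<and> deriv Cu z \<noteq> 0" by simp
  qed
  have est: "cmod (g0 (of_real x)) \<le> exp ((\<bar>M\<bar> + pi) * x) * (C / c1) * exp (2 * ((x + 1) * ln (x + 1))) * exp (- (2 * Re u / pi * x * (\<delta> J * ln (real (R J)))))"
    if x: "0 \<le> x" "x \<le> real (R J)" for x J
  proof -
    \<comment> \<open>The factor exp (- k z) removes the growth exp (M Re z). The second summand
      turns decay in \<bar>Im (u z)\<bar> into decay in \<bar>Im z\<bar>, as Im (u z) = Re u Im z +
      Im u Re z.\<close>
    define k where "k = M + \<delta> J * \<bar>Im u\<bar>"
    define g where "g = (\<lambda>z. g0 z * exp (- (of_real k * z)))"
    have "cmod (g (of_real x)) \<le> C / c1 * exp ((2 * (\<delta> J * Re u) / pi) * ((x + 1) * ln (x + 1)) - (2 * (\<delta> J * Re u) / pi) * (x * ln (real (R J))))"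
    proof (rule half_disc_decay[where \<eta> = "Re u / 4"])
      show "g holomorphic_on {z. - (Re u / 4) < Re z}"
        unfolding g_def using holg0 unfolding U_def by (intro holomorphic_intros)
      show "1 \<le> real (R J)" using R(1)[of J] by simp
      show "0 \<le> \<delta> J * Re u" using \<delta>(1)[of J] u by simp
      show "0 \<le> C / c1" using C0 c1 by simp
      fix z assume re: "Re z \<ge> 0" and zR: "cmod z \<le> real (R J)" and alt0: "Re z = 0 \<or> cmod z = real (R J)"
      have alt: "Re z = 0 \<or> (\<exists>N::nat. N \<ge> 1 \<and> cmod z = real N)" using alt0 R(1)[of J] by auto
      define Y where "Y = \<bar>Im (u * z)\<bar>"
      have lower: "c1 * exp (pi * Y) \<le> cmod (Cu z)" using cosb[OF alt] by (simp add: Cu_def Y_def)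
      have pos: "c1 * exp (pi * Y) > 0" using c1 by simp
      have "Cu z \<noteq> 0" using lower pos by auto
      show "cmod (g z) \<le> C / c1 * exp (- (\<delta> J * Re u * \<bar>Im z\<bar>))"
      proof -
        have "cmod (g z) = cmod (Ku z) / cmod (Cu z) * exp (- (k * Re z))"
          unfolding g_def g0_def using \<open>Cu z \<noteq> 0\<close> by (simp add: norm_mult norm_divide)
        also have "\<dots> \<le> C * exp (M * Re z + (pi - \<delta> J) * Y) / (c1 * exp (pi * Y)) * exp (- (k * Re z))"
          using bound[OF re zR] lower pos C0 unfolding Ku_def Y_def
          by (intro mult_right_mono frac_le) auto
        also have "\<dots> = C / c1 * (exp (M * Re z + (pi - \<delta> J) * Y) / exp (pi * Y) * exp (- (k * Re z)))" by simp
        also have "exp (M * Re z + (pi - \<delta> J) * Y) / exp (pi * Y) * exp (- (k * Re z)) = exp (- (\<delta> J * (Y + \<bar>Im u\<bar> * Re z)))"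
          unfolding k_def by (simp add: algebra_simps flip: exp_diff exp_add)
        also have "C / c1 * exp (- (\<delta> J * (Y + \<bar>Im u\<bar> * Re z))) \<le> C / c1 * exp (- (\<delta> J * Re u * \<bar>Im z\<bar>))"
        proof (intro mult_left_mono)
          have "Re u * \<bar>Im z\<bar> = \<bar>Im (u * z) - Im u * Re z\<bar>" using u by (simp add: abs_mult)
          also have "\<dots> \<le> Y + \<bar>Im u * Re z\<bar>" unfolding Y_def by (rule abs_triangle_ineq4)
          also have "\<bar>Im u * Re z\<bar> = \<bar>Im u\<bar> * Re z" using re by (simp add: abs_mult)
          finally have "\<delta> J * (Re u * \<bar>Im z\<bar>) \<le> \<delta> J * (Y + \<bar>Im u\<bar> * Re z)" using \<delta>(1) by (intro mult_left_mono) auto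
          then show "exp (- (\<delta> J * (Y + \<bar>Im u\<bar> * Re z))) \<le> exp (- (\<delta> J * Re u * \<bar>Im z\<bar>))" by (simp add: mult.assoc)
        qed (use C0 c1 in auto)
        finally show ?thesis .
      qed
    qed (use u x in auto)
    also have "\<dots> \<le> C / c1 * (exp (2 * ((x + 1) * ln (x + 1))) * exp (- (2 * Re u / pi * x * (\<delta> J * ln (real (R J))))))"
    proof (intro mult_left_mono)
      have "Re u \<le> 1" using complex_Re_le_cmod[of u] u by simp
      then have "\<delta> J * Re u \<le> pi * 1" using \<delta>[of J] u by (intro mult_mono) auto
      then have "2 * (\<delta> J * Re u) / pi \<le> 2" by (simp add: divide_le_eq)
      moreover have "0 \<le> (x + 1) * ln (x + 1)" using x by simp
      ultimately have "2 * (\<delta> J * Re u) / pi * ((x + 1) * ln (x + 1)) \<le> 2 * ((x + 1) * ln (x + 1))"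
        by (intro mult_right_mono) auto
      then show "exp (2 * (\<delta> J * Re u) / pi * ((x + 1) * ln (x + 1)) - 2 * (\<delta> J * Re u) / pi * (x * ln (real (R J))))
          \<le> exp (2 * ((x + 1) * ln (x + 1))) * exp (- (2 * Re u / pi * x * (\<delta> J * ln (real (R J)))))"
        unfolding exp_add[symmetric] by (simp add: mult_ac)
    qed (use C0 c1 in auto)
    finally have le: "cmod (g (of_real x)) \<le> C / c1 * (exp (2 * ((x + 1) * ln (x + 1))) * exp (- (2 * Re u / pi * x * (\<delta> J * ln (real (R J))))))" .
    have "g0 (of_real x) = g (of_real x) * exp (of_real (k * x))"
      unfolding g_def by (simp add: mult.assoc flip: exp_add)
    then have "cmod (g0 (of_real x)) = cmod (g (of_real x)) * exp (k * x)"
      by (simp only: norm_mult norm_exp_eq_Re Re_complex_of_real)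
    also have "\<dots> \<le> C / c1 * (exp (2 * ((x + 1) * ln (x + 1))) * exp (- (2 * Re u / pi * x * (\<delta> J * ln (real (R J)))))) * exp ((\<bar>M\<bar> + pi) * x)"
    proof (intro mult_mono le)
      have "\<bar>Im u\<bar> \<le> 1" using abs_Im_le_cmod[of u] u by simp
      then have "\<delta> J * \<bar>Im u\<bar> \<le> pi * 1" using \<delta>[of J] by (intro mult_mono) auto
      then have "k \<le> \<bar>M\<bar> + pi" unfolding k_def by linarith
      then show "exp (k * x) \<le> exp ((\<bar>M\<bar> + pi) * x)" using x by (simp add: mult_right_mono)
    qed (use C0 c1 in auto)
    finally show ?thesis by (simp add: mult_ac)
  qed
  \<comment> \<open>At fixed x only the last factor of the estimate depends on J, and it tends to 0.
    The restriction x < 1 / 2 keeps the cosine from vanishing.\<close>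
  have zero: "K (u * of_real x) = 0" if x: "0 < x" "x < 1 / 2" for x
  proof -
    have lim0: "(\<lambda>J. exp (- (2 * Re u / pi * x * (\<delta> J * ln (real (R J)))))) \<longlonglongrightarrow> 0"
    proof (rule filterlim_compose[OF exp_at_bot])
      show "filterlim (\<lambda>J. - (2 * Re u / pi * x * (\<delta> J * ln (real (R J))))) at_bot sequentially"
      proof (rule filterlim_compose[OF filterlim_uminus_at_bot_at_top])
        show "filterlim (\<lambda>J. 2 * Re u / pi * x * (\<delta> J * ln (real (R J)))) at_top sequentially"
          by (rule filterlim_tendsto_pos_mult_at_top[OF tendsto_const _ lim]) (use u x in auto)
      qed
    qed
    have "(\<lambda>J::nat. g0 (of_real x)) \<longlonglongrightarrow> 0"
    proof (rule Lim_null_comparison)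
      have "\<forall>\<^sub>F J in sequentially. x \<le> real (R J)" using R(2) unfolding filterlim_at_top by blast
      then show "\<forall>\<^sub>F J in sequentially. norm (g0 (of_real x)) \<le> exp ((\<bar>M\<bar> + pi) * x) * (C / c1) * exp (2 * ((x + 1) * ln (x + 1))) * exp (- (2 * Re u / pi * x * (\<delta> J * ln (real (R J)))))"
        by eventually_elim (use est x in auto)
      show "(\<lambda>J. exp ((\<bar>M\<bar> + pi) * x) * (C / c1) * exp (2 * ((x + 1) * ln (x + 1))) * exp (- (2 * Re u / pi * x * (\<delta> J * ln (real (R J)))))) \<longlonglongrightarrow> 0"
        by (rule tendsto_mult_right_zero[OF lim0])
    qed
    then have "g0 (of_real x) = 0" by (simp add: LIMSEQ_const_iff)
    moreover have "Cu (of_real x) \<noteq> 0"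
    proof -
      have "\<bar>Re (u * of_real x)\<bar> \<le> x" using abs_Re_le_cmod[of "u * of_real x"] u x by (simp add: norm_mult)
      then have "pi * \<bar>Re (u * of_real x)\<bar> < pi * (1 / 2)"
        using x by (intro mult_strict_left_mono) auto
      then have "\<bar>pi * Re (u * of_real x)\<bar> < pi * (1 / 2)" by (simp add: abs_mult)
      moreover have "cos q > 0" if "\<bar>q\<bar> < pi * (1 / 2)" for q
        using that by (intro cos_gt_zero_pi) auto
      ultimately have "cos (pi * Re (u * of_real x)) > 0" by blast
      then have "\<bar>cos (Re (of_real pi * (u * of_real x)))\<bar> > 0" by simp
      then show ?thesis unfolding Cu_def using cmod_cos_ge(1)[of "of_real pi * (u * of_real x)"] by auto
    qed
    ultimately show ?thesis by (simp add: g0_def Ku_def)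
  qed
  let ?A = "(\<lambda>x::real. u * of_real x) ` {0<..<1/2}"
  have lp: "0 islimpt ?A" unfolding islimpt_approachable
  proof (intro allI impI)
    fix e :: real assume e: "e > 0"
    define x where "x = min (e / 2) (1 / 4)"
    have x: "0 < x" "x < e" "x < 1 / 2" using e by (auto simp: x_def)
    then show "\<exists>x'\<in>?A. x' \<noteq> 0 \<and> dist x' 0 < e"
      using u by (intro bexI[of _ "u * of_real x"]) (auto simp: norm_mult)
  qed
  show ?thesis
    by (rule analytic_continuation[OF hol open_UNIV connected_UNIV _ _ lp]) (use zero in auto)
qed

section \<open>Cyclic translations\<close>

lemma comp_op_translate_funpow:
  assumes "\<phi> = (\<lambda>z. z + b)"
  shows "(comp_op \<phi> ^^ n) f = (\<lambda>z. f (z + of_nat n * b))"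
  by (induction n arbitrary: f) (auto simp: comp_op_def assms fun_eq_iff algebra_simps)

text \<open>The starting point, half a step off the origin, places the zeros forced by orthogonality
  at half integers, so that none lies on the boundary of the half plane in
  \<open>carlson_type\<close>.\<close>

lemma translate_rkernel_orbit:
  assumes "\<phi> = (\<lambda>z. z + b)"
  shows "(comp_op \<phi> ^^ n) (rkernel \<sigma> (- cnj b / 2)) = rkernel \<sigma> (- cnj b * (of_nat n + 1 / 2))"
  unfolding comp_op_translate_funpow[OF assms] rkernel_translate
  by (auto simp: fun_eq_iff algebra_simps intro!: arg_cong2[of _ _ _ _ "rkernel \<sigma>"])

text \<open>After a suitable rotation of the lattice the function grows only with Re z, which
  \<open>carlson_type\<close> permits with any constant M. The gap to the critical type is then the
  largest possible, \<pi>, whatever the size of b.\<close>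

lemma pw_cyclic_translate_nonreal:
  assumes \<sigma>: "\<sigma> > 0" and b: "Im b \<noteq> 0" and \<phi>: "\<phi> = (\<lambda>z. z + b)"
  shows "pw_cyclic \<sigma> (comp_op \<phi>)"
proof (rule pw_cyclicI[OF \<sigma>, where f = "rkernel \<sigma> (- cnj b / 2)"])
  note orbit = translate_rkernel_orbit[OF \<phi>, of _ \<sigma>]
  show "(comp_op \<phi> ^^ n) (rkernel \<sigma> (- cnj b / 2)) \<in> paley_wiener \<sigma>" for n
    unfolding orbit by (rule rkernel_in_paley_wiener[OF \<sigma>])
  fix h assume h: "h \<in> paley_wiener \<sigma>" and orth: "\<And>n. pw_inner h ((comp_op \<phi> ^^ n) (rkernel \<sigma> (- cnj b / 2))) = 0"
  define \<beta> where "\<beta> = - cnj b"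
  define s where "s = sgn (Im \<beta>)"
  define r where "r = cmod \<beta>"
  have Im\<beta>: "Im \<beta> \<noteq> 0" using b by (simp add: \<beta>_def)
  have s: "s * s = 1" "s * Im \<beta> = \<bar>Im \<beta>\<bar>" "\<bar>s\<bar> = 1" using Im\<beta> by (auto simp: s_def sgn_if)
  have r: "r > 0" using Im\<beta> by (auto simp: r_def)
  \<comment> \<open>u makes \<beta> u purely imaginary, so \<bar>Im (\<beta> u z)\<bar> = r \<bar>Re
    z\<bar>; the sign s makes Re u positive.\<close>
  define u where "u = \<i> * of_real s * cnj \<beta> / of_real r"
  have u: "cmod u = 1" "Re u > 0"
  proof -
    show "cmod u = 1" unfolding u_def using r s by (simp add: norm_mult norm_divide r_def)
    have "Re u = s * Im \<beta> / r" unfolding u_def by simp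
    then show "Re u > 0" using s Im\<beta> r by simp
  qed
  have \<beta>u: "\<beta> * u = \<i> * of_real (s * r)"
  proof -
    have "\<beta> * cnj \<beta> = of_real (r * r)" unfolding r_def by (simp add: complex_norm_square[symmetric] power2_eq_square)
    moreover have "\<beta> * u = \<i> * of_real s * (\<beta> * cnj \<beta>) / of_real r" unfolding u_def by (simp add: mult_ac)
    ultimately have "\<beta> * u = \<i> * of_real s * of_real (r * r) / of_real r" by (simp only:)
    then show ?thesis using r by simp
  qed
  have hz: "h (\<beta> * w) = 0" for w
  proof (rule carlson_type[where K = "\<lambda>w. h (\<beta> * w)" and u = u and \<delta> = "\<lambda>_. pi" and R = Suc
        and C = "sqrt (6 * \<sigma> / pi) * pw_norm h" and M = "\<sigma> * r"])
    show "(\<lambda>w. h (\<beta> * w)) holomorphic_on UNIV"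
      by (intro holomorphic_on_compose_entire[OF paley_wienerD(1)[OF h]] holomorphic_intros)
    show "h (\<beta> * (of_nat n + 1 / 2)) = 0" for n
      using orth[of n] unfolding orbit reproducing[OF h \<sigma>] \<beta>_def .
    show lim: "filterlim (\<lambda>J. real (Suc J)) at_top sequentially"
      by (rule filterlim_compose[OF filterlim_real_sequentially filterlim_Suc])
    show "filterlim (\<lambda>J. pi * ln (real (Suc J))) at_top sequentially"
      by (rule filterlim_tendsto_pos_mult_at_top[OF tendsto_const _ filterlim_compose[OF ln_at_top lim]]) simp
    fix z :: complex assume z: "Re z \<ge> 0"
    have "\<beta> * (u * z) = \<i> * of_real (s * r) * z" using \<beta>u by (simp only: mult.assoc[symmetric])
    moreover have "\<bar>Im (\<i> * of_real (s * r) * z)\<bar> = r * Re z" using s(3) r z by (simp add: abs_mult)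
    ultimately have "\<bar>Im (\<beta> * (u * z))\<bar> = r * Re z" by (simp only:)
    then show "cmod (h (\<beta> * (u * z))) \<le> sqrt (6 * \<sigma> / pi) * pw_norm h * exp (\<sigma> * r * Re z + (pi - pi) * \<bar>Im (u * z)\<bar>)"
      using paley_wiener_pointwise_bound[OF h \<sigma>, of "\<beta> * (u * z)"] by (simp add: mult_ac)
  qed (use u in auto)
  have "\<beta> \<noteq> 0" using Im\<beta> by auto
  then have "h z = 0" for z using hz[of "z / \<beta>"] by simp
  then show "h = (\<lambda>z. 0)" by (simp add: fun_eq_iff)
qed

lemma rkernel_norm_real:
  assumes "\<sigma> > 0"
  shows "(pw_norm (rkernel \<sigma> (of_real x)))\<^sup>2 = \<sigma> / pi"
proof -
  have "complex_of_real ((pw_norm (rkernel \<sigma> (of_real x)))\<^sup>2) = of_real (\<sigma> / pi)"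
    using reproducing[OF rkernel_in_paley_wiener[OF assms] assms, of "of_real x" "of_real x"]
    unfolding pw_inner_self by (simp add: rkernel_def)
  then show ?thesis by (simp only: of_real_eq_iff)
qed

lemma paley_wiener_series:
  assumes f: "\<And>j. f j \<in> paley_wiener \<sigma>" and \<sigma>: "\<sigma> > 0" and B: "\<And>j. pw_norm (f j) \<le> B"
    and c: "summable c" "\<And>j. c j \<ge> 0"
  obtains g where "g \<in> paley_wiener \<sigma>" "(\<lambda>n. pw_norm (\<lambda>z. (\<Sum>j<n. of_real (c j) * f j z) - g z)) \<longlonglongrightarrow> 0"
proof -
  define F where "F = (\<lambda>n z. \<Sum>j<n. of_real (c j) * f j z)"
  have F: "F n \<in> paley_wiener \<sigma>" for n
    unfolding F_def by (intro paley_wiener_sum paley_wiener_scale f)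
  have B0: "B \<ge> 0" using order_trans[OF pw_norm_ge_0 B[of 0]] .
  have tail: "pw_norm (\<lambda>z. F (n + k) z - F n z) \<le> B * (\<Sum>j\<in>{n..<n + k}. c j)" for n k
  proof (induction k)
    case 0
    then show ?case by (simp add: pw_norm_def)
  next
    case (Suc k)
    have "(\<lambda>z. F (n + Suc k) z - F n z) = (\<lambda>z. (F (n + k) z - F n z) + of_real (c (n + k)) * f (n + k) z)"
      by (simp add: F_def fun_eq_iff)
    then have "pw_norm (\<lambda>z. F (n + Suc k) z - F n z) \<le> pw_norm (\<lambda>z. F (n + k) z - F n z) + c (n + k) * pw_norm (f (n + k))"
      using pw_norm_triangle[OF sqi_diff[OF paley_wienerD(3)[OF F[of "n + k"]] paley_wienerD(3)[OF F[of n]]] sqi_scale[OF paley_wienerD(3)[OF f[of "n + k"]], of "of_real (c (n + k))"]] c(2)[of "n + k"]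
      by (simp add: pw_norm_scale)
    also have "\<dots> \<le> B * (\<Sum>j\<in>{n..<n + k}. c j) + c (n + k) * B"
      using Suc B[of "n + k"] c(2)[of "n + k"] by (intro add_mono mult_left_mono) auto
    finally show ?case by (simp add: algebra_simps)
  qed
  have cau: "\<exists>N. \<forall>m\<ge>N. \<forall>n\<ge>N. pw_norm (\<lambda>z. F m z - F n z) \<le> e" if e: "e > 0" for e
  proof -
    obtain N where N: "\<And>m n. m \<ge> N \<Longrightarrow> \<bar>\<Sum>j\<in>{m..<n}. c j\<bar> < e / (B + 1)"
      using c(1) e B0 unfolding summable_Cauchy by (metis (no_types) add_nonneg_pos divide_pos_pos real_norm_def zero_less_one)
    have le: "pw_norm (\<lambda>z. F n z - F m z) \<le> e" if "m \<ge> N" "n \<ge> m" for m n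
    proof -
      have "pw_norm (\<lambda>z. F n z - F m z) \<le> B * (\<Sum>j\<in>{m..<n}. c j)"
        using tail[of m "n - m"] that by simp
      also have "\<dots> \<le> (B + 1) * (e / (B + 1))"
        using N[OF that(1), of n] B0 c(2) by (intro mult_mono sum_nonneg) (auto simp: e less_imp_le)
      also have "\<dots> = e" using B0 by simp
      finally show ?thesis .
    qed
    have "pw_norm (\<lambda>z. F m z - F n z) \<le> e" if "m \<ge> N" "n \<ge> N" for m n
      using le[of m n] le[of n m] that pw_norm_diff_commute[of "F m" "F n"] by (cases "n \<le> m") auto
    then show ?thesis by blast
  qed
  show ?thesis
    by (rule paley_wiener_complete[OF F \<sigma>]) (erule cau, rule that, simp_all only: F_def)
qed

text \<open>For the critical shift the kernels are no longer cyclic. The cyclic vector used here is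
  \<open>f = \<Sum>j. c j * K\<^sub>j\<close> with \<open>K\<^sub>j\<close> the reproducing kernels of spaces of type \<open>s j < \<sigma>\<close>, where \<open>s j\<close> tends to
  \<open>\<sigma>\<close> slowly and \<open>c j\<close> to \<open>0\<close> fast. If \<open>h\<close> is orthogonal to the orbit, then \<open>G = \<Sum>j. c j * p j\<close>, \<open>p j\<close> the
  projections of \<open>h\<close>, vanishes on half of a lattice, hence identically, and \<open>0 = \<langle>G, h\<rangle> = \<Sum>j. c j * \<parallel>p j\<parallel>\<^sup>2\<close>.\<close>

lemma pw_cyclic_translate_real:
  assumes \<sigma>: "\<sigma> > 0" and b: "b \<noteq> 0" "\<bar>b\<bar> \<le> pi / \<sigma>" and \<phi>: "\<phi> = (\<lambda>z. z + complex_of_real b)"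
  shows "pw_cyclic \<sigma> (comp_op \<phi>)"
proof -
  \<comment> \<open>The gap belonging to s J is \<pi> / (J + 2), and R J is so large that the gap
    times ln (R J) is \<pi> ln 2 (J + 2), which tends to infinity. The factor exp (- \<pi> R j) in c
    j suppresses the j-th term on all discs of radius at most R j; the power of 1 / 2 makes the sums
    converge.\<close>
  define s where "s = (\<lambda>j::nat. \<sigma> * (1 - 1 / real (j + 2)))"
  define R where "R = (\<lambda>j::nat. (2::nat) ^ ((j + 2)\<^sup>2))"
  define c where "c = (\<lambda>j::nat. (1 / 2) ^ j * exp (- (pi * real (R j))))"
  define w0 where "w0 = complex_of_real (- b / 2)"
  have s: "s j > 0" "s j \<le> \<sigma>" "s j < \<sigma>" for j
  proof -
    have "1 / real (j + 2) < 1" "0 < 1 / real (j + 2)" by simp_all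
    then have q: "0 < 1 - 1 / real (j + 2)" "1 - 1 / real (j + 2) < 1" by linarith+
    show "s j > 0" unfolding s_def using \<sigma> q by (intro mult_pos_pos)
    show "s j < \<sigma>" using mult_strict_left_mono[OF q(2) \<sigma>] unfolding s_def by simp
    then show "s j \<le> \<sigma>" by simp
  qed
  have smono: "s i \<le> s j" if "i \<le> j" for i j
    unfolding s_def using that \<sigma> by (intro mult_left_mono diff_left_mono divide_left_mono) auto
  have Rmono: "R i \<le> R j" if "i \<le> j" for i j
    unfolding R_def using that by (intro power_increasing power_mono) auto
  have c0: "c j > 0" for j by (simp add: c_def)
  have cle: "c j \<le> (1 / 2) ^ j" for j
  proof -
    have "c j \<le> (1 / 2) ^ j * 1" unfolding c_def by (intro mult_left_mono) auto
    then show ?thesis by simp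
  qed
  have geo: "summable (\<lambda>j. (1 / 2 :: real) ^ j)" by (rule summable_geometric) simp
  have csum: "summable c"
    by (rule summable_comparison_test'[OF geo, of 0]) (use c0 cle in \<open>auto simp: less_imp_le\<close>)
  define k where "k = (\<lambda>j. rkernel (s j) w0)"
  have kp: "k j \<in> paley_wiener \<sigma>" for j
    unfolding k_def by (rule paley_wiener_mono[OF s(2) rkernel_in_paley_wiener[OF s(1)]])
  have kB: "pw_norm (k j) \<le> sqrt (\<sigma> / pi)" for j
    unfolding k_def w0_def
    by (rule real_le_rsqrt, subst rkernel_norm_real[OF s(1)]) (use s(2)[of j] in \<open>simp add: divide_right_mono\<close>)
  obtain f where f: "f \<in> paley_wiener \<sigma>" and flim: "(\<lambda>n. pw_norm (\<lambda>z. (\<Sum>j<n. of_real (c j) * k j z) - f z)) \<longlonglongrightarrow> 0"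
    by (rule paley_wiener_series[OF kp \<sigma> kB csum]) (use c0 in \<open>auto simp: less_imp_le\<close>)
  show ?thesis
  proof (rule pw_cyclicI[OF \<sigma>, where f = f])
    show orbit: "(comp_op \<phi> ^^ n) f \<in> paley_wiener \<sigma>" for n
      unfolding comp_op_translate_funpow[OF \<phi>] by (rule paley_wiener_translate[OF \<sigma> f])
    fix h assume h: "h \<in> paley_wiener \<sigma>" and orth: "\<And>n. pw_inner h ((comp_op \<phi> ^^ n) f) = 0"
    note sh = paley_wienerD(3)[OF h]
    \<comment> \<open>The projection lemma only places p in the large space. The approximating
      sequence is also Cauchy in the complete space of type s j, and the two limits agree
      pointwise.\<close>
    have "\<exists>p\<in>paley_wiener (s j). \<forall>x\<in>paley_wiener (s j). pw_inner (\<lambda>z. h z - p z) x = 0" for j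
    proof -
      have "paley_wiener (s j) \<noteq> {}" using paley_wiener_0 by blast
      then obtain p t where p: "p \<in> paley_wiener \<sigma>" "\<And>n. t n \<in> paley_wiener (s j)" "(\<lambda>n. pw_norm (\<lambda>z. t n z - p z)) \<longlonglongrightarrow> 0"
        "\<And>x. x \<in> paley_wiener (s j) \<Longrightarrow> pw_inner (\<lambda>z. h z - p z) x = 0"
        using paley_wiener_projection[of "paley_wiener (s j)" \<sigma> h thesis] paley_wiener_mono[OF s(2)] \<sigma> h
          paley_wiener_add paley_wiener_scale by (auto simp: subset_iff)
      have cau: "\<exists>N. \<forall>m\<ge>N. \<forall>n\<ge>N. pw_norm (\<lambda>z. t m z - t n z) \<le> e" if e: "e > 0" for e
      proof -
        have "\<forall>\<^sub>F n in sequentially. pw_norm (\<lambda>z. t n z - p z) < e / 2"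
          using e by (intro order_tendstoD(2)[OF p(3)]) simp
        then obtain N where N: "\<And>n. n \<ge> N \<Longrightarrow> pw_norm (\<lambda>z. t n z - p z) < e / 2"
          unfolding eventually_sequentially by blast
        have "pw_norm (\<lambda>z. t m z - t n z) \<le> e" if "m \<ge> N" "n \<ge> N" for m n
          using pw_norm_triangle_diff[OF paley_wienerD(3)[OF p(2)[of m]] paley_wienerD(3)[OF p(1)] paley_wienerD(3)[OF p(2)[of n]]]
            N[OF that(1)] N[OF that(2)] pw_norm_diff_commute[of "t n" p] by linarith
        then show ?thesis by blast
      qed
      obtain q where q: "q \<in> paley_wiener (s j)" "(\<lambda>n. pw_norm (\<lambda>z. t n z - q z)) \<longlonglongrightarrow> 0"
        by (rule paley_wiener_complete[OF p(2) s(1)]) (erule cau, rule that)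
      have "p = q"
      proof
        fix z
        have "(\<lambda>n. t n z) \<longlonglongrightarrow> p z"
          by (rule paley_wiener_tendsto_pointwise[OF paley_wiener_mono[OF s(2) p(2)] p(1) \<sigma> p(3)])
        moreover have "(\<lambda>n. t n z) \<longlonglongrightarrow> q z"
          by (rule paley_wiener_tendsto_pointwise[OF p(2) q(1) s(1) q(2)])
        ultimately show "p z = q z" by (rule LIMSEQ_unique)
      qed
      then show ?thesis using q(1) p(4) by blast
    qed
    then obtain p where p: "\<And>j. p j \<in> paley_wiener (s j)"
      and porth: "\<And>j x. x \<in> paley_wiener (s j) \<Longrightarrow> pw_inner (\<lambda>z. h z - p j z) x = 0" by metis
    have pp: "p j \<in> paley_wiener \<sigma>" for j using p by (rule paley_wiener_mono[OF s(2)])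
    note sp = paley_wienerD(3)[OF pp]
    have hx: "pw_inner h x = pw_inner (p j) x" if "x \<in> paley_wiener (s j)" for j x
      using porth[OF that] sh sp[of j] paley_wienerD(3)[OF that] by (simp add: pw_inner_diff_left)
    have pval: "pw_inner h (rkernel (s j) w) = p j w" for j w
      using hx[OF rkernel_in_paley_wiener[OF s(1)]] reproducing[OF p s(1)] by simp
    have pn: "pw_norm (p j) \<le> pw_norm h" for j
    proof (cases "pw_norm (p j) = 0")
      case False
      have "(pw_norm (p j))\<^sup>2 = cmod (pw_inner h (p j))"
        unfolding hx[OF p] pw_inner_self norm_of_real by simp
      also have "\<dots> \<le> pw_norm h * pw_norm (p j)" by (rule pw_inner_cauchy_schwarz[OF sh sp])
      finally show ?thesis using False pw_norm_ge_0[of "p j"] by (simp add: power2_eq_square)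
    qed simp
    obtain G where G: "G \<in> paley_wiener \<sigma>" and Glim: "(\<lambda>n. pw_norm (\<lambda>z. (\<Sum>j<n. of_real (c j) * p j z) - G z)) \<longlonglongrightarrow> 0"
      by (rule paley_wiener_series[OF pp \<sigma> pn csum]) (use c0 in \<open>auto simp: less_imp_le\<close>)
    have psump: "(\<lambda>z. \<Sum>j<n. of_real (c j) * p j z) \<in> paley_wiener \<sigma>" for n
      by (intro paley_wiener_sum paley_wiener_scale pp)
    have ksump: "(\<lambda>z. \<Sum>j<n. of_real (c j) * k j z) \<in> paley_wiener \<sigma>" for n
      by (intro paley_wiener_sum paley_wiener_scale kp)
    have Gpt: "(\<lambda>n. \<Sum>j<n. of_real (c j) * p j z) \<longlonglongrightarrow> G z" for z
      by (rule paley_wiener_tendsto_pointwise[OF psump G \<sigma> Glim])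
    have inner_sum: "pw_inner x (\<lambda>z. \<Sum>j<n. of_real (c j) * q j z) = (\<Sum>j<n. of_real (c j) * pw_inner x (q j))"
      if "sqi x" "\<And>j. q j \<in> paley_wiener \<sigma>" for x q and n :: nat
    proof (induction n)
      case (Suc n)
      have "sqi (\<lambda>z. \<Sum>j<n. of_real (c j) * q j z)"
        by (rule paley_wienerD(3)[OF paley_wiener_sum[where \<sigma> = \<sigma>]]) (intro paley_wiener_scale that)
      then show ?case
        using Suc that paley_wienerD(3)[OF that(2)[of n]]
        by (simp add: pw_inner_add_right sqi_scale pw_inner_scale_right)
    qed (simp add: pw_inner_def)
    \<comment> \<open>A real shift is isometric, so the series for f may be shifted term by term;
      the pairing of h with a shifted kernel of type s j is a value of p j.\<close>
    have Gzero: "G (of_real (- b) * (of_nat n + 1 / 2)) = 0" for n :: nat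
    proof -
      define t where "t = complex_of_real (real n * b)"
      define v where "v = complex_of_real (- b) * (of_nat n + 1 / 2)"
      have tk: "(\<lambda>z. k j (z + t)) = rkernel (s j) v" for j
        unfolding k_def rkernel_translate
        by (rule arg_cong[of _ _ "rkernel (s j)"]) (simp add: v_def t_def w0_def algebra_simps)
      have nt: "pw_norm (\<lambda>z. g (z + t)) = pw_norm g" for g
        unfolding pw_norm_def t_def
        using lborel_integral_real_affine[of 1 "\<lambda>x. (cmod (g (of_real x)))\<^sup>2" "real n * b"]
        by (simp add: add.commute)
      have "(\<lambda>m. pw_norm (\<lambda>z. (\<Sum>j<m. of_real (c j) * rkernel (s j) v z) - f (z + t))) \<longlonglongrightarrow> 0"
      proof -
        have "pw_norm (\<lambda>z. (\<Sum>j<m. of_real (c j) * rkernel (s j) v z) - f (z + t)) = pw_norm (\<lambda>z. (\<Sum>j<m. of_real (c j) * k j z) - f z)" for m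
          using nt[of "\<lambda>z. (\<Sum>j<m. of_real (c j) * k j z) - f z"] fun_cong[OF tk] by simp
        then show ?thesis using flim by simp
      qed
      moreover have rk: "rkernel (s j) v \<in> paley_wiener \<sigma>" for j
        by (rule paley_wiener_mono[OF s(2) rkernel_in_paley_wiener[OF s(1)]])
      moreover have "sqi (\<lambda>z. \<Sum>j<m. of_real (c j) * rkernel (s j) v z)" for m
        by (rule paley_wienerD(3)[OF paley_wiener_sum[where \<sigma> = \<sigma>]]) (intro paley_wiener_scale rk)
      ultimately have "(\<lambda>m. pw_inner h (\<lambda>z. \<Sum>j<m. of_real (c j) * rkernel (s j) v z)) \<longlonglongrightarrow> pw_inner h (\<lambda>z. f (z + t))"
        by (intro pw_inner_tendsto_right sh paley_wienerD(3)[OF paley_wiener_translate[OF \<sigma> f]])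
      moreover have "pw_inner h (\<lambda>z. f (z + t)) = 0"
        using orth[of n] unfolding comp_op_translate_funpow[OF \<phi>] t_def by simp
      moreover have "pw_inner h (\<lambda>z. \<Sum>j<m. of_real (c j) * rkernel (s j) v z) = (\<Sum>j<m. of_real (c j) * p j v)" for m
        using inner_sum[OF sh, of "\<lambda>j. rkernel (s j) v"] rk by (simp add: pval)
      ultimately have "(\<lambda>m. \<Sum>j<m. of_real (c j) * p j v) \<longlonglongrightarrow> 0" by simp
      then show ?thesis using LIMSEQ_unique[OF Gpt] unfolding v_def by blast
    qed
    define B where "B = sqrt (6 * \<sigma> / pi) * pw_norm h"
    have B0: "B \<ge> 0" unfolding B_def using \<sigma> by simp
    have pbd: "cmod (p j z) \<le> B * exp (s j * \<bar>Im z\<bar>)" for j z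
    proof -
      have "cmod (p j z) \<le> sqrt (6 * s j / pi) * exp (s j * \<bar>Im z\<bar>) * pw_norm (p j)"
        by (rule paley_wiener_pointwise_bound[OF p s(1)])
      also have "\<dots> \<le> sqrt (6 * \<sigma> / pi) * exp (s j * \<bar>Im z\<bar>) * pw_norm h"
        using s(2)[of j] s(1)[of j] pn[of j] \<sigma> by (intro mult_mono real_sqrt_le_mono divide_right_mono) auto
      finally show ?thesis by (simp add: B_def mult_ac)
    qed
    define \<delta> where "\<delta> = (\<lambda>J::nat. pi / real (J + 2))"
    have \<delta>: "0 \<le> \<delta> J" "\<delta> J \<le> pi" for J by (auto simp: \<delta>_def divide_le_eq)
    have \<sigma>b: "\<sigma> * \<bar>b\<bar> \<le> pi" using b(2) \<sigma> by (simp add: pos_le_divide_eq mult.commute)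
    \<comment> \<open>For j \<le> J the type s j \<le> s J leaves the gap \<delta> J. For j > J the
      disc lies in that of radius R j, where the weight c j outweighs all exponential
      growth.\<close>
    have term_bound: "cmod (of_real (c j) * p j (of_real (- b) * w)) \<le> (1 / 2) ^ j * (B * exp ((pi - \<delta> J) * \<bar>Im w\<bar>))"
      if w: "cmod w \<le> real (R J)" for w j J
    proof -
      define Y where "Y = \<bar>Im w\<bar>"
      have Y: "0 \<le> Y" "Y \<le> real (R J)" using w abs_Im_le_cmod[of w] by (auto simp: Y_def)
      have Im: "\<bar>Im (complex_of_real (- b) * w)\<bar> = \<bar>b\<bar> * Y" by (simp add: Y_def abs_mult)
      have "c j * exp (s j * (\<bar>b\<bar> * Y)) \<le> (1 / 2) ^ j * exp ((pi - \<delta> J) * Y)"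
      proof (cases "j \<le> J")
        case True
        have "s j * (\<bar>b\<bar> * Y) \<le> s J * (\<bar>b\<bar> * Y)" using smono[OF True] Y by (intro mult_right_mono) auto
        also have "\<dots> = (1 - 1 / real (J + 2)) * ((\<sigma> * \<bar>b\<bar>) * Y)" by (simp add: s_def mult_ac)
        also have "\<dots> \<le> (1 - 1 / real (J + 2)) * (pi * Y)"
          using \<sigma>b Y by (intro mult_left_mono mult_right_mono) auto
        also have "\<dots> = (pi - \<delta> J) * Y" by (simp add: \<delta>_def algebra_simps)
        finally show ?thesis using cle[of j] c0[of j] by (intro mult_mono) auto
      next
        case False
        then have "real (R J) \<le> real (R j)" using Rmono[of J j] by simp
        then have "pi * Y \<le> pi * real (R j)" using Y by (intro mult_left_mono) auto
        moreover have "s j * (\<bar>b\<bar> * Y) \<le> pi * Y"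
        proof -
          have "s j * \<bar>b\<bar> \<le> \<sigma> * \<bar>b\<bar>" using s(2) by (intro mult_right_mono) auto
          then have "s j * \<bar>b\<bar> * Y \<le> pi * Y" using \<sigma>b Y by (intro mult_right_mono) auto
          then show ?thesis by (simp add: mult.assoc)
        qed
        moreover have "\<delta> J * Y \<le> pi * Y" using \<delta> Y by (intro mult_right_mono) auto
        ultimately have "- (pi * real (R j)) + s j * (\<bar>b\<bar> * Y) \<le> (pi - \<delta> J) * Y"
          unfolding left_diff_distrib by linarith
        then have "exp (- (pi * real (R j))) * exp (s j * (\<bar>b\<bar> * Y)) \<le> exp ((pi - \<delta> J) * Y)"
          by (simp flip: exp_add)
        then show ?thesis unfolding c_def mult.assoc by (intro mult_left_mono) auto
      qed
      then have "c j * (B * exp (s j * (\<bar>b\<bar> * Y))) \<le> (1 / 2) ^ j * (B * exp ((pi - \<delta> J) * Y))"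
        using mult_left_mono[OF _ B0] by (simp add: mult.left_commute[of _ B])
      moreover have "c j * cmod (p j (of_real (- b) * w)) \<le> c j * (B * exp (s j * (\<bar>b\<bar> * Y)))"
        using pbd[of j "of_real (- b) * w"] c0[of j] unfolding Im by (intro mult_left_mono) auto
      ultimately have "c j * cmod (p j (of_real (- b) * w)) \<le> (1 / 2) ^ j * (B * exp ((pi - \<delta> J) * Y))"
        by (rule order_trans[rotated])
      moreover have "\<bar>c j\<bar> = c j" using c0[of j] by simp
      ultimately show ?thesis unfolding norm_mult norm_of_real Y_def by (simp only:)
    qed
    have Gbd: "cmod (G (of_real (- b) * w)) \<le> 2 * B * exp ((pi - \<delta> J) * \<bar>Im w\<bar>)"
      if w: "cmod w \<le> real (R J)" for w J
    proof (rule Lim_bounded)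
      show "(\<lambda>n. cmod (\<Sum>j<n. of_real (c j) * p j (of_real (- b) * w))) \<longlonglongrightarrow> cmod (G (of_real (- b) * w))"
        by (intro tendsto_norm Gpt)
      show "\<forall>n\<ge>0. cmod (\<Sum>j<n. of_real (c j) * p j (of_real (- b) * w)) \<le> 2 * B * exp ((pi - \<delta> J) * \<bar>Im w\<bar>)"
      proof (intro allI impI)
        fix n :: nat
        let ?E = "B * exp ((pi - \<delta> J) * \<bar>Im w\<bar>)"
        have "cmod (\<Sum>j<n. of_real (c j) * p j (of_real (- b) * w)) \<le> (\<Sum>j<n. (1 / 2) ^ j * ?E)"
          by (rule sum_norm_le) (rule term_bound[OF w])
        also have "\<dots> = (\<Sum>j<n. (1 / 2) ^ j) * ?E" by (simp add: sum_distrib_right)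
        also have "\<dots> \<le> 2 * ?E"
        proof (intro mult_right_mono)
          have "(\<Sum>j<n. (1 / 2 :: real) ^ j) \<le> (\<Sum>j. (1 / 2) ^ j)" by (intro sum_le_suminf geo) auto
          then show "(\<Sum>j<n. (1 / 2 :: real) ^ j) \<le> 2" by (simp add: suminf_geometric)
        qed (use B0 in auto)
        finally show "cmod (\<Sum>j<n. of_real (c j) * p j (of_real (- b) * w)) \<le> 2 * B * exp ((pi - \<delta> J) * \<bar>Im w\<bar>)"
          by (simp add: mult.assoc)
      qed
    qed
    have Gz: "G (of_real (- b) * w) = 0" for w
    proof (rule carlson_type[where K = "\<lambda>w. G (of_real (- b) * w)" and u = 1 and \<delta> = \<delta> and R = R
          and C = "2 * B" and M = 0])
      show "(\<lambda>w. G (of_real (- b) * w)) holomorphic_on UNIV"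
        by (intro holomorphic_on_compose_entire[OF paley_wienerD(1)[OF G]] holomorphic_intros)
      show "G (of_real (- b) * (of_nat n + 1 / 2)) = 0" for n by (rule Gzero)
      show "1 \<le> R J" for J by (simp add: R_def)
      have "J \<le> R J" for J
      proof -
        have "J \<le> (J + 2)\<^sup>2" by (simp add: power2_eq_square)
        also have "\<dots> \<le> R J" unfolding R_def by (intro less_imp_le less_exp)
        finally show ?thesis .
      qed
      then show "filterlim (\<lambda>J. real (R J)) at_top sequentially"
        by (intro filterlim_at_top_mono[OF filterlim_real_sequentially]) (auto intro!: always_eventually)
      have "\<delta> J * ln (real (R J)) = pi * ln 2 * real (J + 2)" for J
      proof -
        have "ln (real (R J)) = real ((J + 2)\<^sup>2) * ln 2" unfolding R_def by (simp add: ln_realpow)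
        moreover have "pi / real N * (real (N\<^sup>2) * ln 2) = pi * ln 2 * real N" if "N > 0" for N :: nat
          using that by (simp add: power2_eq_square)
        ultimately show ?thesis by (simp only: \<delta>_def)
      qed
      moreover have "filterlim (\<lambda>J. pi * ln 2 * real (J + 2)) at_top sequentially"
        by (rule filterlim_tendsto_pos_mult_at_top[OF tendsto_const])
           (simp, rule filterlim_compose[OF filterlim_real_sequentially filterlim_add_const_nat_at_top])
      ultimately show "filterlim (\<lambda>J. \<delta> J * ln (real (R J))) at_top sequentially" by simp
      show "cmod (G (of_real (- b) * (1 * z))) \<le> 2 * B * exp (0 * Re z + (pi - \<delta> J) * \<bar>Im (1 * z)\<bar>)"
        if "cmod z \<le> real (R J)" for J z
        using Gbd[OF that] by simp
    qed (use \<delta> in auto)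
    have "G z = 0" for z using Gz[of "z / of_real (- b)"] b(1) by simp
    then have G0: "G = (\<lambda>z. 0)" by (simp add: fun_eq_iff)
    \<comment> \<open>The pairing of h with p j is the squared norm of p j, so the pairing with G is
      a series of nonnegative terms; it vanishes, and all weights are positive.\<close>
    have "pw_norm (p j) = 0" for j
    proof -
      have "(\<lambda>n. pw_inner h (\<lambda>z. \<Sum>j<n. of_real (c j) * p j z)) \<longlonglongrightarrow> pw_inner h G"
        by (rule pw_inner_tendsto_right[OF paley_wienerD(3)[OF psump] paley_wienerD(3)[OF G] sh Glim])
      moreover have "pw_inner h (\<lambda>z. \<Sum>j<n. of_real (c j) * p j z) = of_real (\<Sum>j<n. c j * (pw_norm (p j))\<^sup>2)" for n
        unfolding inner_sum[OF sh pp] hx[OF p] pw_inner_self by simp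
      moreover have "pw_inner h G = 0" unfolding G0 by (simp add: pw_inner_def)
      ultimately have "(\<lambda>n. complex_of_real (\<Sum>j<n. c j * (pw_norm (p j))\<^sup>2)) \<longlonglongrightarrow> of_real 0" by simp
      then have lim: "(\<lambda>n. \<Sum>j<n. c j * (pw_norm (p j))\<^sup>2) \<longlonglongrightarrow> 0" by (simp only: tendsto_of_real_iff)
      have "c j * (pw_norm (p j))\<^sup>2 \<le> 0"
      proof (rule LIMSEQ_le_const[OF lim])
        have "c j * (pw_norm (p j))\<^sup>2 \<le> (\<Sum>i<n. c i * (pw_norm (p i))\<^sup>2)" if "n \<ge> Suc j" for n
          using that c0 by (intro member_le_sum) (auto simp: less_imp_le)
        then show "\<exists>N. \<forall>n\<ge>N. c j * (pw_norm (p j))\<^sup>2 \<le> (\<Sum>i<n. c i * (pw_norm (p i))\<^sup>2)" by blast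
      qed
      then have "(pw_norm (p j))\<^sup>2 \<le> 0" using c0[of j] by (simp add: mult_le_0_iff not_le)
      then show ?thesis by simp
    qed
    then have p0: "p j = (\<lambda>z. 0)" for j by (rule paley_wiener_norm_eq_0[OF p s(1)])
    \<comment> \<open>The kernels at x of the types s j tend in norm to the kernel of type \<sigma>,
      and h is orthogonal to all of them.\<close>
    have "h (of_real x) = 0" for x :: real
    proof -
      define K where "K = rkernel \<sigma> (of_real x)"
      define L where "L = (\<lambda>j. rkernel (s j) (of_real x))"
      have K: "K \<in> paley_wiener \<sigma>" unfolding K_def by (rule rkernel_in_paley_wiener[OF \<sigma>])
      have L: "L j \<in> paley_wiener \<sigma>" for j
        unfolding L_def by (rule paley_wiener_mono[OF s(2) rkernel_in_paley_wiener[OF s(1)]])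
      have "(pw_norm (\<lambda>z. L j z - K z))\<^sup>2 = (1 / pi) * (\<sigma> / real (j + 2))" for j
      proof -
        have "pw_inner (L j) K = of_real (s j / pi)"
          unfolding K_def reproducing[OF L \<sigma>] by (simp add: L_def rkernel_def)
        then have "(pw_norm (\<lambda>z. L j z - K z))\<^sup>2 = s j / pi - 2 * (s j / pi) + \<sigma> / pi"
          unfolding pw_norm_diff_sq[OF paley_wienerD(3)[OF L] paley_wienerD(3)[OF K]]
          unfolding L_def K_def rkernel_norm_real[OF s(1)] rkernel_norm_real[OF \<sigma>] by simp
        also have "\<dots> = (\<sigma> - s j) / pi" by (simp add: diff_divide_distrib)
        also have "\<sigma> - s j = \<sigma> / real (j + 2)" by (simp add: s_def right_diff_distrib)
        finally show ?thesis by simp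
      qed
      moreover have "(\<lambda>j. (1 / pi) * (\<sigma> / real (j + 2))) \<longlonglongrightarrow> (1 / pi) * 0"
        by (intro tendsto_mult tendsto_const LIMSEQ_ignore_initial_segment[OF lim_const_over_n])
      ultimately have "(\<lambda>j. (pw_norm (\<lambda>z. L j z - K z))\<^sup>2) \<longlonglongrightarrow> 0" by simp
      from tendsto_real_sqrt[OF this] have "(\<lambda>j. pw_norm (\<lambda>z. L j z - K z)) \<longlonglongrightarrow> 0" by simp
      then have "(\<lambda>j. pw_inner h (L j)) \<longlonglongrightarrow> pw_inner h K"
        by (intro pw_inner_tendsto_right paley_wienerD(3)[OF L] paley_wienerD(3)[OF K] sh)
      moreover have "pw_inner h (L j) = 0" for j unfolding L_def pval by (simp add: p0)
      ultimately have "pw_inner h K = 0" by (simp add: LIMSEQ_const_iff)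
      then show ?thesis unfolding K_def reproducing[OF h \<sigma>] .
    qed
    then have "pw_norm h = 0" by (simp add: pw_norm_def)
    then show "h = (\<lambda>z. 0)" by (rule paley_wiener_norm_eq_0[OF h \<sigma>])
  qed
qed

section \<open>Operators without cyclic vectors\<close>

lemma pw_supercyclic_imp_cyclic:
  assumes "pw_supercyclic \<sigma> T"
  shows "pw_cyclic \<sigma> T"
proof -
  obtain f where f: "f \<in> paley_wiener \<sigma>" and d: "pw_dense \<sigma> {(\<lambda>z. c * (T ^^ n) f z) | c n. True}"
    using assms unfolding pw_supercyclic_def by blast
  have "{(\<lambda>z. c * (T ^^ n) f z) | c n. True} \<subseteq> cfun.span (range (\<lambda>n. (T ^^ n) f))"
    by (auto intro!: cfun.span_scale[OF cfun.span_base])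
  then have "pw_dense \<sigma> (cfun.span (range (\<lambda>n. (T ^^ n) f)))"
    using d unfolding pw_dense_def by blast
  then show ?thesis using f unfolding pw_cyclic_def by blast
qed

text \<open>The orthogonality of the sampling functions of Shannon's theorem; they are the test
  vectors against density and against supercyclicity.\<close>

lemma rkernel_lattice:
  assumes "\<sigma> > 0"
  shows "rkernel \<sigma> (of_real (real_of_int m * (pi / \<sigma>))) (of_real (real_of_int n * (pi / \<sigma>))) = (if m = n then of_real (\<sigma> / pi) else 0)"
proof -
  have "complex_of_real \<sigma> * (of_real (real_of_int n * (pi / \<sigma>)) - cnj (of_real (real_of_int m * (pi / \<sigma>)))) = of_real (real_of_int (n - m) * pi)"
    using assms by (simp add: field_simps)
  moreover have "csinc (of_real (real_of_int (n - m) * pi)) = (if m = n then 1 else 0)"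
  proof -
    have "sin (complex_of_real (real_of_int (n - m) * pi)) = of_real (sin (real_of_int (n - m) * pi))"
      by (rule sin_of_real)
    also have "sin (real_of_int (n - m) * pi) = 0" unfolding sin_zero_iff_int2 by blast
    finally show ?thesis by (auto simp: csinc_def)
  qed
  ultimately show ?thesis unfolding rkernel_def by simp
qed

text \<open>The values at three points of elements of a two-dimensional space have vanishing determinant.\<close>

lemma not_pw_dense_two_dim:
  assumes \<sigma>: "\<sigma> > 0" and D: "\<And>x. x \<in> D \<Longrightarrow> \<exists>\<alpha> \<beta>. x = (\<lambda>z. \<alpha> * f z + \<beta> * g z)"
  shows "\<not> pw_dense \<sigma> D"
proof
  assume dense: "pw_dense \<sigma> D"
  define w where "w = (\<lambda>i. complex_of_real (real_of_int i * (pi / \<sigma>)))"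
  define e where "e = (\<lambda>i. rkernel \<sigma> (w i))"
  have ep: "e i \<in> paley_wiener \<sigma>" for i unfolding e_def by (rule rkernel_in_paley_wiener[OF \<sigma>])
  have "\<exists>s. (\<forall>n::nat. s n \<in> D) \<and> (\<forall>z. (\<lambda>n. s n z) \<longlonglongrightarrow> e i z)" for i
  proof -
    obtain s where s: "\<And>n. s n \<in> D" "\<And>n. s n \<in> paley_wiener \<sigma>" "(\<lambda>n. pw_norm (\<lambda>z. s n z - e i z)) \<longlonglongrightarrow> 0"
      by (rule pw_denseD[OF dense ep]) (assumption | rule that)+
    then show ?thesis using paley_wiener_tendsto_pointwise[OF s(2) ep \<sigma> s(3)] by blast
  qed
  then obtain s where s: "\<And>i n. s i n \<in> D" and lim: "\<And>i z. (\<lambda>n::nat. s i n z) \<longlonglongrightarrow> e i z" by metis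
  define det where "det = (\<lambda>M :: int \<Rightarrow> int \<Rightarrow> complex.
     M 0 0 * (M 1 1 * M 2 2 - M 1 2 * M 2 1) - M 0 1 * (M 1 0 * M 2 2 - M 1 2 * M 2 0) + M 0 2 * (M 1 0 * M 2 1 - M 1 1 * M 2 0))"
  have "(\<lambda>n. det (\<lambda>i j. s i n (w j))) \<longlonglongrightarrow> det (\<lambda>i j. e i (w j))"
    unfolding det_def by (intro tendsto_intros lim)
  moreover have "det (\<lambda>i j. s i n (w j)) = 0" for n
  proof -
    have "\<forall>i. \<exists>\<alpha> \<beta>. s i n = (\<lambda>z. \<alpha> * f z + \<beta> * g z)" using D[OF s] by blast
    then obtain \<alpha> \<beta> where eq: "\<And>i. s i n = (\<lambda>z. \<alpha> i * f z + \<beta> i * g z)" by metis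
    show ?thesis unfolding det_def eq by (simp add: algebra_simps)
  qed
  moreover have "det (\<lambda>i j. e i (w j)) = of_real ((\<sigma> / pi) ^ 3)"
    unfolding det_def e_def w_def rkernel_lattice[OF \<sigma>] by (simp add: power3_eq_cube mult.assoc)
  ultimately have "complex_of_real ((\<sigma> / pi) ^ 3) = 0" by (simp add: LIMSEQ_const_iff)
  then show False using \<sigma> by simp
qed

lemma not_pw_cyclic_involution:
  assumes \<sigma>: "\<sigma> > 0" and T: "\<And>f. f \<in> paley_wiener \<sigma> \<Longrightarrow> T (T f) = f"
  shows "\<not> pw_cyclic \<sigma> T"
proof
  assume "pw_cyclic \<sigma> T"
  then obtain f where f: "f \<in> paley_wiener \<sigma>" and d: "pw_dense \<sigma> (cfun.span (range (\<lambda>n. (T ^^ n) f)))"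
    unfolding pw_cyclic_def by blast
  have orb: "(T ^^ n) f \<in> {f, T f}" for n
    by (induction n) (use T[OF f] in auto)
  let ?W = "{x. \<exists>\<alpha> \<beta>. x = (\<lambda>z. \<alpha> * f z + \<beta> * T f z)}"
  have "cfun.span (range (\<lambda>n. (T ^^ n) f)) \<subseteq> ?W"
  proof (rule cfun.span_minimal)
    have "f = (\<lambda>z. 1 * f z + 0 * T f z)" "T f = (\<lambda>z. 0 * f z + 1 * T f z)" by simp_all
    then have "f \<in> ?W" "T f \<in> ?W" by blast+
    then have "{f, T f} \<subseteq> ?W" by (simp only: insert_subset empty_subsetI simp_thms)
    then show "range (\<lambda>n. (T ^^ n) f) \<subseteq> ?W" using orb by (intro image_subsetI) (rule subsetD)
    show "cfun.subspace ?W" unfolding cfun.subspace_def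
    proof (intro conjI ballI allI)
      have "(0 :: complex \<Rightarrow> complex) = (\<lambda>z. 0 * f z + 0 * T f z)" by (simp add: fun_eq_iff)
      then show "0 \<in> ?W" by blast
    next
      fix x y assume "x \<in> ?W" "y \<in> ?W"
      then obtain \<alpha> \<beta> \<alpha>' \<beta>' where "x = (\<lambda>z. \<alpha> * f z + \<beta> * T f z)" "y = (\<lambda>z. \<alpha>' * f z + \<beta>' * T f z)" by blast
      then have "x + y = (\<lambda>z. (\<alpha> + \<alpha>') * f z + (\<beta> + \<beta>') * T f z)" by (simp add: fun_eq_iff algebra_simps)
      then show "x + y \<in> ?W" by blast
    next
      fix c x assume "x \<in> ?W"
      then obtain \<alpha> \<beta> where "x = (\<lambda>z. \<alpha> * f z + \<beta> * T f z)" by blast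
      then have "(\<lambda>z. c * x z) = (\<lambda>z. (c * \<alpha>) * f z + (c * \<beta>) * T f z)" by (simp add: fun_eq_iff algebra_simps)
      then show "(\<lambda>z. c * x z) \<in> ?W" by blast
    qed
  qed
  then show False using not_pw_dense_two_dim[OF \<sigma>, of _ f "T f"] d by blast
qed

text \<open>For \<open>\<bar>a\<bar> < 1\<close> the span of an orbit consists of multiples of \<open>f\<close> plus functions of type \<open>\<bar>a\<bar> \<sigma>\<close>,
  whereas the functionals \<open>x w - \<langle>x, K\<^sub>w\<rangle>\<close>, \<open>K\<^sub>w\<close> the kernel of type \<open>\<bar>a\<bar> \<sigma>\<close>, annihilate the latter.\<close>

lemma not_pw_cyclic_contraction:
  assumes \<sigma>: "\<sigma> > 0" and a: "0 < \<bar>a\<bar>" "\<bar>a\<bar> < 1" and \<phi>: "\<phi> = (\<lambda>z. complex_of_real a * z + b)"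
  shows "\<not> pw_cyclic \<sigma> (comp_op \<phi>)"
proof
  assume "pw_cyclic \<sigma> (comp_op \<phi>)"
  then obtain f where f: "f \<in> paley_wiener \<sigma>" and d: "pw_dense \<sigma> (cfun.span (range (\<lambda>n. (comp_op \<phi> ^^ n) f)))"
    unfolding pw_cyclic_def by blast
  define \<tau> where "\<tau> = \<bar>a\<bar> * \<sigma>"
  have \<tau>: "\<tau> > 0" "\<tau> < \<sigma>" using a \<sigma> by (auto simp: \<tau>_def)
  \<comment> \<open>Square integrability of g is not recorded; \<open>lW\<close> recovers it from
    that of x and f.\<close>
  let ?W = "{x. \<exists>\<alpha> g. x = (\<lambda>z. \<alpha> * f z + g z) \<and> g holomorphic_on UNIV \<and> exponential_type_le \<tau> g}"
  have low: "(comp_op \<phi> ^^ Suc n) f holomorphic_on UNIV \<and> exponential_type_le \<tau> ((comp_op \<phi> ^^ Suc n) f)" for n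
  proof (induction n)
    case 0
    then show ?case
      using exponential_type_le_affine[OF paley_wienerD(2)[OF f], of a \<tau> b] a \<sigma>
      by (auto simp: comp_op_def \<phi> o_def \<tau>_def intro!: holomorphic_on_compose_entire[OF paley_wienerD(1)[OF f]] holomorphic_intros)
  next
    case (Suc n)
    have "\<bar>a\<bar> * \<tau> \<le> 1 * \<tau>" using a \<tau> by (intro mult_right_mono) auto
    then have "exponential_type_le \<tau> (\<lambda>z. (comp_op \<phi> ^^ Suc n) f (of_real a * z + b))"
      using exponential_type_le_affine[OF conjunct2[OF Suc], of a \<tau> b] a \<tau> by simp
    moreover have "(\<lambda>z. (comp_op \<phi> ^^ Suc n) f (of_real a * z + b)) holomorphic_on UNIV"
      by (intro holomorphic_on_compose_entire[OF conjunct1[OF Suc]] holomorphic_intros)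
    moreover have "(comp_op \<phi> ^^ Suc (Suc n)) f = (\<lambda>z. (comp_op \<phi> ^^ Suc n) f (of_real a * z + b))"
      unfolding funpow.simps(2)[of "Suc n"] o_apply by (simp only: comp_op_def \<phi> o_def)
    ultimately show ?case by (simp only:)
  qed
  have span: "cfun.span (range (\<lambda>n. (comp_op \<phi> ^^ n) f)) \<subseteq> ?W"
  proof (rule cfun.span_minimal)
    have zero: "(\<lambda>z::complex. 0 :: complex) holomorphic_on UNIV \<and> exponential_type_le \<tau> (\<lambda>z. 0)"
      using paley_wienerD(1,2)[OF paley_wiener_0] by blast
    have "(comp_op \<phi> ^^ n) f \<in> ?W" for n
    proof (cases n)
      case 0
      have "f \<in> ?W" unfolding mem_Collect_eq
        by (rule exI[of _ 1], rule exI[of _ "\<lambda>z. 0"]) (use zero in \<open>simp add: fun_eq_iff\<close>)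
      then show ?thesis unfolding 0 funpow_0 .
    next
      case (Suc m)
      have "(comp_op \<phi> ^^ n) f = (\<lambda>z. 0 * f z + (comp_op \<phi> ^^ n) f z)" by simp
      then show ?thesis using low[of m] Suc by blast
    qed
    then show "range (\<lambda>n. (comp_op \<phi> ^^ n) f) \<subseteq> ?W" by blast
    show "cfun.subspace ?W" unfolding cfun.subspace_def
    proof (intro conjI ballI allI)
      show "0 \<in> ?W" unfolding mem_Collect_eq
        by (rule exI[of _ 0], rule exI[of _ "\<lambda>z. 0"]) (use zero in \<open>simp add: fun_eq_iff\<close>)
    next
      fix x y assume "x \<in> ?W" "y \<in> ?W"
      then obtain \<alpha> g \<alpha>' g' where *: "x = (\<lambda>z. \<alpha> * f z + g z)" "y = (\<lambda>z. \<alpha>' * f z + g' z)"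
        "g holomorphic_on UNIV" "exponential_type_le \<tau> g" "g' holomorphic_on UNIV" "exponential_type_le \<tau> g'" by blast
      then have "x + y = (\<lambda>z. (\<alpha> + \<alpha>') * f z + (g z + g' z))" by (simp add: fun_eq_iff algebra_simps)
      moreover have "(\<lambda>z. g z + g' z) holomorphic_on UNIV" "exponential_type_le \<tau> (\<lambda>z. g z + g' z)"
        using * by (auto intro: holomorphic_on_add exponential_type_le_add)
      ultimately show "x + y \<in> ?W" unfolding mem_Collect_eq
        by (intro exI[of _ "\<alpha> + \<alpha>'"] exI[of _ "\<lambda>z. g z + g' z"] conjI)
    next
      fix c x assume "x \<in> ?W"
      then obtain \<alpha> g where *: "x = (\<lambda>z. \<alpha> * f z + g z)" "g holomorphic_on UNIV" "exponential_type_le \<tau> g" by blast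
      then have "(\<lambda>z. c * x z) = (\<lambda>z. (c * \<alpha>) * f z + c * g z)" by (simp add: fun_eq_iff algebra_simps)
      moreover have "(\<lambda>z. c * g z) holomorphic_on UNIV" "exponential_type_le \<tau> (\<lambda>z. c * g z)"
        using * by (auto intro: holomorphic_intros exponential_type_le_scale)
      ultimately show "(\<lambda>z. c * x z) \<in> ?W" unfolding mem_Collect_eq
        by (intro exI[of _ "c * \<alpha>"] exI[of _ "\<lambda>z. c * g z"] conjI)
    qed
  qed
  define l where "l = (\<lambda>w x. x w - pw_inner x (rkernel \<tau> w))"
  have lW: "\<exists>\<alpha>. \<forall>w. l w x = \<alpha> * l w f" if x: "x \<in> ?W" "x \<in> paley_wiener \<sigma>" for x
  proof -
    obtain \<alpha> g where g: "x = (\<lambda>z. \<alpha> * f z + g z)" "g holomorphic_on UNIV" "exponential_type_le \<tau> g" using x(1) by blast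
    have "sqi (\<lambda>z. x z - \<alpha> * f z)" by (intro sqi_diff sqi_scale paley_wienerD(3)[OF x(2)] paley_wienerD(3)[OF f])
    then have gp: "g \<in> paley_wiener \<tau>" using g by (intro paley_wienerI) auto
    have "l w x = \<alpha> * l w f" for w
    proof -
      have "pw_inner x (rkernel \<tau> w) = \<alpha> * pw_inner f (rkernel \<tau> w) + g w"
        unfolding g(1) using paley_wienerD(3)[OF f] paley_wienerD(3)[OF gp] sqi_rkernel[OF \<tau>(1)] reproducing[OF gp \<tau>(1)]
        by (simp add: pw_inner_add_left sqi_scale pw_inner_scale_left)
      then show ?thesis by (simp add: l_def g(1) algebra_simps)
    qed
    then show ?thesis by blast
  qed
  have llim: "(\<lambda>n. l w (s n)) \<longlonglongrightarrow> l w x"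
    if "\<And>n. s n \<in> paley_wiener \<sigma>" "x \<in> paley_wiener \<sigma>" "(\<lambda>n. pw_norm (\<lambda>z. s n z - x z)) \<longlonglongrightarrow> 0" for w s x
    unfolding l_def
    by (intro tendsto_diff paley_wiener_tendsto_pointwise[OF that(1,2) \<sigma> that(3)]
        pw_inner_tendsto_left[OF paley_wienerD(3)[OF that(1)] paley_wienerD(3)[OF that(2)] sqi_rkernel[OF \<tau>(1)] that(3)])
  \<comment> \<open>For this v one has \<sigma> v = \<pi> - \<tau> v, so the sines of \<sigma> v and
    \<tau> v agree and an off-diagonal entry of the determinant below vanishes.\<close>
  define v where "v = complex_of_real (pi / (\<sigma> + \<tau>))"
  have kp: "rkernel \<sigma> w \<in> paley_wiener \<sigma>" for w by (rule rkernel_in_paley_wiener[OF \<sigma>])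
  obtain s where s0: "\<And>n. s n \<in> cfun.span (range (\<lambda>n. (comp_op \<phi> ^^ n) f))"
    and s: "\<And>n. s n \<in> paley_wiener \<sigma>" "(\<lambda>n. pw_norm (\<lambda>z. s n z - rkernel \<sigma> 0 z)) \<longlonglongrightarrow> 0"
    by (rule pw_denseD[OF d kp[of 0]]) (assumption | rule that)+
  obtain t where t0: "\<And>n. t n \<in> cfun.span (range (\<lambda>n. (comp_op \<phi> ^^ n) f))"
    and t: "\<And>n. t n \<in> paley_wiener \<sigma>" "(\<lambda>n. pw_norm (\<lambda>z. t n z - rkernel \<sigma> v z)) \<longlonglongrightarrow> 0"
    by (rule pw_denseD[OF d kp[of v]]) (assumption | rule that)+
  \<comment> \<open>On elements of the span lying in the space, the pair of functionals at 0 and v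
    takes values proportional to its value at f, so the 2 by 2 determinants vanish, also in the
    limit.\<close>
  have "(\<lambda>n. l 0 (s n) * l v (t n) - l v (s n) * l 0 (t n)) \<longlonglongrightarrow>
      l 0 (rkernel \<sigma> 0) * l v (rkernel \<sigma> v) - l v (rkernel \<sigma> 0) * l 0 (rkernel \<sigma> v)"
    by (intro tendsto_intros llim s t kp)
  moreover have "l 0 (s n) * l v (t n) - l v (s n) * l 0 (t n) = 0" for n
  proof -
    obtain \<alpha> \<beta> where "\<forall>w. l w (s n) = \<alpha> * l w f" "\<forall>w. l w (t n) = \<beta> * l w f"
      using lW[OF subsetD[OF span s0] s(1)] lW[OF subsetD[OF span t0] t(1)] by meson
    then show ?thesis by simp
  qed
  ultimately have det: "l 0 (rkernel \<sigma> 0) * l v (rkernel \<sigma> v) - l v (rkernel \<sigma> 0) * l 0 (rkernel \<sigma> v) = 0"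
    by (simp add: LIMSEQ_const_iff)
  have lk: "l w (rkernel \<sigma> u) = rkernel \<sigma> u w - cnj (rkernel \<tau> w u)" for w u
    unfolding l_def pw_inner_commute[of "rkernel \<sigma> u"]
    using reproducing[OF paley_wiener_mono[OF less_imp_le[OF \<tau>(2)] rkernel_in_paley_wiener[OF \<tau>(1)]] \<sigma>] by simp
  have v0: "v \<noteq> 0" unfolding v_def of_real_eq_0_iff using \<tau> \<sigma> by simp
  have diag: "l u (rkernel \<sigma> u) = of_real ((\<sigma> - \<tau>) / pi)" if "cnj u = u" for u
    unfolding lk by (simp add: rkernel_def that diff_divide_distrib)
  have eq: "of_real \<sigma> * v = of_real pi - of_real \<tau> * v"
  proof -
    define q where "q = pi / (\<sigma> + \<tau>)"
    have "(\<sigma> + \<tau>) * q = pi" unfolding q_def using \<tau> \<sigma> by simp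
    then have "\<sigma> * q = pi - \<tau> * q" unfolding distrib_right by linarith
    then have "complex_of_real (\<sigma> * q) = of_real (pi - \<tau> * q)" by (rule arg_cong)
    then show ?thesis unfolding v_def q_def[symmetric] by simp
  qed
  have "v * (of_real (\<sigma> / pi) * csinc (of_real \<sigma> * v) - of_real (\<tau> / pi) * csinc (of_real \<tau> * v))
      = (sin (of_real \<sigma> * v) - sin (of_real \<tau> * v)) / of_real pi"
    unfolding mult_csinc[symmetric] by (simp add: diff_divide_distrib algebra_simps)
  also have "sin (of_real \<sigma> * v) = sin (of_real \<tau> * v)" unfolding eq by (simp add: sin_diff)
  finally have "of_real (\<sigma> / pi) * csinc (of_real \<sigma> * v) = of_real (\<tau> / pi) * csinc (of_real \<tau> * v)" using v0 by simp
  moreover have "cnj v = v" by (simp add: v_def)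
  ultimately have "l v (rkernel \<sigma> 0) = 0" unfolding lk by (simp add: rkernel_def)
  then have "complex_of_real ((\<sigma> - \<tau>) / pi) * of_real ((\<sigma> - \<tau>) / pi) = 0"
    using det diag[of 0] diag[of v] by (simp add: v_def)
  then show False using \<tau> by simp
qed

lemma pw_inner_translate_real:
  "pw_inner (\<lambda>z. f (z + of_real r)) (\<lambda>z. g (z + of_real r)) = pw_inner f g"
  unfolding pw_inner_def
  using lborel_integral_real_affine[of 1 "\<lambda>t. f (of_real t) * cnj (g (of_real t))" r]
  by (simp add: add.commute)

lemma pw_norm_translate_real: "pw_norm (\<lambda>z. f (z + of_real r)) = pw_norm f"
  unfolding pw_norm_def
  using lborel_integral_real_affine[of 1 "\<lambda>t. (cmod (f (of_real t)))\<^sup>2" r]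
  by (simp add: add.commute)

text \<open>With \<open>p = 2 \<pi> / b\<close>, the substitution of \<open>- t - n b\<close> for \<open>t\<close> turns \<open>\<integral> sin (p t) f(t + n b) f(-t) dt\<close> into its
  negative. If \<open>f\<close> is cyclic, \<open>\<integral> sin (p t) x(t) y(-t) dt\<close> therefore vanishes for all \<open>x\<close>, \<open>y\<close> in the space.\<close>

lemma not_pw_cyclic_translate_large:
  assumes \<sigma>: "\<sigma> > 0" and b: "\<bar>b\<bar> > pi / \<sigma>" and \<phi>: "\<phi> = (\<lambda>z. z + complex_of_real b)"
  shows "\<not> pw_cyclic \<sigma> (comp_op \<phi>)"
proof
  assume "pw_cyclic \<sigma> (comp_op \<phi>)"
  then obtain f where f: "f \<in> paley_wiener \<sigma>" and d: "pw_dense \<sigma> (cfun.span (range (\<lambda>n. (comp_op \<phi> ^^ n) f)))"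
    unfolding pw_cyclic_def by blast
  have b0: "b \<noteq> 0" using b divide_pos_pos[OF pi_gt_zero \<sigma>] by auto
  define p where "p = 2 * pi / b"
  have p0: "p \<noteq> 0" using b0 by (simp add: p_def)
  have pb: "p * (real n * b) = real n * (2 * pi)" for n using b0 by (simp add: p_def)
  have p\<sigma>: "\<bar>p\<bar> / 2 < \<sigma>"
  proof -
    have "pi < \<bar>b\<bar> * \<sigma>" using b \<sigma> by (simp add: pos_divide_less_eq)
    then show ?thesis using b0 by (simp add: p_def abs_mult pos_divide_less_eq mult.commute)
  qed
  have orb: "(comp_op \<phi> ^^ n) f = (\<lambda>z. f (z + of_real (real n * b)))" for n
    unfolding comp_op_translate_funpow[OF \<phi>] by simp
  have orbp: "(comp_op \<phi> ^^ n) f \<in> paley_wiener \<sigma>" for n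
    unfolding orb by (rule paley_wiener_translate[OF \<sigma> f])
  \<comment> \<open>The functional is represented by a square integrable m outside the space in
    general, because \<open>M y\<close> below is not holomorphic.\<close>
  have total: "pw_inner x m = 0"
    if m: "sqi m" and z: "\<And>n. pw_inner ((comp_op \<phi> ^^ n) f) m = 0" and x: "x \<in> paley_wiener \<sigma>" for m x
  proof -
    let ?Z = "{x. x \<in> paley_wiener \<sigma> \<and> pw_inner x m = 0}"
    have "cfun.span (range (\<lambda>n. (comp_op \<phi> ^^ n) f)) \<subseteq> ?Z"
    proof (rule cfun.span_minimal)
      show "range (\<lambda>n. (comp_op \<phi> ^^ n) f) \<subseteq> ?Z" using orbp z by blast
      show "cfun.subspace ?Z" unfolding cfun.subspace_def zero_fun_def plus_fun_def
        using m by (auto intro: paley_wiener_0 paley_wiener_add paley_wiener_scale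
            simp: pw_inner_add_left pw_inner_scale_left paley_wienerD(3) pw_inner_def[of "\<lambda>x. 0"])
    qed
    moreover obtain s where s: "\<And>n. s n \<in> cfun.span (range (\<lambda>n. (comp_op \<phi> ^^ n) f))" "\<And>n. s n \<in> paley_wiener \<sigma>"
      "(\<lambda>n. pw_norm (\<lambda>z. s n z - x z)) \<longlonglongrightarrow> 0" by (rule pw_denseD[OF d x]) (assumption | rule that)+
    ultimately have "pw_inner (s n) m = 0" for n by blast
    moreover have "(\<lambda>n. pw_inner (s n) m) \<longlonglongrightarrow> pw_inner x m"
      by (rule pw_inner_tendsto_left[OF paley_wienerD(3)[OF s(2)] paley_wienerD(3)[OF x] m s(3)])
    ultimately show ?thesis by (simp add: LIMSEQ_const_iff)
  qed
  \<comment> \<open>The conjugation cancels that of the inner product, so pairing with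
    \<open>M y\<close> gives a form bilinear in x and y.\<close>
  define M where "M = (\<lambda>y z. complex_of_real (sin (p * Re z)) * cnj (y (- z)))"
  have sqiM: "sqi (M y)" if y: "sqi y" for y
  proof -
    have "sqi (\<lambda>z. cnj (y (- z)))"
    proof (rule sqi_cnj)
      have "(\<lambda>t::real. y (of_real (- t))) \<in> borel_measurable borel"
        using measurable_compose[OF borel_measurable_uminus[OF measurable_ident] sqiD(1)[OF y]] by simp
      then show "sqi (\<lambda>z. y (- z))" unfolding sqi_def
        using lborel_integrable_real_affine[OF sqiD(2)[OF y], of "-1" 0] by simp
    qed
    then show ?thesis unfolding M_def
      by (rule sqi_mult_bounded[where B = 1]) auto
  qed
  have inner: "pw_inner x (M y) = (LINT t|lborel. of_real (sin (p * t)) * (x (of_real t) * y (- of_real t)))" for x y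
    unfolding pw_inner_def M_def by (simp add: mult_ac)
  have anti: "pw_inner x (M y) = - pw_inner y (M x)" for x y
    unfolding inner
    using lborel_integral_real_affine[of "-1" "\<lambda>t. of_real (sin (p * t)) * (x (of_real t) * y (- of_real t))" 0]
    by (simp add: mult_ac)
  have shift: "pw_inner (\<lambda>z. x (z + of_real (real n * b))) (M y) = pw_inner x (M (\<lambda>z. y (z + of_real (real n * b))))" for x y n
  proof -
    have "cos (real n * (2 * pi)) = 1" "sin (real n * (2 * pi)) = 0"
      using cos_int_2pin[of "int n"] sin_int_2pin[of "int n"] by (simp_all add: mult_ac)
    then have "sin (p * (t + real n * b)) = sin (p * t)" for t
      unfolding distrib_left pb by (simp add: sin_add)
    moreover have "- complex_of_real (t + real n * b) + of_real (real n * b) = - of_real t" for t by simp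
    ultimately show ?thesis unfolding inner
      using lborel_integral_real_affine[of 1 "\<lambda>t. of_real (sin (p * t)) * (x (of_real t) * y (- of_real t + of_real (real n * b)))" "real n * b"]
      by (simp add: add.commute)
  qed
  note sf = paley_wienerD(3)[OF f]
  \<comment> \<open>Density is used twice: here for the first argument, with f in the second, and
    then, after shifting and exchanging the arguments, for an arbitrary second argument.\<close>
  have 1: "pw_inner x (M f) = 0" if "x \<in> paley_wiener \<sigma>" for x
  proof (rule total[OF sqiM[OF sf] _ that])
    fix n
    have "pw_inner (\<lambda>z. f (z + of_real (real n * b))) (M f) = - pw_inner (\<lambda>z. f (z + of_real (real n * b))) (M f)"
      using shift[of f n f] anti[of f] by metis
    then show "pw_inner ((comp_op \<phi> ^^ n) f) (M f) = 0" unfolding orb by simp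
  qed
  have 2: "pw_inner x (M y) = 0" if x: "x \<in> paley_wiener \<sigma>" and y: "y \<in> paley_wiener \<sigma>" for x y
  proof (rule total[OF sqiM[OF paley_wienerD(3)[OF y]] _ x])
    fix n
    have "pw_inner ((comp_op \<phi> ^^ n) f) (M y) = pw_inner f (M (\<lambda>z. y (z + of_real (real n * b))))"
      unfolding orb by (rule shift)
    also have "\<dots> = - pw_inner (\<lambda>z. y (z + of_real (real n * b))) (M f)" by (rule anti)
    also have "\<dots> = 0" using 1[OF paley_wiener_translate[OF \<sigma> y]] by simp
    finally show "pw_inner ((comp_op \<phi> ^^ n) f) (M y) = 0" .
  qed
  \<comment> \<open>The test functions X and Y have frequencies -p / 2 and p / 2 and a profile u of
    type 2 \<epsilon>, so their type is exactly \<sigma>. There is room for this since \<bar>p\<bar>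
    / 2 < \<sigma>, that is \<bar>b\<bar> > \<pi> / \<sigma>.\<close>
  define \<epsilon> where "\<epsilon> = (\<sigma> - \<bar>p\<bar> / 2) / 2"
  have \<epsilon>: "\<epsilon> > 0" "\<bar>p\<bar> / 2 + 2 * \<epsilon> = \<sigma>" using p\<sigma> by (auto simp: \<epsilon>_def field_simps)
  define u where "u = (\<lambda>z. (csinc (of_real \<epsilon> * z))\<^sup>2)"
  have holu: "u holomorphic_on UNIV" unfolding u_def by (intro holomorphic_intros)
  have ubd: "cmod (u z) \<le> 36 * exp (2 * \<epsilon> * cmod z)" for z
  proof -
    have "cmod (csinc (of_real \<epsilon> * z)) \<le> 6 * exp \<bar>Im (of_real \<epsilon> * z)\<bar> / (1 + cmod (of_real \<epsilon> * z))" by (rule cmod_csinc_le)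
    also have "\<dots> \<le> 6 * exp \<bar>Im (of_real \<epsilon> * z)\<bar> / 1" by (intro divide_left_mono) (auto simp: add_pos_nonneg)
    also have "\<dots> \<le> 6 * exp (\<epsilon> * cmod z)"
      using \<epsilon> abs_Im_le_cmod[of z] by (simp add: abs_mult)
    finally have "(cmod (csinc (of_real \<epsilon> * z)))\<^sup>2 \<le> (6 * exp (\<epsilon> * cmod z))\<^sup>2" by (intro power_mono) auto
    then show ?thesis unfolding u_def norm_power by (simp add: power_mult_distrib exp_double[symmetric] mult.assoc)
  qed
  have squ: "sqi u"
    unfolding u_def power2_eq_square
    using sqi_mult_bounded[OF sqi_csinc_shift[OF \<epsilon>(1), of 0] sqiD(1)[OF sqi_csinc_shift[OF \<epsilon>(1), of 0]], of 1]
      cmod_csinc_real_le_1 by (simp flip: of_real_mult)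
  have mult_u: "(\<lambda>z. m z * u z) \<in> paley_wiener (r + 2 * \<epsilon>)"
    if m: "m holomorphic_on UNIV" "\<And>z. cmod (m z) \<le> exp (r * cmod z)" "\<And>t::real. cmod (m (of_real t)) \<le> 1" for m r
  proof (rule paley_wienerI)
    show "(\<lambda>z. m z * u z) holomorphic_on UNIV" by (intro holomorphic_intros m holu)
    show "sqi (\<lambda>z. m z * u z)"
      by (rule sqi_mult_bounded[OF squ borel_measurable_entire[OF m(1)] m(3)])
    have "cmod (m z * u z) \<le> 36 * exp ((r + 2 * \<epsilon>) * cmod z)" for z
    proof -
      have "cmod (m z * u z) \<le> exp (r * cmod z) * (36 * exp (2 * \<epsilon> * cmod z))"
        unfolding norm_mult using m(2) ubd by (intro mult_mono) auto
      then show ?thesis by (simp only: distrib_right exp_add mult.left_commute)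
    qed
    then show "exponential_type_le (r + 2 * \<epsilon>) (\<lambda>z. m z * u z)" by (rule exponential_type_leI)
  qed
  have ex: "(\<lambda>z. exp (\<i> * of_real q * z) * u z) \<in> paley_wiener (\<bar>q\<bar> + 2 * \<epsilon>)" for q :: real
  proof (rule mult_u)
    show "(\<lambda>z. exp (\<i> * of_real q * z)) holomorphic_on UNIV" by (intro holomorphic_intros)
    fix z
    have "- (q * Im z) \<le> \<bar>q\<bar> * cmod z"
      using abs_ge_self[of "- (q * Im z)"] mult_left_mono[OF abs_Im_le_cmod[of z], of "\<bar>q\<bar>"] by (simp add: abs_mult)
    then show "cmod (exp (\<i> * of_real q * z)) \<le> exp (\<bar>q\<bar> * cmod z)" by simp
  qed simp
  define v where "v = (\<lambda>z. sin (of_real p * z) * u z)"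
  have v: "v \<in> paley_wiener (\<bar>p\<bar> + 2 * \<epsilon>)" unfolding v_def
  proof (rule mult_u)
    show "(\<lambda>z. sin (of_real p * z)) holomorphic_on UNIV" by (intro holomorphic_intros)
    fix z
    have "cmod (sin (of_real p * z)) \<le> exp \<bar>Im (of_real p * z)\<bar>" by (rule cmod_sin_le)
    also have "\<dots> \<le> exp (\<bar>p\<bar> * cmod z)" using abs_Im_le_cmod[of z] by (simp add: abs_mult mult_left_mono)
    finally show "cmod (sin (of_real p * z)) \<le> exp (\<bar>p\<bar> * cmod z)" .
    fix t :: real
    have "cmod (sin (of_real p * of_real t)) = \<bar>sin (p * t)\<bar>"
      by (metis norm_of_real of_real_mult sin_of_real)
    then show "cmod (sin (of_real p * of_real t)) \<le> 1" by simp
  qed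
  define X where "X = (\<lambda>z. exp (\<i> * of_real (- p / 2) * z) * u z)"
  define Y where "Y = (\<lambda>z. exp (\<i> * of_real (p / 2) * z) * u z)"
  have X: "X \<in> paley_wiener \<sigma>" unfolding X_def using ex[of "- p / 2"] \<epsilon>(2) by (simp add: abs_divide)
  have Y: "Y \<in> paley_wiener \<sigma>" unfolding Y_def using ex[of "p / 2"] \<epsilon>(2) by (simp add: abs_divide)
  have ureal: "\<exists>r. u (of_real t) = of_real r" for t :: real
    unfolding u_def by (rule exI[of _ "(Re (csinc (of_real (\<epsilon> * t))))\<^sup>2"])
      (simp add: csinc_def flip: sin_of_real of_real_mult of_real_divide)
  \<comment> \<open>The product of X at t and Y at -t is exp (- \<i> p t) times the square of u, so
    the imaginary part of the integrand is minus a square and cannot cancel under the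
    integral.\<close>
  have point: "Im (of_real (sin (p * t)) * (X (of_real t) * Y (- of_real t))) = - (cmod (v (of_real t)))\<^sup>2" for t :: real
  proof -
    obtain r where r: "u (of_real t) = of_real r" using ureal by blast
    have um: "u (- of_real t) = of_real r" using r by (simp add: u_def)
    have "exp (\<i> * of_real (- p / 2) * of_real t) * exp (\<i> * of_real (p / 2) * - of_real t) = cis (- (p * t))"
      by (simp add: cis_conv_exp flip: exp_add)
    then have "X (of_real t) * Y (- of_real t) = cis (- (p * t)) * of_real (r * r)"
      unfolding X_def Y_def r um by (simp add: mult_ac)
    then have "Im (of_real (sin (p * t)) * (X (of_real t) * Y (- of_real t))) = - (sin (p * t) * sin (p * t) * (r * r))"
      by (simp add: Im_complex_of_real del: of_real_mult)
    moreover have "v (of_real t) = of_real (sin (p * t) * r)"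
      unfolding v_def r by (simp flip: sin_of_real)
    then have "(cmod (v (of_real t)))\<^sup>2 = sin (p * t) * sin (p * t) * (r * r)"
      by (simp only: norm_of_real power2_abs) (simp add: power2_eq_square)
    ultimately show ?thesis by simp
  qed
  have int: "integrable lborel (\<lambda>t. of_real (sin (p * t)) * (X (of_real t) * Y (- of_real t)))"
    using integrable_sqi_inner[OF paley_wienerD(3)[OF X] sqiM[OF paley_wienerD(3)[OF Y]]] by (simp add: M_def mult_ac)
  have "0 = Im (pw_inner X (M Y))" using 2[OF X Y] by simp
  also have "\<dots> = - (pw_norm v)\<^sup>2"
    unfolding inner pw_norm_sq using integral_Im[OF int] by (simp only: point Bochner_Integration.integral_minus)
  finally have "pw_norm v = 0" by simp
  then have "v = (\<lambda>z. 0)" using paley_wiener_norm_eq_0[OF v] \<epsilon> by simp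
  then have "v \<i> = 0" by simp
  moreover have nz: "sin (of_real q * \<i>) \<noteq> 0" if "q \<noteq> 0" for q :: real
    using that unfolding sin_eq_0 by (auto simp: complex_eq_iff)
  moreover have "csinc (of_real \<epsilon> * \<i>) \<noteq> 0" using nz[of \<epsilon>] \<epsilon> by (simp add: csinc_def)
  ultimately show False using p0 by (simp add: v_def u_def)
qed

section \<open>Adjoints and supercyclicity\<close>

lemma pw_cyclic_adjoint_contraction:
  assumes \<sigma>: "\<sigma> > 0" and a: "0 < \<bar>a\<bar>" "\<bar>a\<bar> < 1" and \<phi>: "\<phi> = (\<lambda>z. complex_of_real a * z + b)"
  shows "pw_cyclic \<sigma> (pw_adjoint \<sigma> (comp_op \<phi>))"
proof -
  have comp: "comp_op \<phi> f \<in> paley_wiener \<sigma>" if f: "f \<in> paley_wiener \<sigma>" for f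
  proof (rule paley_wienerI)
    have eq: "comp_op \<phi> f = (\<lambda>z. f (of_real a * z + b))" by (simp add: comp_op_def \<phi> o_def)
    show hol: "comp_op \<phi> f holomorphic_on UNIV" unfolding eq
      by (intro holomorphic_on_compose_entire[OF paley_wienerD(1)[OF f]] holomorphic_intros)
    have "\<bar>a\<bar> * \<sigma> \<le> \<sigma>" using a \<sigma> by (simp add: mult_le_cancel_right1)
    then show "exponential_type_le \<sigma> (comp_op \<phi> f)" unfolding eq
      using exponential_type_le_affine[OF paley_wienerD(2)[OF f], of a \<sigma> b] a \<sigma> by simp
    \<comment> \<open>The complex shift by b is bounded on the space; what remains is a real change
      of scale.\<close>
    have "integrable lborel (\<lambda>t::real. (cmod (f (of_real (0 + a * t) + b)))\<^sup>2)"
      using a sqiD(2)[OF paley_wienerD(3)[OF paley_wiener_translate[OF \<sigma> f, of b]]]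
      by (intro lborel_integrable_real_affine) auto
    then show "sqi (comp_op \<phi> f)" unfolding sqi_def
      using borel_measurable_entire[OF hol] unfolding eq by simp
  qed
  have adj: "pw_adjoint \<sigma> (comp_op \<phi>) (rkernel \<sigma> w) = rkernel \<sigma> (\<phi> w)" for w
  proof (rule pw_adjoint_eqI[OF \<sigma> rkernel_in_paley_wiener[OF \<sigma>]])
    fix f assume f: "f \<in> paley_wiener \<sigma>"
    show "pw_inner (comp_op \<phi> f) (rkernel \<sigma> w) = pw_inner f (rkernel \<sigma> (\<phi> w))"
      unfolding reproducing[OF comp[OF f] \<sigma>] reproducing[OF f \<sigma>] by (simp add: comp_op_def)
  qed
  \<comment> \<open>The fixed point. The orbit of z0 + 1 is z0 + a^n, which differs from z0 as a
    \<noteq> 0.\<close>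
  define z0 where "z0 = b / (1 - of_real a)"
  have "of_real a \<noteq> (1 :: complex)" using a by auto
  then have fix0: "of_real a * z0 + b = z0" by (simp add: z0_def field_simps)
  have orbit: "(pw_adjoint \<sigma> (comp_op \<phi>) ^^ n) (rkernel \<sigma> (z0 + 1)) = rkernel \<sigma> (z0 + of_real (a ^ n))" for n
  proof (induction n)
    case (Suc n)
    have "\<phi> (z0 + of_real (a ^ n)) = (of_real a * z0 + b) + of_real (a ^ Suc n)"
      unfolding \<phi> by (simp add: algebra_simps)
    then show ?case using Suc adj by (simp add: fix0)
  qed simp
  show ?thesis
  proof (rule pw_cyclicI[OF \<sigma>, where f = "rkernel \<sigma> (z0 + 1)"])
    show "(pw_adjoint \<sigma> (comp_op \<phi>) ^^ n) (rkernel \<sigma> (z0 + 1)) \<in> paley_wiener \<sigma>" for n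
      unfolding orbit by (rule rkernel_in_paley_wiener[OF \<sigma>])
    fix h assume h: "h \<in> paley_wiener \<sigma>"
      and orth: "\<And>n. pw_inner h ((pw_adjoint \<sigma> (comp_op \<phi>) ^^ n) (rkernel \<sigma> (z0 + 1))) = 0"
    have zero: "h (z0 + of_real (a ^ n)) = 0" for n
      using orth[of n] unfolding orbit reproducing[OF h \<sigma>] .
    have lp: "z0 islimpt range (\<lambda>n. z0 + of_real (a ^ n))" unfolding islimpt_approachable
    proof (intro allI impI)
      fix e :: real assume "e > 0"
      moreover have "(\<lambda>n. a ^ n) \<longlonglongrightarrow> 0" using a by (intro LIMSEQ_power_zero) simp
      ultimately obtain n where "\<bar>a ^ n\<bar> < e" using LIMSEQ_D[of "\<lambda>n. a ^ n" 0 e] by auto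
      then show "\<exists>x'\<in>range (\<lambda>n. z0 + of_real (a ^ n)). x' \<noteq> z0 \<and> dist x' z0 < e"
        using a by (intro bexI[of _ "z0 + of_real (a ^ n)"]) (auto simp: dist_norm norm_power power_abs)
    qed
    show "h = (\<lambda>z. 0)"
    proof
      fix w show "h w = 0"
        by (rule analytic_continuation[OF paley_wienerD(1)[OF h] open_UNIV connected_UNIV _ _ lp]) (use zero in auto)
    qed
  qed
qed

text \<open>Adjoints are determined on the space only, so they are identified with explicit
  operators just there.\<close>

lemma pw_cyclic_cong:
  assumes TS: "\<And>f. f \<in> paley_wiener \<sigma> \<Longrightarrow> T f = S f" and S: "\<And>f. f \<in> paley_wiener \<sigma> \<Longrightarrow> S f \<in> paley_wiener \<sigma>"
  shows "pw_cyclic \<sigma> T \<longleftrightarrow> pw_cyclic \<sigma> S"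
proof -
  have "(T ^^ n) f = (S ^^ n) f \<and> (S ^^ n) f \<in> paley_wiener \<sigma>" if "f \<in> paley_wiener \<sigma>" for f n
    by (induction n) (use that TS S in auto)
  then show ?thesis unfolding pw_cyclic_def by simp
qed

lemma pw_cyclic_adjoint_translate:
  assumes \<sigma>: "\<sigma> > 0" and \<phi>: "\<phi> = (\<lambda>z. z + b)"
  shows "pw_cyclic \<sigma> (pw_adjoint \<sigma> (comp_op \<phi>)) \<longleftrightarrow> pw_cyclic \<sigma> (comp_op (\<lambda>z. z + (- cnj b)))"
proof (rule pw_cyclic_cong)
  fix g assume g: "g \<in> paley_wiener \<sigma>"
  have eq: "comp_op (\<lambda>z. z + (- cnj b)) g = (\<lambda>z. g (z - cnj b))" by (simp add: comp_op_def o_def)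
  show mem: "comp_op (\<lambda>z. z + (- cnj b)) g \<in> paley_wiener \<sigma>"
    using paley_wiener_translate[OF \<sigma> g, of "- cnj b"] by (simp add: comp_op_def o_def)
  show "pw_adjoint \<sigma> (comp_op \<phi>) g = comp_op (\<lambda>z. z + (- cnj b)) g"
    by (rule pw_adjoint_eqI[OF \<sigma> mem], unfold eq)
       (use pw_inner_translate[OF \<sigma> _ g, of _ b] in \<open>simp add: comp_op_def \<phi> o_def\<close>)
qed

lemma paley_wiener_reflect:
  assumes "f \<in> paley_wiener \<sigma>" "\<sigma> > 0"
  shows "(\<lambda>z. f (- z)) \<in> paley_wiener \<sigma>"
proof (rule paley_wienerI)
  show hol: "(\<lambda>z. f (- z)) holomorphic_on UNIV"
    by (intro holomorphic_on_compose_entire[OF paley_wienerD(1)[OF assms(1)]] holomorphic_intros)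
  show "exponential_type_le \<sigma> (\<lambda>z. f (- z))"
    using exponential_type_le_affine[OF paley_wienerD(2)[OF assms(1)], of "-1" \<sigma> 0] assms(2) by simp
  show "sqi (\<lambda>z. f (- z))" unfolding sqi_def
    using borel_measurable_entire[OF hol] lborel_integrable_real_affine[OF sqiD(2)[OF paley_wienerD(3)[OF assms(1)]], of "-1" 0]
    by simp
qed

lemma pw_inner_reflect: "pw_inner (\<lambda>z. f (- z)) g = pw_inner f (\<lambda>z. g (- z))"
  unfolding pw_inner_def
  using lborel_integral_real_affine[of "-1" "\<lambda>t. f (of_real t) * cnj (g (- of_real t))" 0] by simp

lemma not_pw_cyclic_adjoint_reflection:
  assumes \<sigma>: "\<sigma> > 0" and \<phi>: "\<phi> = (\<lambda>z. - z + b)"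
  shows "\<not> pw_cyclic \<sigma> (pw_adjoint \<sigma> (comp_op \<phi>))"
proof (rule not_pw_cyclic_involution[OF \<sigma>])
  have adj: "pw_adjoint \<sigma> (comp_op \<phi>) g = (\<lambda>z. g (- z + cnj b))" and mem: "(\<lambda>z. g (- z + cnj b)) \<in> paley_wiener \<sigma>"
    if g: "g \<in> paley_wiener \<sigma>" for g
  proof -
    have tg: "(\<lambda>z. g (z + cnj b)) \<in> paley_wiener \<sigma>" by (rule paley_wiener_translate[OF \<sigma> g])
    show mem: "(\<lambda>z. g (- z + cnj b)) \<in> paley_wiener \<sigma>" using paley_wiener_reflect[OF tg \<sigma>] .
    show "pw_adjoint \<sigma> (comp_op \<phi>) g = (\<lambda>z. g (- z + cnj b))"
    proof (rule pw_adjoint_eqI[OF \<sigma> mem])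
      fix f assume f: "f \<in> paley_wiener \<sigma>"
      have "pw_inner (comp_op \<phi> f) g = pw_inner (\<lambda>z. f (- (z + (- b)))) g" by (simp add: comp_op_def \<phi> o_def)
      also have "\<dots> = pw_inner (\<lambda>z. f (- z)) (\<lambda>z. g (z - cnj (- b)))"
        by (rule pw_inner_translate[OF \<sigma> paley_wiener_reflect[OF f \<sigma>] g])
      also have "\<dots> = pw_inner f (\<lambda>z. g (- z - cnj (- b)))" by (rule pw_inner_reflect)
      finally show "pw_inner (comp_op \<phi> f) g = pw_inner f (\<lambda>z. g (- z + cnj b))" by simp
    qed
  qed
  show "pw_adjoint \<sigma> (comp_op \<phi>) (pw_adjoint \<sigma> (comp_op \<phi>) f) = f" if "f \<in> paley_wiener \<sigma>" for f
    unfolding adj[OF that] adj[OF mem[OF that]] by simp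
qed

section \<open>Supercyclicity of translations\<close>

lemma not_supercyclic_zero:
  assumes "\<sigma> > 0" "pw_norm f = 0" "f \<in> paley_wiener \<sigma>" and \<phi>: "\<phi> = (\<lambda>z. z + b)"
  shows "\<not> pw_dense \<sigma> {(\<lambda>z. c * (comp_op \<phi> ^^ n) f z) | c n. True}"
proof (rule not_pw_dense_two_dim[OF assms(1), where f = f and g = f])
  have f0: "f = (\<lambda>z. 0)" by (rule paley_wiener_norm_eq_0[OF assms(3,1,2)])
  fix x assume "x \<in> {(\<lambda>z. c * (comp_op \<phi> ^^ n) f z) | c n. True}"
  then have "x = (\<lambda>z. 0)" unfolding comp_op_translate_funpow[OF \<phi>] f0 by auto
  then show "\<exists>\<alpha> \<beta>. x = (\<lambda>z. \<alpha> * f z + \<beta> * f z)" by (simp add: f0)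
qed

lemma pw_norm_tendsto:
  assumes "\<And>n. sqi (f n)" "sqi g" "(\<lambda>n. pw_norm (\<lambda>z. f n z - g z)) \<longlonglongrightarrow> 0"
  shows "(\<lambda>n. pw_norm (f n)) \<longlonglongrightarrow> pw_norm g"
proof (rule LIM_zero_cancel, rule Lim_null_comparison[OF _ assms(3)])
  show "\<forall>\<^sub>F n in sequentially. norm (pw_norm (f n) - pw_norm g) \<le> pw_norm (\<lambda>z. f n z - g z)"
    using pw_norm_le_diff[OF assms(1,2)] by (intro always_eventually) simp
qed

lemma pw_inner_tendsto:
  assumes f: "\<And>n. sqi (f n)" "sqi g" "(\<lambda>n. pw_norm (\<lambda>z. f n z - g z)) \<longlonglongrightarrow> 0"
    and f': "\<And>n. sqi (f' n)" "sqi g'" "(\<lambda>n. pw_norm (\<lambda>z. f' n z - g' z)) \<longlonglongrightarrow> 0"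
  shows "(\<lambda>n. pw_inner (f n) (f' n)) \<longlonglongrightarrow> pw_inner g g'"
proof (rule LIM_zero_cancel, rule Lim_null_comparison)
  show "\<forall>\<^sub>F n in sequentially. norm (pw_inner (f n) (f' n) - pw_inner g g')
      \<le> pw_norm (\<lambda>z. f n z - g z) * pw_norm (f' n) + pw_norm g * pw_norm (\<lambda>z. f' n z - g' z)"
  proof (intro always_eventually allI)
    fix n
    have "pw_inner (f n) (f' n) - pw_inner g g' = pw_inner (\<lambda>z. f n z - g z) (f' n) + pw_inner g (\<lambda>z. f' n z - g' z)"
      using f f' by (simp add: pw_inner_diff_left pw_inner_diff_right)
    then show "norm (pw_inner (f n) (f' n) - pw_inner g g')
      \<le> pw_norm (\<lambda>z. f n z - g z) * pw_norm (f' n) + pw_norm g * pw_norm (\<lambda>z. f' n z - g' z)"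
      using f f' by (simp add: norm_triangle_le add_mono pw_inner_cauchy_schwarz sqi_diff)
  qed
  have "(\<lambda>n. pw_norm (\<lambda>z. f n z - g z) * pw_norm (f' n) + pw_norm g * pw_norm (\<lambda>z. f' n z - g' z)) \<longlonglongrightarrow> 0 * pw_norm g' + pw_norm g * 0"
    by (intro tendsto_intros f f' pw_norm_tendsto)
  then show "(\<lambda>n. pw_norm (\<lambda>z. f n z - g z) * pw_norm (f' n) + pw_norm g * pw_norm (\<lambda>z. f' n z - g' z)) \<longlonglongrightarrow> 0" by simp
qed

text \<open>A real shift preserves the normalised autocorrelation \<open>\<langle>u(\<cdot> + c), u\<rangle> / \<parallel>u\<parallel>\<^sup>2\<close>, which however is not the
  same for all \<open>u\<close>.\<close>

lemma not_pw_supercyclic_translate_real: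
  assumes \<sigma>: "\<sigma> > 0" and \<phi>: "\<phi> = (\<lambda>z. z + complex_of_real b)"
  shows "\<not> pw_supercyclic \<sigma> (comp_op \<phi>)"
proof
  assume "pw_supercyclic \<sigma> (comp_op \<phi>)"
  then obtain f where f: "f \<in> paley_wiener \<sigma>" and d: "pw_dense \<sigma> {(\<lambda>z. c * (comp_op \<phi> ^^ n) f z) | c n. True}" (is "pw_dense \<sigma> ?D")
    unfolding pw_supercyclic_def by blast
  \<comment> \<open>The spacing at which the kernels e i are orthogonal, so that their
    autocorrelations can be read off.\<close>
  define r where "r = pi / \<sigma>"
  define A where "A = (\<lambda>u. pw_inner (\<lambda>z. u (z + of_real r)) u)"
  define N where "N = (\<lambda>u. complex_of_real ((pw_norm u)\<^sup>2))"
  have D: "A u * N f = A f * N u" if "u \<in> ?D" for u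
  proof -
    obtain c n where u: "u = (\<lambda>z. c * f (z + of_real (real n * b)))"
      using \<open>u \<in> ?D\<close> unfolding comp_op_translate_funpow[OF \<phi>] by auto
    have "A u = c * cnj c * pw_inner (\<lambda>z. f (z + of_real r + of_real (real n * b))) (\<lambda>z. f (z + of_real (real n * b)))"
      unfolding A_def u pw_inner_scale_left pw_inner_scale_right by simp
    also have "pw_inner (\<lambda>z. f (z + of_real r + of_real (real n * b))) (\<lambda>z. f (z + of_real (real n * b))) = A f"
      unfolding A_def using pw_inner_translate_real[of "\<lambda>z. f (z + of_real r)" "real n * b" f] by (simp only: add.assoc add.commute add.left_commute)
    finally have "A u = c * cnj c * A f" .
    moreover have "N u = c * cnj c * N f"
      unfolding N_def u pw_norm_scale pw_norm_translate_real
      using complex_norm_square[of c] by (simp add: power_mult_distrib)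
    ultimately show ?thesis by simp
  qed
  have all: "A u * N f = A f * N u" if u: "u \<in> paley_wiener \<sigma>" for u
  proof -
    obtain s where s: "\<And>n. s n \<in> ?D" "\<And>n. s n \<in> paley_wiener \<sigma>" "(\<lambda>n. pw_norm (\<lambda>z. s n z - u z)) \<longlonglongrightarrow> 0"
      by (rule pw_denseD[OF d u]) (assumption | rule that)+
    note ss = paley_wienerD(3)[OF s(2)] and su = paley_wienerD(3)[OF u]
    have "(\<lambda>n. A (s n)) \<longlonglongrightarrow> A u" unfolding A_def
    proof (rule pw_inner_tendsto[OF _ _ _ ss su s(3)])
      show "sqi (\<lambda>z. s n (z + of_real r))" for n by (rule paley_wienerD(3)[OF paley_wiener_translate[OF \<sigma> s(2)]])
      show "sqi (\<lambda>z. u (z + of_real r))" by (rule paley_wienerD(3)[OF paley_wiener_translate[OF \<sigma> u]])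
      show "(\<lambda>n. pw_norm (\<lambda>z. s n (z + of_real r) - u (z + of_real r))) \<longlonglongrightarrow> 0"
        using s(3) pw_norm_translate_real[of "\<lambda>z. s _ z - u z" r] by simp
    qed
    moreover have "(\<lambda>n. N (s n)) \<longlonglongrightarrow> N u" unfolding N_def
      by (intro tendsto_intros pw_norm_tendsto ss su s(3))
    ultimately have "(\<lambda>n. A (s n) * N f - A f * N (s n)) \<longlonglongrightarrow> A u * N f - A f * N u"
      by (intro tendsto_intros)
    then show ?thesis by (simp add: D[OF s(1)] LIMSEQ_const_iff)
  qed
  define e where "e = (\<lambda>i::int. rkernel \<sigma> (of_real (real_of_int i * r)))"
  have ep: "e i \<in> paley_wiener \<sigma>" for i unfolding e_def by (rule rkernel_in_paley_wiener[OF \<sigma>])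
  note se = paley_wienerD(3)[OF ep]
  have inner: "pw_inner (e i) (e j) = (if i = j then of_real (\<sigma> / pi) else 0)" for i j
    unfolding e_def reproducing[OF rkernel_in_paley_wiener[OF \<sigma>] \<sigma>] r_def by (rule rkernel_lattice[OF \<sigma>])
  have shift: "(\<lambda>z. e i (z + of_real r)) = e (i - 1)" for i
    unfolding e_def rkernel_translate by (rule arg_cong[of _ _ "rkernel \<sigma>"]) (simp add: algebra_simps)
  \<comment> \<open>The autocorrelation of e 0 is zero, which forces A f = 0; that of e 0 + e 1 is
    not, which then forces f to have norm 0.\<close>
  have "A (e 0) = 0" unfolding A_def shift inner by simp
  then have "A f * N (e 0) = 0" using all[OF ep[of 0]] by simp
  moreover have "N (e 0) = of_real (\<sigma> / pi)" unfolding N_def pw_inner_self[symmetric] inner by simp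
  ultimately have Af: "A f = 0" using \<sigma> by simp
  let ?u = "\<lambda>z. e 0 z + e 1 z"
  have "A ?u = pw_inner (\<lambda>z. e (- 1) z + e 0 z) ?u"
    unfolding A_def using fun_cong[OF shift[of 0]] fun_cong[OF shift[of 1]] by simp
  also have "\<dots> = of_real (\<sigma> / pi)"
    using se by (simp add: pw_inner_add_left pw_inner_add_right sqi_add inner)
  finally have "N f = 0" using all[OF paley_wiener_add[OF ep[of 0] ep[of 1]]] Af \<sigma> by simp
  then have "pw_norm f = 0" by (simp add: N_def)
  then show False using not_supercyclic_zero[OF \<sigma> _ f \<phi>] d by blast
qed

text \<open>A complex shift \<open>T\<close> is normal, so \<open>\<parallel>T\<^sup>n\<^sup>+\<^sup>1 f\<parallel> / \<parallel>T\<^sup>n f\<parallel>\<close> increases with \<open>n\<close>. If \<open>f\<close> is supercyclic, it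
  therefore minimises \<open>\<parallel>T x\<parallel> / \<parallel>x\<parallel>\<close> and is an eigenvector of \<open>T\<^sup>* T\<close>, which is a purely imaginary shift; by
  density all \<open>x\<close> are.\<close>

lemma not_pw_supercyclic_translate_nonreal:
  assumes \<sigma>: "\<sigma> > 0" and b: "Im b \<noteq> 0" and \<phi>: "\<phi> = (\<lambda>z. z + b)"
  shows "\<not> pw_supercyclic \<sigma> (comp_op \<phi>)"
proof
  assume "pw_supercyclic \<sigma> (comp_op \<phi>)"
  then obtain f where f: "f \<in> paley_wiener \<sigma>" and d: "pw_dense \<sigma> {(\<lambda>z. c * (comp_op \<phi> ^^ n) f z) | c n. True}" (is "pw_dense \<sigma> ?D")
    unfolding pw_supercyclic_def by blast
  define T where "T = (\<lambda>(u::complex \<Rightarrow> complex) z. u (z + b))"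
  define T' where "T' = (\<lambda>(u::complex \<Rightarrow> complex) z. u (z - cnj b))"
  have Tp: "T u \<in> paley_wiener \<sigma>" and T'p: "T' u \<in> paley_wiener \<sigma>" if "u \<in> paley_wiener \<sigma>" for u
    using paley_wiener_translate[OF \<sigma> that, of b] paley_wiener_translate[OF \<sigma> that, of "- cnj b"]
    by (simp_all add: T_def T'_def)
  have adj: "pw_inner (T u) v = pw_inner u (T' v)" if "u \<in> paley_wiener \<sigma>" "v \<in> paley_wiener \<sigma>" for u v
    unfolding T_def T'_def by (rule pw_inner_translate[OF \<sigma> that])
  have adj': "pw_inner (T' u) v = pw_inner u (T v)" if "u \<in> paley_wiener \<sigma>" "v \<in> paley_wiener \<sigma>" for u v
    using adj[OF that(2,1)] pw_inner_commute[of "T' u" v] pw_inner_commute[of u "T v"] by simp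
  have TT': "T (T' u) = T' (T u)" for u by (simp add: T_def T'_def algebra_simps)
  have normal: "pw_norm (T' u) = pw_norm (T u)" if u: "u \<in> paley_wiener \<sigma>" for u
  proof -
    have "pw_inner (T' u) (T' u) = pw_inner (T u) (T u)"
      using adj'[OF u T'p[OF u]] adj[OF u Tp[OF u]] by (simp add: TT')
    then have "(pw_norm (T' u))\<^sup>2 = (pw_norm (T u))\<^sup>2" unfolding pw_inner_self of_real_eq_iff .
    then show ?thesis by (rule power2_eq_imp_eq) auto
  qed
  \<comment> \<open>Normality enters here: the norm of T' (T u) equals that of T (T u), which makes
    the norms along an orbit logarithmically convex.\<close>
  have convex: "(pw_norm (T u))\<^sup>2 \<le> pw_norm u * pw_norm (T (T u))" if u: "u \<in> paley_wiener \<sigma>" for u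
  proof -
    have "(pw_norm (T u))\<^sup>2 = cmod (pw_inner (T u) (T u))" unfolding pw_inner_self norm_of_real by simp
    also have "\<dots> = cmod (pw_inner u (T' (T u)))" by (simp add: adj[OF u Tp[OF u]])
    also have "\<dots> \<le> pw_norm u * pw_norm (T' (T u))"
      by (rule pw_inner_cauchy_schwarz[OF paley_wienerD(3)[OF u] paley_wienerD(3)[OF T'p[OF Tp[OF u]]]])
    finally show ?thesis by (simp add: normal[OF Tp[OF u]])
  qed
  have orb: "(comp_op \<phi> ^^ n) f = (T ^^ n) f" for n
    by (induction n) (auto simp: comp_op_def \<phi> T_def o_def)
  have orbp: "(T ^^ n) f \<in> paley_wiener \<sigma>" for n by (induction n) (auto intro: f Tp)
  \<comment> \<open>The comparison of quotients is written without division, since norms may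
    vanish.\<close>
  have mono: "pw_norm (T f) * pw_norm ((T ^^ n) f) \<le> pw_norm f * pw_norm ((T ^^ Suc n) f)" for n
  proof (induction n)
    case (Suc n)
    define A B C where "A = pw_norm ((T ^^ n) f)" and "B = pw_norm ((T ^^ Suc n) f)" and "C = pw_norm ((T ^^ Suc (Suc n)) f)"
    have AB: "B\<^sup>2 \<le> A * C" unfolding A_def B_def C_def using convex[OF orbp[of n]] by simp
    have nn: "A \<ge> 0" "B \<ge> 0" "C \<ge> 0" by (auto simp: A_def B_def C_def)
    have IH: "pw_norm (T f) * A \<le> pw_norm f * B" using Suc by (simp only: A_def B_def)
    have "pw_norm (T f) * B \<le> pw_norm f * C"
    proof (cases "A = 0")
      case True
      then show ?thesis using AB nn by simp
    next
      case False
      have "A * (pw_norm (T f) * B) = (pw_norm (T f) * A) * B" by simp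
      also have "\<dots> \<le> pw_norm f * B * B" using IH nn by (intro mult_right_mono) auto
      also have "\<dots> = pw_norm f * B\<^sup>2" by (simp add: power2_eq_square)
      also have "\<dots> \<le> pw_norm f * (A * C)" using AB by (intro mult_left_mono) auto
      also have "\<dots> = A * (pw_norm f * C)" by simp
      finally show ?thesis using False nn by simp
    qed
    then show ?case by (simp only: B_def C_def)
  qed simp
  obtain M where M: "\<And>u. u \<in> paley_wiener \<sigma> \<Longrightarrow> pw_norm (T u) \<le> M * pw_norm u"
    using translate_bounded[OF \<sigma>, of b] unfolding T_def by blast
  have Tscale: "T (\<lambda>z. c * u z) = (\<lambda>z. c * T u z)" for c u by (simp add: T_def)
  have min: "pw_norm (T f) * pw_norm x \<le> pw_norm f * pw_norm (T x)" if x: "x \<in> paley_wiener \<sigma>" for x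
  proof -
    obtain s where s: "\<And>n. s n \<in> ?D" "\<And>n. s n \<in> paley_wiener \<sigma>" "(\<lambda>n. pw_norm (\<lambda>z. s n z - x z)) \<longlonglongrightarrow> 0"
      by (rule pw_denseD[OF d x]) (assumption | rule that)+
    have sD: "pw_norm (T f) * pw_norm (s n) \<le> pw_norm f * pw_norm (T (s n))" for n
    proof -
      obtain c k where "s n = (\<lambda>z. c * (T ^^ k) f z)" using s(1)[of n] unfolding orb by auto
      then show ?thesis
        using mult_left_mono[OF mono[of k], of "cmod c"] by (simp add: Tscale pw_norm_scale mult_ac)
    qed
    have Tlim: "(\<lambda>n. pw_norm (\<lambda>z. T (s n) z - T x z)) \<longlonglongrightarrow> 0"
    proof (rule Lim_null_comparison)
      have "pw_norm (\<lambda>z. T (s n) z - T x z) \<le> M * pw_norm (\<lambda>z. s n z - x z)" for n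
        using M[OF paley_wiener_diff[OF s(2)[of n] x]] by (simp add: T_def)
      then show "\<forall>\<^sub>F n in sequentially. norm (pw_norm (\<lambda>z. T (s n) z - T x z)) \<le> M * pw_norm (\<lambda>z. s n z - x z)"
        by (intro always_eventually) simp
      show "(\<lambda>n. M * pw_norm (\<lambda>z. s n z - x z)) \<longlonglongrightarrow> 0" by (rule tendsto_mult_right_zero[OF s(3)])
    qed
    show ?thesis
    proof (rule LIMSEQ_le)
      show "(\<lambda>n. pw_norm (T f) * pw_norm (s n)) \<longlonglongrightarrow> pw_norm (T f) * pw_norm x"
        by (intro tendsto_intros pw_norm_tendsto paley_wienerD(3)[OF s(2)] paley_wienerD(3)[OF x] s(3))
      show "(\<lambda>n. pw_norm f * pw_norm (T (s n))) \<longlonglongrightarrow> pw_norm f * pw_norm (T x)"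
        by (intro tendsto_intros pw_norm_tendsto paley_wienerD(3)[OF Tp[OF s(2)]] paley_wienerD(3)[OF Tp[OF x]] Tlim)
      show "\<exists>N. \<forall>n\<ge>N. pw_norm (T f) * pw_norm (s n) \<le> pw_norm f * pw_norm (T (s n))" using sD by blast
    qed
  qed
  define F G where "F = (pw_norm f)\<^sup>2" and "G = (pw_norm (T f))\<^sup>2"
  note sf = paley_wienerD(3)[OF f] and sTf = paley_wienerD(3)[OF Tp[OF f]]
  \<comment> \<open>First variation: F \<parallel>T y\<parallel>^2 - G \<parallel>y\<parallel>^2 is
    nonnegative on the space and zero at y = f. If the derivative along x did not vanish, a small
    multiple t q of x, subtracted from f, would make the expression negative.\<close>
  have crit: "of_real F * pw_inner (T f) (T x) = of_real G * pw_inner f x" if x: "x \<in> paley_wiener \<sigma>" for x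
  proof (rule ccontr)
    note sx = paley_wienerD(3)[OF x] and sTx = paley_wienerD(3)[OF Tp[OF x]]
    define q where "q = of_real F * pw_inner (T f) (T x) - of_real G * pw_inner f x"
    assume "\<not> ?thesis"
    then have q: "(cmod q)\<^sup>2 > 0" by (simp add: q_def)
    define X where "X = F * (pw_norm (T x))\<^sup>2"
    have X: "X \<ge> 0" by (simp add: X_def F_def)
    define t where "t = 1 / (X + 1)"
    have t: "t > 0" "t * X < 1" using X by (auto simp: t_def add_nonneg_pos divide_less_eq)
    define c where "c = of_real t * q"
    let ?y = "\<lambda>z. f z - c * x z"
    have y: "?y \<in> paley_wiener \<sigma>" by (intro paley_wiener_diff paley_wiener_scale f x)
    have "(pw_norm (T f) * pw_norm ?y)\<^sup>2 \<le> (pw_norm f * pw_norm (T ?y))\<^sup>2" using min[OF y] by (intro power_mono) auto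
    then have "G * (pw_norm ?y)\<^sup>2 \<le> F * (pw_norm (T ?y))\<^sup>2" by (simp only: power_mult_distrib F_def G_def)
    also have "T ?y = (\<lambda>z. T f z - c * T x z)" by (simp add: T_def)
    also have "(pw_norm (\<lambda>z. T f z - c * T x z))\<^sup>2 = G - 2 * Re (cnj c * pw_inner (T f) (T x)) + (cmod c)\<^sup>2 * (pw_norm (T x))\<^sup>2"
      unfolding pw_norm_diff_sq[OF sTf sqi_scale[OF sTx]] pw_inner_scale_right pw_norm_scale power_mult_distrib G_def ..
    also have "(pw_norm ?y)\<^sup>2 = F - 2 * Re (cnj c * pw_inner f x) + (cmod c)\<^sup>2 * (pw_norm x)\<^sup>2"
      unfolding pw_norm_diff_sq[OF sf sqi_scale[OF sx]] pw_inner_scale_right pw_norm_scale power_mult_distrib F_def ..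
    finally have "G * (cmod c)\<^sup>2 * (pw_norm x)\<^sup>2 + 2 * (F * Re (cnj c * pw_inner (T f) (T x)) - G * Re (cnj c * pw_inner f x)) \<le> (cmod c)\<^sup>2 * X"
      by (simp add: X_def algebra_simps)
    note quad = this
    have "F * Re (cnj c * pw_inner (T f) (T x)) - G * Re (cnj c * pw_inner f x) = Re (cnj c * q)"
      by (simp add: q_def algebra_simps)
    from quad[unfolded this] have "G * (cmod c)\<^sup>2 * (pw_norm x)\<^sup>2 + 2 * Re (cnj c * q) \<le> (cmod c)\<^sup>2 * X" .
    moreover have "0 \<le> G * (cmod c)\<^sup>2 * (pw_norm x)\<^sup>2" by (simp add: G_def)
    ultimately have "2 * Re (cnj c * q) \<le> (cmod c)\<^sup>2 * X" by linarith
    moreover have "Re (cnj c * q) = t * (cmod q)\<^sup>2"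
    proof -
      have "q * cnj q = of_real ((cmod q)\<^sup>2)" by (rule complex_norm_square[symmetric])
      then have "cnj c * q = of_real (t * (cmod q)\<^sup>2)" by (simp add: c_def mult_ac)
      then show ?thesis by (simp only: Re_complex_of_real)
    qed
    moreover have "(cmod c)\<^sup>2 * X = t * (cmod q)\<^sup>2 * (t * X)"
      using t by (simp add: c_def norm_mult power2_eq_square)
    moreover have "t * (cmod q)\<^sup>2 * (t * X) \<le> t * (cmod q)\<^sup>2 * 1" using t q by (intro mult_left_mono) auto
    ultimately show False using mult_pos_pos[OF t(1) q] by linarith
  qed
  \<comment> \<open>With the kernel at w for x, the critical equation becomes a pointwise relation
    between f at w and at w shifted by the imaginary number b - cnj b.\<close>
  have eigf: "of_real F * f (w + (b - cnj b)) = of_real G * f w" for w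
  proof -
    note kp = rkernel_in_paley_wiener[OF \<sigma>, of w]
    have "T (rkernel \<sigma> w) = rkernel \<sigma> (w - cnj b)" unfolding T_def by (rule ext) (rule rkernel_translate)
    then have "pw_inner (T f) (T (rkernel \<sigma> w)) = f (w + (b - cnj b))"
      using reproducing[OF Tp[OF f] \<sigma>, of "w - cnj b"] by (simp add: T_def algebra_simps)
    then show ?thesis using crit[OF kp] reproducing[OF f \<sigma>, of w] by simp
  qed
  have eig: "of_real F * x (w + (b - cnj b)) = of_real G * x w" if x: "x \<in> paley_wiener \<sigma>" for x w
  proof -
    obtain s where s: "\<And>n. s n \<in> ?D" "\<And>n. s n \<in> paley_wiener \<sigma>" "(\<lambda>n. pw_norm (\<lambda>z. s n z - x z)) \<longlonglongrightarrow> 0"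
      by (rule pw_denseD[OF d x]) (assumption | rule that)+
    have "of_real F * s n (w + (b - cnj b)) - of_real G * s n w = 0" for n
    proof -
      obtain c k where "s n = (\<lambda>z. c * f (z + of_nat k * b))"
        using s(1)[of n] unfolding comp_op_translate_funpow[OF \<phi>] by auto
      then show ?thesis
        using arg_cong[OF eigf[of "w + of_nat k * b"], of "\<lambda>v. c * v"] by (simp add: algebra_simps)
    qed
    moreover have "(\<lambda>n. of_real F * s n (w + (b - cnj b)) - of_real G * s n w) \<longlonglongrightarrow> of_real F * x (w + (b - cnj b)) - of_real G * x w"
      by (intro tendsto_intros paley_wiener_tendsto_pointwise[OF s(2) x \<sigma> s(3)])
    ultimately show ?thesis by (simp add: LIMSEQ_const_iff)
  qed
  \<comment> \<open>All zeros of the kernel at 0 are real. It vanishes at \<pi> / \<sigma> but not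
    at the nonreal shifted point, so the relation forces F = 0.\<close>
  have "rkernel \<sigma> 0 (of_real (pi / \<sigma>)) = 0" using rkernel_lattice[OF \<sigma>, of 0 1] by simp
  moreover have "rkernel \<sigma> 0 (of_real (pi / \<sigma>) + (b - cnj b)) \<noteq> 0"
  proof -
    have "sin (of_real \<sigma> * (of_real (pi / \<sigma>) + (b - cnj b))) \<noteq> 0"
      unfolding sin_eq_0 using \<sigma> b by (auto simp: complex_eq_iff)
    then show ?thesis using \<sigma> by (auto simp: rkernel_def csinc_def)
  qed
  ultimately have "complex_of_real F = 0"
    using eig[OF rkernel_in_paley_wiener[OF \<sigma>, of 0], of "of_real (pi / \<sigma>)"] by simp
  then have "pw_norm f = 0" by (simp add: F_def)
  then show False using not_supercyclic_zero[OF \<sigma> _ f \<phi>] d by blast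
qed

section \<open>The classification\<close>

lemma pw_cyclic_translate_iff:
  assumes \<sigma>: "\<sigma> > 0"
  shows "pw_cyclic \<sigma> (comp_op (\<lambda>z. z + b)) \<longleftrightarrow> b \<notin> \<real> \<or> (b \<in> \<real> \<and> 0 < cmod b \<and> cmod b \<le> pi / \<sigma>)"
proof (cases "b \<in> \<real>")
  case False
  then have "Im b \<noteq> 0" by (simp add: complex_is_Real_iff)
  then show ?thesis using pw_cyclic_translate_nonreal[OF \<sigma>] False by blast
next
  case True
  then obtain r where r: "b = complex_of_real r" by (auto elim: Reals_cases)
  have "\<not> pw_cyclic \<sigma> (comp_op (\<lambda>z. z + b))" if "r = 0"
    by (rule not_pw_cyclic_involution[OF \<sigma>]) (simp add: comp_op_def r that fun_eq_iff)
  then show ?thesis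
    using pw_cyclic_translate_real[OF \<sigma>, of r] not_pw_cyclic_translate_large[OF \<sigma>, of r] True
    unfolding r by (cases "\<bar>r\<bar> \<le> pi / \<sigma>") auto
qed

theorem theorem3p3:
  fixes \<sigma> a :: real and b :: complex and \<phi> :: "complex \<Rightarrow> complex"
  assumes "\<sigma> > 0" and "0 < \<bar>a\<bar>" and "\<bar>a\<bar> \<le> 1"
    and "\<phi> = (\<lambda>z. complex_of_real a * z + b)"
  shows "(pw_cyclic \<sigma> (comp_op \<phi>) \<longleftrightarrow>
            a = 1 \<and> (b \<notin> \<real> \<or> (b \<in> \<real> \<and> 0 < cmod b \<and> cmod b \<le> pi / \<sigma>)))
       \<and> \<not> pw_supercyclic \<sigma> (comp_op \<phi>)
       \<and> (pw_cyclic \<sigma> (pw_adjoint \<sigma> (comp_op \<phi>)) \<longleftrightarrow>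
            (0 < \<bar>a\<bar> \<and> \<bar>a\<bar> < 1) \<or> pw_cyclic \<sigma> (comp_op \<phi>))"
proof -
  note \<sigma> = assms(1)
  consider "\<bar>a\<bar> < 1" | "a = -1" | "a = 1" using assms(3) by linarith
  then show ?thesis
  proof cases
    case 1
    have "\<not> pw_cyclic \<sigma> (comp_op \<phi>)" by (rule not_pw_cyclic_contraction[OF \<sigma> assms(2) 1 assms(4)])
    moreover have "pw_cyclic \<sigma> (pw_adjoint \<sigma> (comp_op \<phi>))"
      by (rule pw_cyclic_adjoint_contraction[OF \<sigma> assms(2) 1 assms(4)])
    ultimately show ?thesis using pw_supercyclic_imp_cyclic 1 assms(2) by auto
  next
    case 2
    then have \<phi>: "\<phi> = (\<lambda>z. - z + b)" using assms(4) by simp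
    have "\<not> pw_cyclic \<sigma> (comp_op \<phi>)"
      by (rule not_pw_cyclic_involution[OF \<sigma>]) (simp add: comp_op_def \<phi> fun_eq_iff)
    moreover have "\<not> pw_cyclic \<sigma> (pw_adjoint \<sigma> (comp_op \<phi>))"
      by (rule not_pw_cyclic_adjoint_reflection[OF \<sigma> \<phi>])
    ultimately show ?thesis using pw_supercyclic_imp_cyclic 2 by auto
  next
    case 3
    then have \<phi>: "\<phi> = (\<lambda>z. z + b)" using assms(4) by simp
    have "\<not> pw_supercyclic \<sigma> (comp_op \<phi>)"
    proof (cases "b \<in> \<real>")
      case True
      then obtain r where "b = complex_of_real r" by (auto elim: Reals_cases)
      then show ?thesis using not_pw_supercyclic_translate_real[OF \<sigma>] \<phi> by simp
    next
      case False
      then show ?thesis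
        using not_pw_supercyclic_translate_nonreal[OF \<sigma> _ \<phi>] by (simp add: complex_is_Real_iff)
    qed
    \<comment> \<open>The condition on b is invariant under passing to minus the conjugate, hence
      the same for the adjoint shift.\<close>
    moreover have "- cnj b \<in> \<real> \<longleftrightarrow> b \<in> \<real>" by (simp add: complex_is_Real_iff)
    ultimately show ?thesis
      unfolding pw_cyclic_adjoint_translate[OF \<sigma> \<phi>] pw_cyclic_translate_iff[OF \<sigma>] unfolding \<phi> pw_cyclic_translate_iff[OF \<sigma>]
      using 3 by simp
  qed
qed

end
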